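(* Let $X=X(P,\lambda)$ be an orientable $3$-dimensional small cover with Hamiltonian characteristic function $\lambda$, let $G$ be its orientation-preserving subgroup, and let $g\in G$ be such that $X/\langle g\rangle\cong S^3$, so that $X\to X/\langle g\rangle$ is a $2$-fold branched covering with branching along a link $L$. Then every knot component of $L$ is trivial and corresponds to a chord of the linear chord diagram $D_C$; moreover, two knot components of $L$ are linked if and only if the corresponding chords in $D_C$ intersect.
   Context: $P$ is a simple $3$-polytope with facets $F_i$; $\lambda$ maps facets to $\mathbb{Z}_2^3$, $\lambda_i=\lambda(F_i)$, such that for every face $F=F_{i_1}\cap\dots\cap F_{i_k}$ the $\lambda_{i_1},\dots,\lambda_{i_k}$ are linearly independent. $X(P,\lambda)=P\times\mathbb{Z}_2^3/\!\sim$, $(p,u)\sim(q,v)$ iff $p=q$ and $v-u$ lies in the subgroup generated by the $\lambda_i$ over facets containing $p$; $\mathbb{Z}_2^3$ acts by translation; $\pi\colon X\to P$ is the projection. $G$ is the subgroup of orientation-preserving elements; for each edge $I=F_i\cap F_j$, $\lambda_i+\lambda_j\in G$ and the circle $X_I=\pi^{-1}(I)$ is fixed pointwise by $\lambda_i+\lambda_j$. $\lambda$ is Hamiltonian if there is a Hamiltonian cycle in the $1$-skeleton of $P$ (dividing $\partial P$ into two disks) and a splitting of $\operatorname{im}\lambda=\{a,b,c,a+b+c\}$ ($a,b,c$ a basis) into two $2$-element subsets with facets of one disk taking values in the first subset and facets of the other disk in the second. For $g$ as in the claim, the edges $I=F_i\cap F_j$ with $\lambda_i+\lambda_j\neq g$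 form a Hamiltonian cycle $C$ of $P$, and the components of $L$ are the images in $X/\langle g\rangle$ of the circles $X_I$ for the edges $I\notin C$. Linear chord diagram $D_C$: remove one edge from $C$ to get a Hamiltonian path, number the $2l$ vertices $1,\dots,2l$ consecutively along it; the chords are the edges $\{i,j\}$ ($i<j$) of $P$ not in $C$. Chords $\{i_1,j_1\}$ and $\{i_2,j_2\}$ intersect iff $i_1<i_2<j_1<j_2$ or $i_2<i_1<j_2<j_1$. Two components are linked if the two-component sublink they form is not split. *)

theory Defs
  imports "HOL-Analysis.Analysis" "HOL-Homology.Homology" "HOL-Library.Z2"
begin

definition z2_indep :: "('f \<Rightarrow> bit^3) \<Rightarrow> 'f set \<Rightarrow> bool" where
  "z2_indep lam S \<longleftrightarrow> finite S \<and> inj_on lam S \<and>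
     (\<forall>T\<subseteq>S. T \<noteq> {} \<longrightarrow> (\<Sum>F\<in>T. lam F) \<noteq> 0)"

definition p_vertices :: "(real^3) set \<Rightarrow> (real^3) set" where
  "p_vertices P = {v. v extreme_point_of P}"

definition p_facets :: "(real^3) set \<Rightarrow> (real^3) set set" where
  "p_facets P = {F. F facet_of P}"

definition p_edges :: "(real^3) set \<Rightarrow> (real^3) set set" where
  "p_edges P = {I. I face_of P \<and> aff_dim I = 1}"

definition simple_3polytope :: "(real^3) set \<Rightarrow> bool" where
  "simple_3polytope P \<longleftrightarrow> polytope P \<and> aff_dim P = 3 \<and>
     (\<forall>v\<in>p_vertices P. card {F\<in>p_facets P. v \<in> F} = 3)"

definition char_fun :: "(real^3) set \<Rightarrow> ((real^3) set \<Rightarrow> bit^3) \<Rightarrow> bool" where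
  "char_fun P lam \<longleftrightarrow> (\<forall>F. F face_of P \<and> F \<noteq> {} \<and> F \<noteq> P \<longrightarrow>
       z2_indep lam {G\<in>p_facets P. F \<subseteq> G})"

definition sc_rel :: "(real^3) set \<Rightarrow> ((real^3) set \<Rightarrow> bit^3) \<Rightarrow>
    ((real^3) \<times> (bit^3)) \<Rightarrow> ((real^3) \<times> (bit^3)) \<Rightarrow> bool" where
  "sc_rel P lam x y \<longleftrightarrow> fst x \<in> P \<and> fst y \<in> P \<and> fst x = fst y \<and>
     snd y - snd x \<in> {(\<Sum>F\<in>T. lam F) | T. T \<subseteq> {F\<in>p_facets P. fst x \<in> F}}"

definition small_cover_quot :: "(real^3) set \<Rightarrow> ((real^3) set \<Rightarrow> bit^3) \<Rightarrow>
    'x topology \<Rightarrow> ((real^3) \<times> (bit^3) \<Rightarrow> 'x) \<Rightarrow> bool" where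
  "small_cover_quot P lam Xt q \<longleftrightarrow>
     quotient_map (prod_topology (top_of_set P) (discrete_topology UNIV)) Xt q \<and>
     (\<forall>x y. fst x \<in> P \<longrightarrow> fst y \<in> P \<longrightarrow> (q x = q y \<longleftrightarrow> sc_rel P lam x y))"

definition sc_act :: "(real^3) set \<Rightarrow> ((real^3) \<times> (bit^3) \<Rightarrow> 'x) \<Rightarrow> bit^3 \<Rightarrow> 'x \<Rightarrow> 'x" where
  "sc_act P q u x = (SOME y. \<exists>p v. p \<in> P \<and> x = q (p, v) \<and> y = q (p, v + u))"

text \<open>Orientability of the closed connected 3-manifold X: H_3(X;Z) = Z.\<close>
definition orientable3 :: "'x topology \<Rightarrow> bool" where
  "orientable3 Xt \<longleftrightarrow> homology_group 3 Xt \<cong> integer_group"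

definition orient_pres :: "(real^3) set \<Rightarrow> 'x topology \<Rightarrow> ((real^3) \<times> (bit^3) \<Rightarrow> 'x) \<Rightarrow>
    bit^3 \<Rightarrow> bool" where
  "orient_pres P Xt q u \<longleftrightarrow>
     (\<forall>c\<in>carrier (homology_group 3 Xt). hom_induced 3 Xt {} Xt {} (sc_act P q u) c = c)"

definition ham_cycle :: "(real^3) set \<Rightarrow> (real^3) set set \<Rightarrow> bool" where
  "ham_cycle P H \<longleftrightarrow> H \<subseteq> p_edges P \<and>
     (\<exists>num. bij_betw num (p_vertices P) {1..card (p_vertices P)} \<and>
        (let w = inv_into (p_vertices P) num; n = card (p_vertices P) in
         H = {closed_segment (w k) (w (k+1)) | k. 1 \<le> k \<and> k < n} \<union>
             {closed_segment (w n) (w 1)}))"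

text \<open>Hamiltonian characteristic function: a Hamiltonian cycle H splitting the boundary
  into two disks (facet classes A, B: two facets adjacent along an edge lie in different
  classes iff the edge is in H) and a splitting of im lambda = {a,b,c,a+b+c} into two
  2-element subsets S1, S2 with lambda(A) in S1 and lambda(B) in S2.\<close>
definition hamiltonian_cf :: "(real^3) set \<Rightarrow> ((real^3) set \<Rightarrow> bit^3) \<Rightarrow> bool" where
  "hamiltonian_cf P lam \<longleftrightarrow>
     (\<exists>H A B S1 S2 a b c. ham_cycle P H \<and>
        A \<union> B = p_facets P \<and> A \<inter> B = {} \<and>
        (\<forall>I\<in>p_edges P. \<forall>F\<in>p_facets P. \<forall>F'\<in>p_facets P.
            F \<noteq> F' \<and> I \<subseteq> F \<and> I \<subseteq> F' \<longrightarrow> (I \<in> H \<longleftrightarrow> (F \<in> A \<longleftrightarrow> F' \<in> B))) \<and>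
        card {a, b, c} = 3 \<and> z2_indep id {a, b, c} \<and>
        lam ` p_facets P = {a, b, c, a + b + c} \<and>
        S1 \<union> S2 = lam ` p_facets P \<and> card S1 = 2 \<and> card S2 = 2 \<and>
        lam ` A \<subseteq> S1 \<and> lam ` B \<subseteq> S2)"

text \<open>lambda_i + lambda_j for the edge I = F_i \<inter> F_j.\<close>
definition edge_label :: "(real^3) set \<Rightarrow> ((real^3) set \<Rightarrow> bit^3) \<Rightarrow> (real^3) set \<Rightarrow> bit^3" where
  "edge_label P lam I = (\<Sum>F\<in>{F\<in>p_facets P. I \<subseteq> F}. lam F)"

text \<open>Numbering of the vertices along the Hamiltonian path obtained from the cycle C by
  removing one edge.\<close>
definition path_numbering :: "(real^3) set \<Rightarrow> (real^3) set set \<Rightarrow> (real^3 \<Rightarrow> nat) \<Rightarrow> bool" where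
  "path_numbering P C num \<longleftrightarrow> bij_betw num (p_vertices P) {1..card (p_vertices P)} \<and>
     (\<forall>k. 1 \<le> k \<and> k < card (p_vertices P) \<longrightarrow>
        closed_segment (inv_into (p_vertices P) num k) (inv_into (p_vertices P) num (k+1)) \<in> C)"

definition chord_lo :: "(real^3) set \<Rightarrow> (real^3 \<Rightarrow> nat) \<Rightarrow> (real^3) set \<Rightarrow> nat" where
  "chord_lo P num I = Min (num ` (I \<inter> p_vertices P))"

definition chord_hi :: "(real^3) set \<Rightarrow> (real^3 \<Rightarrow> nat) \<Rightarrow> (real^3) set \<Rightarrow> nat" where
  "chord_hi P num I = Max (num ` (I \<inter> p_vertices P))"

definition chords_intersect :: "(real^3) set \<Rightarrow> (real^3 \<Rightarrow> nat) \<Rightarrow> (real^3) set \<Rightarrow> (real^3) set \<Rightarrow> bool" where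
  "chords_intersect P num I J \<longleftrightarrow>
     (chord_lo P num I < chord_lo P num J \<and> chord_lo P num J < chord_hi P num I \<and>
        chord_hi P num I < chord_hi P num J) \<or>
     (chord_lo P num J < chord_lo P num I \<and> chord_lo P num I < chord_hi P num J \<and>
        chord_hi P num J < chord_hi P num I)"

abbreviation S3 :: "(real^4) topology" where
  "S3 \<equiv> top_of_set (sphere 0 1)"

definition trivial_knot :: "'y topology \<Rightarrow> 'y set \<Rightarrow> bool" where
  "trivial_knot Y K \<longleftrightarrow> (\<exists>h. homeomorphic_map Y S3 h \<and>
      h ` K = {x\<in>sphere 0 1. x$3 = 0 \<and> x$4 = 0})"

text \<open>Split two-component link: separated by a (tame) 2-sphere, i.e. some homeomorphism
  onto S^3 puts the components into opposite open hemispheres.\<close>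
definition split_link :: "'y topology \<Rightarrow> 'y set \<Rightarrow> 'y set \<Rightarrow> bool" where
  "split_link Y K1 K2 \<longleftrightarrow> (\<exists>h. homeomorphic_map Y S3 h \<and>
      h ` K1 \<subseteq> {x. x$4 > 0} \<and> h ` K2 \<subseteq> {x. x$4 < 0})"

end

theory Submission
  imports Defs
begin

text \<open>Modulo \<open>g\<close> the characteristic function takes two values, which are the two basis vectors of
  \<open>\<int>\<^sub>2\<^sup>3/\<langle>g\<rangle>\<close>; here \<open>g\<close> is not a facet label, since the quotient by a reflection has boundary. So
  \<open>Y = X/\<langle>g\<rangle>\<close> consists of four copies of \<open>P\<close>, and the facets are two-coloured. Unicoherence of the
  3-sphere makes each colour region connected, and unicoherence of the boundary sphere of \<open>P\<close> makes
  their common boundary connected; being a 2-regular graph, it is one Hamiltonian cycle \<open>C\<close>. Hence both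
  regions are discs, cut by the edges outside \<open>C\<close>, and by theta curves and the Alexander trick each is
  mapped to the round disc with these edges going to straight chords and with prescribed values on
  \<open>C\<close>. Coning identifies \<open>P\<close> with a quarter of the 3-sphere and \<open>Y\<close> with the 3-sphere, in
  such a way that a component of the link is the preimage of a straight chord under the projection to
  the first two coordinates, lying in \<open>x\<^sub>3 = 0\<close> or \<open>x\<^sub>4 = 0\<close>. A single chord can be made a diameter,
  so its knot is a great circle. Two crossing chords have different colours and can be made
  perpendicular diameters, giving the Hopf link; two non-crossing chords can be made disjoint from
  a diameter separating them, giving a split link.\<close>

section \<open>Continuous bijections and convex bodies\<close>

text \<open>The Hamiltonian cycle supplied by the hypothesis on \<open>lam\<close> belongs to one
  splitting of the image, whose two pairs have the same sum; \<open>g\<close> may be another of the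
  three sums of two labels, and then \<open>C\<close> is a different set of edges. That
  \<open>C\<close> is one cycle must therefore come from the topology of the quotient, since
  2-regularity alone allows several cycles. Being trivial or split only asks for some homeomorphism
  onto the 3-sphere, so a fresh model is built for each chord or pair of chords; the given
  homeomorphism serves only to transfer topological properties of the sphere. The freedom in the
  model is the parametrisation of \<open>C\<close>: at most four vertices matter at a time, and they
  can be sent to four equally spaced points of the circle, so that only their cyclic order counts.
  Interleaving of two chords survives a rotation of the numbering, which is why the edge removed
  from \<open>C\<close> does not matter. That a link is not split concerns all homeomorphisms and
  cannot be read off one model; there the non-contractibility of the circle enters.\<close>

definition cbij :: "'a::topological_space set \<Rightarrow> 'b::topological_space set \<Rightarrow> ('a \<Rightarrow> 'b) \<Rightarrow> bool" where
  "cbij S T f \<longleftrightarrow> continuous_on S f \<and> inj_on f S \<and> f ` S = T"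

lemma cbijI: "continuous_on S f \<Longrightarrow> inj_on f S \<Longrightarrow> f ` S = T \<Longrightarrow> cbij S T f"
  by (simp add: cbij_def)

lemma cbijD:
  assumes "cbij S T f"
  shows "continuous_on S f" "inj_on f S" "f ` S = T"
  using assms by (auto simp: cbij_def)

lemma cbij_compose: "cbij S T f \<Longrightarrow> cbij T U g \<Longrightarrow> cbij S U (g \<circ> f)"
  using continuous_on_compose [of S f g] comp_inj_on [of f S g]
  by (auto simp: cbij_def simp del: o_apply simp flip: image_comp)

lemma cbij_subset: "cbij S T f \<Longrightarrow> A \<subseteq> S \<Longrightarrow> cbij A (f ` A) f"
  unfolding cbij_def by (auto intro: continuous_on_subset inj_on_subset)

text \<open>On a compact domain a continuous bijection onto a Hausdorff set is a homeomorphism. For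
  this reason \<open>cbij\<close> records one map only, and inverses are recovered here when they
  are needed.\<close>

lemma cbij_inv_into:
  fixes f :: "'a::t2_space \<Rightarrow> 'b::t2_space"
  assumes "cbij S T f" "compact S"
  shows "cbij T S (inv_into S f)"
proof -
  have "continuous_on (f ` S) (inv_into S f)"
    using assms by (intro continuous_on_inv) (auto simp: cbij_def)
  then show ?thesis
    using assms unfolding cbij_def by (auto simp: inj_on_inv_into)
qed

lemma cbij_compact: "cbij S T f \<Longrightarrow> compact S \<Longrightarrow> compact T"
  by (metis cbij_def compact_continuous_image)

text \<open>The gluing lemma for two closed pieces. The last assumption secures injectivity across
  the pieces: a value common to both images must already be attained on the overlap.\<close>

lemma cbij_Un:
  assumes f: "cbij S1 T1 f" and g: "cbij S2 T2 g" and "closed S1" "closed S2"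
    and agree: "\<And>x. x \<in> S1 \<Longrightarrow> x \<in> S2 \<Longrightarrow> f x = g x"
    and inter: "T1 \<inter> T2 \<subseteq> f ` (S1 \<inter> S2)"
  shows "cbij (S1 \<union> S2) (T1 \<union> T2) (\<lambda>x. if x \<in> S1 then f x else g x)"
proof (rule cbijI)
  show "continuous_on (S1 \<union> S2) (\<lambda>x. if x \<in> S1 then f x else g x)"
    using assms by (intro continuous_on_If) (auto simp: cbij_def)
  have im: "(\<lambda>x. if x \<in> S1 then f x else g x) ` S2 = g ` S2"
    using agree by (auto simp: image_iff)
  then show "(\<lambda>x. if x \<in> S1 then f x else g x) ` (S1 \<union> S2) = T1 \<union> T2"
    using f g by (auto simp: image_Un cbij_def)
  have key: "x = y" if "x \<in> S1" "y \<in> S2" "f x = g y" for x y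
  proof -
    have "f x \<in> T1 \<inter> T2"
      using that cbijD(3) [OF f] cbijD(3) [OF g] by (metis IntI image_eqI)
    then obtain z where z: "z \<in> S1" "z \<in> S2" "f x = f z"
      using inter by auto
    then have "x = z" "y = z"
      using that f g agree by (metis cbijD(2) inj_onD)+
    then show ?thesis by simp
  qed
  show "inj_on (\<lambda>x. if x \<in> S1 then f x else g x) (S1 \<union> S2)"
  proof (rule inj_onI)
    fix x y
    assume "x \<in> S1 \<union> S2" "y \<in> S1 \<union> S2"
      and "(if x \<in> S1 then f x else g x) = (if y \<in> S1 then f y else g y)"
    then show "x = y"
      using key [of x y] key [of y x] inj_onD [OF cbijD(2) [OF f], of x y]
        inj_onD [OF cbijD(2) [OF g], of x y]
      by (auto split: if_splits)
  qed
qed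

text \<open>Invariance of domain: as the affine dimensions agree, the image of the relative interior
  is open in the affine hull of \<open>T\<close>. Applying this to the inverse as well gives
  equality.\<close>

lemma cbij_rel_interior:
  fixes f :: "'a::euclidean_space \<Rightarrow> 'b::euclidean_space"
  assumes f: "cbij S T f" and S: "compact S" and dim: "aff_dim S = aff_dim T"
  shows "f ` rel_interior S = rel_interior T"
proof -
  \<comment> \<open>Stated for arbitrary types, because it is applied to \<open>f\<close> and to its
    inverse, which go in opposite directions.\<close>
  have *: "g ` rel_interior U \<subseteq> rel_interior V"
    if "cbij U V g" "aff_dim V \<le> aff_dim U"
    for U :: "'c::euclidean_space set" and V :: "'d::euclidean_space set" and g
  proof (rule rel_interior_maximal)
    show "g ` rel_interior U \<subseteq> V"
      using that rel_interior_subset by (auto simp: cbij_def)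
    show "openin (top_of_set (affine hull V)) (g ` rel_interior U)"
    proof (rule Further_Topology.invariance_of_domain_affine_sets [of "affine hull U"])
      show "continuous_on (rel_interior U) g" "inj_on g (rel_interior U)"
        using that rel_interior_subset unfolding cbij_def
        by (meson continuous_on_subset inj_on_subset)+
      show "g \<in> rel_interior U \<rightarrow> affine hull V"
        using that rel_interior_subset hull_subset [of V affine]
        unfolding cbij_def by blast
    qed (use that in \<open>auto simp: openin_rel_interior aff_dim_affine_hull\<close>)
  qed
  have 1: "f ` rel_interior S \<subseteq> rel_interior T"
    using * f dim by (simp add: *)
  have 2: "inv_into S f ` rel_interior T \<subseteq> rel_interior S"
    using * [OF cbij_inv_into [OF f S]] dim by simp
  have "rel_interior T \<subseteq> f ` rel_interior S"
  proof
    fix y assume y: "y \<in> rel_interior T"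
    then have "y \<in> f ` S"
      using f rel_interior_subset by (auto simp: cbij_def)
    then have "y = f (inv_into S f y)"
      by (simp add: f_inv_into_f)
    then show "y \<in> f ` rel_interior S"
      using 2 y by blast
  qed
  with 1 show ?thesis by blast
qed

lemma cbij_rel_frontier:
  fixes f :: "'a::euclidean_space \<Rightarrow> 'b::euclidean_space"
  assumes f: "cbij S T f" and S: "compact S" and dim: "aff_dim S = aff_dim T"
  shows "f ` rel_frontier S = rel_frontier T"
proof -
  have "compact T" using f S by (rule cbij_compact)
  then have "rel_frontier S = S - rel_interior S" "rel_frontier T = T - rel_interior T"
    using S by (auto simp: rel_frontier_def compact_imp_closed)
  moreover have "f ` (S - rel_interior S) = f ` S - f ` rel_interior S"
    using cbijD(2) [OF f] rel_interior_subset by (metis inj_on_image_set_diff Diff_subset)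
  ultimately show ?thesis
    using cbij_rel_interior [OF assms] cbijD(3) [OF f] by simp
qed

lemma convex_body_cbij:
  fixes S :: "'a::euclidean_space set" and T :: "'b::euclidean_space set"
  assumes "convex S" "compact S" "convex T" "compact T" "aff_dim S = aff_dim T"
  obtains f where "cbij S T f" "f ` rel_frontier S = rel_frontier T"
proof -
  obtain f g where "homeomorphism S T f g"
    using homeomorphic_convex_compact_sets [OF assms] by (auto simp: homeomorphic_def)
  then have "cbij S T f"
    by (auto simp: cbij_def homeomorphism_def intro: inj_on_inverseI)
  with that cbij_rel_frontier assms show thesis by blast
qed

text \<open>The Alexander trick: the boundary map is coned radially from the centre. Coning
  preserves norms, and from this follow injectivity, surjectivity and continuity at the
  centre.\<close>

lemma cbij_sphere_extends_cball:
  fixes b :: "'a::euclidean_space \<Rightarrow> 'b::euclidean_space"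
  assumes b: "cbij (sphere 0 1) (sphere 0 1) b"
  obtains f where "cbij (cball 0 1) (cball 0 1) f" "\<And>x. x \<in> sphere 0 1 \<Longrightarrow> f x = b x"
proof -
  define f where "f = (\<lambda>x. norm x *\<^sub>R b (x /\<^sub>R norm x))"
  have bs: "norm (b x) = 1" if "norm x = 1" for x
    using cbijD(3) [OF b] that by (metis image_eqI mem_sphere_0)
  have nf: "norm (f x) = norm x" for x
    using bs [of "x /\<^sub>R norm x"] by (cases "x = 0") (auto simp: f_def)
  have fs: "f x = b x" if "x \<in> sphere 0 1" for x
    using that by (simp add: f_def)
  have "continuous (at x) f" for x
  proof (cases "x = 0")
    case True
    \<comment> \<open>At the origin the quotient \<open>x /\<^sub>R norm x\<close> is 0 by
      convention and \<open>b 0\<close> is arbitrary; the factor \<open>norm x\<close> makes the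
      value 0, and continuity follows from \<open>norm (f x) = norm x\<close>.\<close>
    have "(f \<longlongrightarrow> 0) (at 0)"
      by (rule tendsto_norm_zero_cancel) (simp add: nf tendsto_norm_zero)
    then show ?thesis
      using True by (simp add: continuous_at f_def)
  next
    case False
    have "continuous_on (- {0}) f"
      unfolding f_def
    proof (intro continuous_intros)
      show "continuous_on (- {0}) (\<lambda>x. b (x /\<^sub>R norm x))"
        by (rule continuous_on_compose2 [OF cbijD(1) [OF b]])
           (auto intro!: continuous_intros simp: field_simps split: if_splits)
    qed
    then show ?thesis
      using False continuous_on_eq_continuous_at [of "- {0}" f] by auto
  qed
  then have cont: "continuous_on (cball 0 1) f"
    by (simp add: continuous_at_imp_continuous_on)
  have inj: "inj_on f (cball 0 1)"
  proof (rule inj_onI)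
    fix x y assume "f x = f y"
    then have n: "norm x = norm y" by (metis nf)
    show "x = y"
    proof (cases "x = 0")
      case True with n show ?thesis by simp
    next
      case False
      with n have "y \<noteq> 0" by auto
      have "b (x /\<^sub>R norm x) = b (y /\<^sub>R norm y)"
        using \<open>f x = f y\<close> n \<open>y \<noteq> 0\<close> by (simp add: f_def)
      then have "x /\<^sub>R norm x = y /\<^sub>R norm y"
        using False \<open>y \<noteq> 0\<close> by (intro inj_onD [OF cbijD(2) [OF b]]) auto
      with n False \<open>y \<noteq> 0\<close> show ?thesis by simp
    qed
  qed
  have surj: "f ` cball 0 1 = cball 0 1"
  proof
    show "f ` cball 0 1 \<subseteq> cball 0 1" by (auto simp: nf)
    show "cball 0 1 \<subseteq> f ` cball 0 1"
    proof
      fix y :: 'b assume y: "y \<in> cball 0 1"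
      show "y \<in> f ` cball 0 1"
      proof (cases "y = 0")
        case True then show ?thesis by (auto intro!: image_eqI [of _ _ 0] simp: f_def)
      next
        case False
        then have "y /\<^sub>R norm y \<in> b ` sphere 0 1"
          using cbijD(3) [OF b] by simp
        then obtain x where x: "norm x = 1" "b x = y /\<^sub>R norm y" by auto
        have "f (norm y *\<^sub>R x) = y"
          using x False by (simp add: f_def)
        then show ?thesis
          using x y by (intro image_eqI [of _ _ "norm y *\<^sub>R x"]) auto
      qed
    qed
  qed
  show thesis
    using that cont inj surj fs by (auto simp: cbij_def)
qed

text \<open>The charts \<open>f\<close> and \<open>h\<close> identify both sets with closed balls in
  one space, so a boundary homeomorphism becomes a map of spheres, is coned there and is carried
  back.\<close>

lemma alexander_extension:
  fixes S :: "'a::t2_space set" and T :: "'b::t2_space set" and f :: "'a \<Rightarrow> 'c::euclidean_space"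
    and h :: "'b \<Rightarrow> 'c"
  assumes f: "cbij S (cball 0 1) f" "f ` A = sphere 0 1" "A \<subseteq> S" "compact S"
    and h: "cbij T (cball 0 1) h" "h ` B = sphere 0 1" "B \<subseteq> T" "compact T"
    and b: "cbij A B b"
  obtains F where "cbij S T F" "\<And>x. x \<in> A \<Longrightarrow> F x = b x"
proof -
  have fA: "cbij A (sphere 0 1) f" and hB: "cbij B (sphere 0 1) h"
    using cbij_subset f h by metis+
  have iA: "cbij (sphere 0 1) A (inv_into S f)"
    using cbij_subset [OF cbij_inv_into [OF f(1,4)], of "sphere 0 1"] f
    by (metis cbijD(2) inv_into_image_cancel sphere_cball)
  have "cbij (sphere 0 1) (sphere 0 1) (h \<circ> (b \<circ> inv_into S f))"
    by (intro cbij_compose [OF _ hB] cbij_compose [OF iA b])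
  then obtain k where k: "cbij (cball 0 1) (cball 0 1) k"
    and kx: "\<And>x. x \<in> sphere 0 1 \<Longrightarrow> k x = h (b (inv_into S f x))"
    using cbij_sphere_extends_cball by (metis comp_apply)
  show thesis
  proof
    show "cbij S T (inv_into T h \<circ> (k \<circ> f))"
      by (intro cbij_compose [OF _ cbij_inv_into [OF h(1,4)]] cbij_compose [OF f(1) k])
    fix x assume x: "x \<in> A"
    then have "f x \<in> sphere 0 1" "inv_into S f (f x) = x"
      using f by (auto simp: cbij_def)
    then have "k (f x) = h (b x)" using kx by simp
    moreover have "b x \<in> T" using b x h(3) by (auto simp: cbij_def)
    ultimately show "(inv_into T h \<circ> (k \<circ> f)) x = b x"
      using cbijD(2) [OF h(1)] by simp
  qed
qed

text \<open>The geometry of one induction step of the straightening: the line through the two ends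
  meets \<open>K\<close> in the chord alone and leaves part of the frontier strictly on each side,
  so that both halves are again convex bodies.\<close>

lemma convex_cut:
  fixes K :: "complex set" and a b :: complex
  assumes K: "convex K" "compact K" and ab: "a \<in> frontier K" "b \<in> frontier K"
    and seg: "open_segment a b \<subseteq> interior K" and "a \<noteq> b"
  obtains n \<beta> where "n \<noteq> 0" "n \<bullet> a = \<beta>" "n \<bullet> b = \<beta>"
    "K \<inter> {x. n \<bullet> x = \<beta>} = closed_segment a b"
    "frontier K \<inter> {x. n \<bullet> x = \<beta>} = {a, b}"
    "frontier K \<inter> {x. n \<bullet> x < \<beta>} \<noteq> {}" "frontier K \<inter> {x. n \<bullet> x > \<beta>} \<noteq> {}"
proof -
  \<comment> \<open>Multiplication by \<open>\<i>\<close> is a quarter turn, so \<open>n\<close> is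
    normal to the line through \<open>a\<close> and \<open>b\<close>.\<close>
  define n where "n = \<i> * (b - a)"
  define \<beta> where "\<beta> = n \<bullet> a"
  have n0: "n \<noteq> 0" using \<open>a \<noteq> b\<close> by (simp add: n_def)
  have na: "n \<bullet> a = \<beta>" and nb: "n \<bullet> b = \<beta>"
    by (simp_all add: \<beta>_def n_def inner_complex_def algebra_simps)
  have clK: "closed K" using K by (simp add: compact_imp_closed)
  have abK: "a \<in> K" "b \<in> K" using ab clK by (auto simp: frontier_def)
  have abnot: "a \<notin> interior K" "b \<notin> interior K" using ab by (auto simp: frontier_def)
  have line: "\<exists>t. x = a + t *\<^sub>R (b - a)" if "n \<bullet> x = \<beta>" for x
  proof -
    define y where "y = x - a"
    have ny: "n \<bullet> y = 0" using that by (simp add: y_def \<beta>_def inner_diff_right)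
    \<comment> \<open>Orthogonality of \<open>y\<close> to \<open>n\<close> says exactly that this
      product is real; dividing by the squared length of \<open>b - a\<close> exhibits
      \<open>y\<close> as a real multiple of \<open>b - a\<close>.\<close>
    have "y * cnj (b - a) = of_real (Re (y * cnj (b - a)))"
      using ny by (simp add: complex_eq_iff n_def inner_complex_def algebra_simps)
    moreover have "(b - a) * cnj (b - a) = of_real ((cmod (b - a))\<^sup>2)"
      using complex_norm_square [of "b - a"] by simp
    ultimately have "y * of_real ((cmod (b - a))\<^sup>2) = of_real (Re (y * cnj (b - a))) * (b - a)"
      by (metis mult.assoc mult.commute)
    then have "y = (Re (y * cnj (b - a)) / (cmod (b - a))\<^sup>2) *\<^sub>R (b - a)"
      using \<open>a \<noteq> b\<close> by (simp add: scaleR_conv_of_real field_simps)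
    then show ?thesis unfolding y_def by (metis add.commute diff_add_cancel)
  qed
  obtain m where m: "m \<in> open_segment a b"
    using \<open>a \<noteq> b\<close> by (metis ex_in_conv open_segment_eq_empty)
  then have mK: "m \<in> interior K" using seg by blast
  have lin: "n \<bullet> x = \<beta>" if x: "x \<in> closed_segment a b" for x
  proof -
    obtain s0 where "x = (1 - s0) *\<^sub>R a + s0 *\<^sub>R b"
      using x by (auto simp: in_segment)
    then show ?thesis
      using na nb by (simp add: inner_add_right) (simp add: algebra_simps)
  qed
  then have nm: "n \<bullet> m = \<beta>"
    using m by (auto simp: open_segment_def)
  \<comment> \<open>Every point strictly between the interior point \<open>m\<close> and a point of
    \<open>K\<close> is interior. The ends \<open>a\<close> and \<open>b\<close> are not interior,
    so no point of \<open>K\<close> on the line lies beyond them.\<close>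
  have stop: False if "y \<in> K" "w \<in> open_segment m y" "w \<notin> interior K" for y w
    using in_interior_closure_convex_segment [OF \<open>convex K\<close> mK] that clK by auto
  have 1: "K \<inter> {x. n \<bullet> x = \<beta>} = closed_segment a b"
  proof
    show "closed_segment a b \<subseteq> K \<inter> {x. n \<bullet> x = \<beta>}"
      using closed_segment_subset [OF abK \<open>convex K\<close>] lin by blast
    show "K \<inter> {x. n \<bullet> x = \<beta>} \<subseteq> closed_segment a b"
    proof
      fix x assume x: "x \<in> K \<inter> {x. n \<bullet> x = \<beta>}"
      then obtain t where t: "x = a + t *\<^sub>R (b - a)" using line by auto
      obtain s where s: "0 < s" "s < 1" "m = a + s *\<^sub>R (b - a)"
        using m by (auto simp: in_segment algebra_simps)
      have seg': "a + r *\<^sub>R (b - a) \<in> open_segment m x" if "s < r \<and> r < t \<or> t < r \<and> r < s" for r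
      proof -
        define u where "u = (r - s) / (t - s)"
        have u: "0 < u" "u < 1" "r = (1 - u) * s + u * t"
          using that by (auto simp: u_def field_simps)
        have "m \<noteq> x" using s t that \<open>a \<noteq> b\<close> by auto
        moreover have "a + r *\<^sub>R (b - a) = (1 - u) *\<^sub>R m + u *\<^sub>R x"
          unfolding s t u(3) by (simp add: algebra_simps)
        ultimately show ?thesis using u by (auto simp: in_segment)
      qed
      have "0 \<le> t"
        using stop [of x a] seg' [of 0] x abnot s by (force simp: not_le)
      moreover have "t \<le> 1"
        using stop [of x b] seg' [of 1] x abnot s by (force simp: not_le)
      ultimately show "x \<in> closed_segment a b"
        by (auto simp: in_segment t algebra_simps intro!: exI [of _ t])
    qed
  qed
  have 2: "frontier K \<inter> {x. n \<bullet> x = \<beta>} = {a, b}"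
  proof
    show "{a, b} \<subseteq> frontier K \<inter> {x. n \<bullet> x = \<beta>}" using ab na nb by auto
    have "frontier K \<inter> {x. n \<bullet> x = \<beta>} \<subseteq> closed_segment a b - interior K"
      using 1 clK by (auto simp: frontier_def)
    then show "frontier K \<inter> {x. n \<bullet> x = \<beta>} \<subseteq> {a, b}"
      using seg by (auto simp: open_segment_def)
  qed
  \<comment> \<open>Rays from \<open>m\<close> in the directions \<open>n\<close> and
    \<open>- n\<close> leave the bounded set \<open>K\<close> through the frontier, which yields a
    frontier point on either side of the line.\<close>
  have front: "\<exists>d>0. m + d *\<^sub>R v \<in> frontier K" if "v \<noteq> 0" for v
    using ray_to_frontier [of K m v] mK K that
    by (metis compact_imp_bounded)
  have nn: "n \<bullet> n > 0" using n0 by simp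
  obtain d1 where d1: "d1 > 0" "m + d1 *\<^sub>R n \<in> frontier K" using front n0 by blast
  obtain d2 where d2: "d2 > 0" "m + d2 *\<^sub>R (- n) \<in> frontier K" using front [of "- n"] n0 by auto
  have "m + d1 *\<^sub>R n \<in> frontier K \<inter> {x. n \<bullet> x > \<beta>}"
    using d1 nm nn by (simp add: inner_add_right)
  moreover have "m + d2 *\<^sub>R (- n) \<in> frontier K \<inter> {x. n \<bullet> x < \<beta>}"
    using d2 nm nn by (simp add: inner_diff_right)
  ultimately show thesis
    using that [OF n0 na nb 1 2] by blast
qed

lemma frontier_convex_cut:
  fixes K :: "'a::euclidean_space set"
  assumes "closed K" "n \<noteq> 0"
  shows "frontier (K \<inter> {x. n \<bullet> x \<le> \<beta>})
       = frontier K \<inter> {x. n \<bullet> x \<le> \<beta>} \<union> K \<inter> {x. n \<bullet> x = \<beta>}"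
proof -
  have "closed (K \<inter> {x. n \<bullet> x \<le> \<beta>})"
    using assms by (simp add: closed_Int closed_halfspace_le)
  then show ?thesis
    using assms interior_subset [of K]
    by (auto simp: frontier_def closure_closed interior_halfspace_le)
qed

section \<open>Straightening chords of a Jordan disc\<close>

text \<open>This is the conclusion of the Schoenflies theorem, imposed as a condition. It will hold
  for the images of facets, because a facet is a plane convex body.\<close>

definition disc_face :: "complex set \<Rightarrow> bool" where
  "disc_face U \<longleftrightarrow> (\<exists>f. cbij (closure U) (cball (0::complex) 1) f \<and> f ` frontier U = sphere 0 1)"

definition chord_of :: "(real \<Rightarrow> complex) \<Rightarrow> (real \<Rightarrow> complex) \<Rightarrow> bool" where
  "chord_of c e \<longleftrightarrow> arc e \<and> pathstart e \<in> path_image c \<and> pathfinish e \<in> path_image c \<and>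
     path_image e - {pathstart e, pathfinish e} \<subseteq> inside (path_image c)"

text \<open>A Jordan curve with disjoint chords. The faces are kept as data because the property of
  being a disc has to be inherited by the two parts when the cell is cut along a chord.\<close>

definition cell :: "(real \<Rightarrow> complex) \<Rightarrow> (real \<Rightarrow> complex) set \<Rightarrow> complex set set \<Rightarrow> bool" where
  "cell c E FF \<longleftrightarrow> simple_path c \<and> pathfinish c = pathstart c \<and> finite E \<and>
     (\<forall>e\<in>E. chord_of c e) \<and>
     (\<forall>e\<in>E. \<forall>e'\<in>E. e \<noteq> e' \<longrightarrow> path_image e \<inter> path_image e' = {}) \<and>
     (\<forall>U\<in>FF. open U \<and> connected U \<and> U \<noteq> {} \<and> disc_face U) \<and>
     disjoint FF \<and> \<Union>FF = inside (path_image c) - \<Union>(path_image ` E)"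

lemma connected_subset_one_side:
  assumes "connected S" "S \<subseteq> A \<union> B" "open A" "open B" "A \<inter> B = {}" "S \<inter> A \<noteq> {}"
  shows "S \<subseteq> A"
  using assms connectedD [of S A B] by blast

lemma simple_loop_inside:
  fixes c :: "real \<Rightarrow> complex"
  assumes "simple_path c" "pathfinish c = pathstart c"
  shows "inside (path_image c) \<noteq> {}" "open (inside (path_image c))"
    "connected (inside (path_image c))" "frontier (inside (path_image c)) = path_image c"
    "closure (inside (path_image c)) = path_image c \<union> inside (path_image c)"
    "compact (path_image c \<union> inside (path_image c))"
    "inside (path_image c) \<inter> path_image c = {}"
proof -
  note J = Jordan_inside_outside [OF assms]
  show "inside (path_image c) \<noteq> {}" "open (inside (path_image c))"
    "connected (inside (path_image c))" and fr: "frontier (inside (path_image c)) = path_image c"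
    using J by blast+
  show cl: "closure (inside (path_image c)) = path_image c \<union> inside (path_image c)"
    using fr closure_Un_frontier [of "inside (path_image c)"] by blast
  show "compact (path_image c \<union> inside (path_image c))"
    using J by (metis cl compact_closure)
  show "inside (path_image c) \<inter> path_image c = {}"
    by (rule inside_no_overlap)
qed

text \<open>A theta curve: the loop formed by \<open>u\<close> and \<open>d\<close> together with
  the cross-cut \<open>e\<close>. The conditions are symmetric in \<open>u\<close> and
  \<open>d\<close>, so what is shown for the part next to \<open>u\<close> holds for the other part
  by exchanging them.\<close>

locale theta =
  fixes u d e :: "real \<Rightarrow> complex" and a b
  assumes arcs: "arc u" "arc d" "arc e"
    and ends: "pathstart u = a" "pathfinish u = b" "pathstart d = a" "pathfinish d = b"
      "pathstart e = a" "pathfinish e = b"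
    and ud: "path_image u \<inter> path_image d = {a, b}"
    and e_inside: "path_image e - {a, b} \<subseteq> inside (path_image u \<union> path_image d)"
begin

lemma theta_swap: "theta d u e a b"
  by unfold_locales (use arcs ends ud e_inside in \<open>auto simp: Un_commute\<close>)

lemma a_neq_b: "a \<noteq> b"
  using arcs(1) ends by (metis arc_distinct_ends)

lemma ue: "path_image u \<inter> path_image e = {a, b}"
proof -
  have "{a, b} \<subseteq> path_image u \<inter> path_image e"
    using ends by (metis insert_subset empty_subsetI IntI pathstart_in_path_image pathfinish_in_path_image)
  moreover have "path_image u \<inter> inside (path_image u \<union> path_image d) = {}"
    using inside_no_overlap by blast
  ultimately show ?thesis using e_inside by blast
qed

lemma loop: "simple_path (u +++ reversepath e)"
  "pathfinish (u +++ reversepath e) = pathstart (u +++ reversepath e)"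
  "path_image (u +++ reversepath e) = path_image u \<union> path_image e"
  using arcs ends ue by (auto simp: path_image_join intro!: simple_path_join_loop arc_reversepath)

lemma split:
  shows "inside (path_image u \<union> path_image e) \<inter> inside (path_image d \<union> path_image e) = {}"
    "inside (path_image u \<union> path_image e) \<union> inside (path_image d \<union> path_image e) \<union>
      (path_image e - {a, b}) = inside (path_image u \<union> path_image d)"
proof -
  interpret s: theta d u e a b by (rule theta_swap)
  have "path_image e - {a, b} \<noteq> {}"
    using nonempty_simple_path_endless [of e] arcs ends by (simp add: arc_imp_simple_path)
  then have ne: "path_image e \<inter> inside (path_image u \<union> path_image d) \<noteq> {}"
    using e_inside by blast
  show "inside (path_image u \<union> path_image e) \<inter> inside (path_image d \<union> path_image e) = {}"
    "inside (path_image u \<union> path_image e) \<union> inside (path_image d \<union> path_image e) \<union>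
      (path_image e - {a, b}) = inside (path_image u \<union> path_image d)"
    using split_inside_simple_closed_curve [of u a b d e, OF arc_imp_simple_path ends(1,2)
        arc_imp_simple_path ends(3,4) arc_imp_simple_path ends(5,6) a_neq_b ud ue s.ue ne]
      arcs by auto
qed

end

text \<open>Each remaining chord, without its ends, and each face is connected and misses
  \<open>e\<close>, hence lies in one of the two parts. The ends of a chord in the first part are on
  \<open>u\<close> but differ from \<open>a\<close> and \<open>b\<close>, as chords are disjoint
  from \<open>e\<close>.\<close>

lemma cell_side:
  assumes th: "theta u d e a b" and cell: "cell c E FF" and e: "e \<in> E"
    and c: "path_image u \<union> path_image d = path_image c"
    and E1: "E1 = {e' \<in> E - {e}. path_image e' \<inter> inside (path_image u \<union> path_image e) \<noteq> {}}"
    and FF1: "FF1 = {U \<in> FF. U \<subseteq> inside (path_image u \<union> path_image e)}"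
  shows "cell (u +++ reversepath e) E1 FF1"
    "\<And>e'. e' \<in> E1 \<Longrightarrow> pathstart e' \<in> path_image u - {a, b} \<and> pathfinish e' \<in> path_image u - {a, b}"
proof -
  interpret theta u d e a b by (rule th)
  interpret s: theta d u e a b by (rule theta_swap)
  define I1 where "I1 = inside (path_image u \<union> path_image e)"
  define I2 where "I2 = inside (path_image d \<union> path_image e)"
  note L1 = simple_loop_inside [OF loop(1,2), unfolded loop(3), folded I1_def]
  note L2 = simple_loop_inside [OF s.loop(1,2), unfolded s.loop(3), folded I2_def]
  have sp: "I1 \<inter> I2 = {}" "I1 \<union> I2 \<union> (path_image e - {a, b}) = inside (path_image c)"
    using split by (auto simp: I1_def I2_def c)
  have cin: "inside (path_image c) \<inter> path_image c = {}"
    by (rule inside_no_overlap)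
  have chord: "chord_of c e'" if "e' \<in> E" for e'
    using cell that by (auto simp: cell_def)
  have dis: "path_image e \<inter> path_image e' = {}" if "e' \<in> E - {e}" for e'
    using cell that e by (auto simp: cell_def)
  have side: "path_image e' - {pathstart e', pathfinish e'} \<subseteq> I1 \<and>
      pathstart e' \<in> path_image u - {a, b} \<and> pathfinish e' \<in> path_image u - {a, b}"
    if e': "e' \<in> E1" for e'
  proof -
    let ?o = "path_image e' - {pathstart e', pathfinish e'}"
    have e'E: "e' \<in> E - {e}" and "path_image e' \<inter> I1 \<noteq> {}"
      using e' by (auto simp: E1 I1_def)
    note ch = chord [of e', unfolded chord_of_def]
    have arc: "arc e'" and ends': "pathstart e' \<in> path_image c" "pathfinish e' \<in> path_image c"
      and o: "?o \<subseteq> inside (path_image c)"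
      using ch e'E by auto
    have con: "connected ?o"
      using arc by (intro connected_simple_path_endless arc_imp_simple_path)
    have "?o \<subseteq> I1 \<union> I2"
      using o sp dis [OF e'E] by blast
    moreover have "?o \<inter> I1 \<noteq> {}"
      using \<open>path_image e' \<inter> I1 \<noteq> {}\<close> ends' cin sp by blast
    ultimately have oI: "?o \<subseteq> I1"
      using connected_subset_one_side [OF con _ L1(2) L2(2) sp(1)] by blast
    \<comment> \<open>The ends of a path are limits of its interior points, so the whole chord lies
      in the closure of the part that contains its interior.\<close>
    have "e' ` closure {0<..<1} \<subseteq> closure ?o"
    proof (rule image_closure_subset)
      show "continuous_on (closure {0<..<1}) e'"
        using arc by (simp add: arc_def path_def)
      show "e' ` {0<..<1} \<subseteq> closure ?o"
        using simple_path_endless [OF arc_imp_simple_path [OF arc]] closure_subset by blast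
    qed simp
    then have "path_image e' \<subseteq> closure ?o"
      by (simp add: path_image_def)
    then have "path_image e' \<subseteq> closure I1"
      using oI closure_mono by blast
    then have "path_image e' \<subseteq> path_image u \<union> path_image e \<union> I1"
      using L1(5) by auto
    moreover have "pathstart e' \<notin> I1" "pathfinish e' \<notin> I1"
      using ends' cin sp by blast+
    moreover have "a \<in> path_image e" "b \<in> path_image e"
      using ue by auto
    ultimately show ?thesis
      using oI dis [OF e'E] pathstart_in_path_image [of e'] pathfinish_in_path_image [of e'] by blast
  qed
  then show "\<And>e'. e' \<in> E1 \<Longrightarrow> pathstart e' \<in> path_image u - {a, b} \<and> pathfinish e' \<in> path_image u - {a, b}"
    by blast
  have un: "\<Union>FF1 = I1 - \<Union>(path_image ` E1)"
  proof
    show "\<Union>FF1 \<subseteq> I1 - \<Union>(path_image ` E1)"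
      using cell by (auto simp: FF1 E1 I1_def cell_def)
    show "I1 - \<Union>(path_image ` E1) \<subseteq> \<Union>FF1"
    proof
      fix x assume x: "x \<in> I1 - \<Union>(path_image ` E1)"
      have "x \<notin> path_image e" using x L1(7) by blast
      then have "x \<notin> \<Union>(path_image ` E)"
        using x by (auto simp: E1 I1_def)
      then have "x \<in> \<Union>FF"
        using cell sp x by (auto simp: cell_def)
      then obtain U where U: "U \<in> FF" "x \<in> U" by blast
      have "U \<subseteq> inside (path_image c) - path_image e" "connected U"
        using U cell e by (auto simp: cell_def)
      then have "U \<subseteq> I1"
        using connected_subset_one_side [OF _ _ L1(2) L2(2) sp(1), of U] sp U x by blast
      with U show "x \<in> \<Union>FF1" by (auto simp: FF1 I1_def)
    qed
  qed
  have "disjoint FF1"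
    using cell by (auto simp: cell_def FF1 pairwise_def disjoint_def)
  then show "cell (u +++ reversepath e) E1 FF1"
    unfolding cell_def loop(3)
    using un cell loop(1,2) side chord
    by (auto simp: cell_def chord_of_def loop(3) E1 FF1 I1_def)
qed

lemma arc_to_segment:
  fixes e :: "real \<Rightarrow> complex" and a' b' :: "'a::euclidean_space"
  assumes "arc e" "a' \<noteq> b'"
  obtains s where "cbij (path_image e) (closed_segment a' b') s"
    "s (pathstart e) = a'" "s (pathfinish e) = b'"
proof -
  have e: "cbij {0..1} (path_image e) e"
    using \<open>arc e\<close> by (auto simp: cbij_def arc_def path_def path_image_def)
  have l: "cbij {0..1} (closed_segment a' b') (linepath a' b')"
    using \<open>a' \<noteq> b'\<close> by (simp add: cbij_def linepath_image_01 inj_on_linepath continuous_on_linepath)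
  show thesis
  proof
    show "cbij (path_image e) (closed_segment a' b') (linepath a' b' \<circ> inv_into {0..1} e)"
      by (rule cbij_compose [OF cbij_inv_into [OF e compact_Icc] l])
    show "(linepath a' b' \<circ> inv_into {0..1} e) (pathstart e) = a'"
      "(linepath a' b' \<circ> inv_into {0..1} e) (pathfinish e) = b'"
      using cbijD(2) [OF e] by (simp_all add: pathstart_def pathfinish_def linepath_def)
  qed
qed

text \<open>The midpoint of \<open>m\<close> and \<open>x\<close> is a witness: it is interior to
  \<open>K\<close> because \<open>m\<close> is, and it lies strictly below the line because
  \<open>x\<close> does.\<close>

lemma convex_cut_interior:
  fixes K :: "'a::euclidean_space set"
  assumes K: "convex K" "closed K" and x: "x \<in> frontier K" "n \<bullet> x < \<beta>"
    and m: "m \<in> interior K" "n \<bullet> m = \<beta>"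
  shows "interior (K \<inter> {x. n \<bullet> x \<le> \<beta>}) \<noteq> {}"
proof -
  have "x \<in> K" "x \<notin> interior K" using K x by (auto simp: frontier_def)
  then have "m \<noteq> x" using m by auto
  define y where "y = (1/2) *\<^sub>R m + (1/2) *\<^sub>R x"
  have "y \<in> open_segment m x"
    using \<open>m \<noteq> x\<close> by (auto simp: in_segment y_def intro!: exI [of _ "1/2"])
  then have "y \<in> interior K"
    using in_interior_closure_convex_segment [OF K(1) m(1), of x] \<open>x \<in> K\<close> closure_subset by blast
  moreover have "n \<bullet> y < \<beta>"
    using x m by (simp add: y_def inner_add_right)
  moreover have "{x. n \<bullet> x < \<beta>} \<subseteq> interior {x. n \<bullet> x \<le> \<beta>}"
    by (rule interior_maximal) (auto simp: open_halfspace_lt)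
  ultimately show ?thesis by auto
qed

lemma theta_union:
  assumes "U \<union> D = C" "I1 \<union> I2 \<union> (E - {a, b}) = I" "{a, b} \<subseteq> U"
  shows "(U \<union> E \<union> I1) \<union> (D \<union> E \<union> I2) = C \<union> I"
  unfolding assms(1,2) [symmetric] using assms(3) by auto

lemma theta_inter:
  assumes "U \<union> D = C" "I1 \<union> I2 \<union> (E - {a, b}) = I" "I \<inter> C = {}"
    "I1 \<inter> (U \<union> E) = {}" "I2 \<inter> (D \<union> E) = {}" "I1 \<inter> I2 = {}" "U \<inter> D \<subseteq> {a, b}" "{a, b} \<subseteq> E"
  shows "(U \<union> E \<union> I1) \<inter> (D \<union> E \<union> I2) = E"
proof -
  have "I1 \<inter> D = {}" "I2 \<inter> U = {}"
    using assms(3) unfolding assms(1,2) [symmetric] by auto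
  then show ?thesis using assms(4-8) by auto
qed

text \<open>Induction on the number of chords: a chord cuts the cell into two, and the straightenings of both
  agree on it. Since the faces are assumed to be closed discs, the Alexander trick settles the
  case without chords and the Schoenflies theorem is not needed.\<close>

theorem straighten_chords:
  fixes K :: "complex set"
  assumes "cell c E FF" "convex K" "compact K" "interior K \<noteq> {}"
    "cbij (path_image c) (frontier K) \<phi>"
    "\<And>e. e \<in> E \<Longrightarrow> open_segment (\<phi> (pathstart e)) (\<phi> (pathfinish e)) \<subseteq> interior K"
  shows "\<exists>f. cbij (path_image c \<union> inside (path_image c)) K f \<and>
    (\<forall>x\<in>path_image c. f x = \<phi> x) \<and>
    (\<forall>e\<in>E. f ` path_image e = closed_segment (\<phi> (pathstart e)) (\<phi> (pathfinish e)))"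
  using assms
proof (induction "card E" arbitrary: c E FF K \<phi> rule: less_induct)
  case less
  note cell = less.prems(1) and K = less.prems(2,3,4) and \<phi> = less.prems(5)
    and chords = less.prems(6)
  have clK: "closed K" using K by (simp add: compact_imp_closed)
  have loop: "simple_path c" "pathfinish c = pathstart c" and finE: "finite E"
    using cell by (auto simp: cell_def)
  note L = simple_loop_inside [OF loop]
  have \<phi>': "continuous_on (path_image c) \<phi>" "inj_on \<phi> (path_image c)" "\<phi> ` path_image c = frontier K"
    using \<phi> by (auto simp: cbij_def)
  show ?case
  proof (cases "E = {}")
    case True
    have FF: "\<Union>FF = inside (path_image c)" "disjoint FF"
      "\<And>U. U \<in> FF \<Longrightarrow> open U \<and> connected U \<and> U \<noteq> {} \<and> disc_face U"
      using cell True by (auto simp: cell_def)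
    \<comment> \<open>Without chords the disjoint open faces cover the connected inside of the
      curve, so there is only one face, and it is a disc.\<close>
    obtain U where U: "U \<in> FF" using FF(1) L(1) by blast
    have "open (\<Union>(FF - {U}))" using FF(3) by blast
    moreover have "U \<inter> \<Union>(FF - {U}) = {}"
      using FF(2) U by (auto simp: disjoint_def)
    moreover have "inside (path_image c) \<subseteq> U \<union> \<Union>(FF - {U})" using FF(1) by blast
    moreover have "inside (path_image c) \<inter> U \<noteq> {}" using FF U by blast
    ultimately have "inside (path_image c) \<subseteq> U"
      using connected_subset_one_side [OF L(3), of U "\<Union>(FF - {U})"] FF(3) [OF U] by blast
    then have "U = inside (path_image c)" using FF(1) U by blast
    then have "disc_face (inside (path_image c))" using FF(3) U by blast
    then obtain f where f: "cbij (path_image c \<union> inside (path_image c)) (cball (0::complex) 1) f"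
      "f ` path_image c = sphere 0 1"
      unfolding disc_face_def L(4,5) by blast
    have "aff_dim K = aff_dim (cball (0::complex) 1)"
      using K(3) by (simp add: aff_dim_nonempty_interior aff_dim_cball)
    then obtain h where h: "cbij K (cball (0::complex) 1) h"
      "h ` rel_frontier K = rel_frontier (cball (0::complex) 1)"
      using convex_body_cbij [of K "cball (0::complex) 1"] K by (auto simp: convex_cball)
    have h2: "h ` frontier K = sphere 0 1"
      using h(2) K(3) by (simp add: rel_frontier_nonempty_interior)
    have "frontier K \<subseteq> K" using clK by (simp add: frontier_subset_eq)
    obtain F where "cbij (path_image c \<union> inside (path_image c)) K F"
      "\<And>x. x \<in> path_image c \<Longrightarrow> F x = \<phi> x"
      using alexander_extension [OF f(1,2) _ L(6) h(1) h2 \<open>frontier K \<subseteq> K\<close> K(2) \<phi>] by auto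
    then show ?thesis using True by auto
  next
    case False
    then obtain e where e: "e \<in> E" by blast
    define a where "a = pathstart e"
    define b where "b = pathfinish e"
    have ch: "arc e" "a \<in> path_image c" "b \<in> path_image c"
      "path_image e - {a, b} \<subseteq> inside (path_image c)"
      using cell e by (auto simp: cell_def chord_of_def a_def b_def)
    have ab: "a \<noteq> b" using ch(1) unfolding a_def b_def by (metis arc_distinct_ends)
    obtain u d0 where ud: "arc u" "arc d0" "pathstart u = a" "pathfinish u = b"
      "pathstart d0 = b" "pathfinish d0 = a" "path_image u \<inter> path_image d0 = {a, b}"
      "path_image u \<union> path_image d0 = path_image c"
      using exists_double_arc [OF loop ch(2,3) ab] by metis
    define d where "d = reversepath d0"
    have c: "path_image u \<union> path_image d = path_image c" using ud by (simp add: d_def)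
    have th: "theta u d e a b"
      by unfold_locales (use ud ch c in \<open>auto simp: d_def a_def b_def arc_reversepath\<close>)
    have ab': "\<phi> a \<noteq> \<phi> b" using \<phi>'(2) ch ab by (auto dest: inj_onD)
    have front: "\<phi> a \<in> frontier K" "\<phi> b \<in> frontier K" using \<phi>' ch by auto
    have seg: "open_segment (\<phi> a) (\<phi> b) \<subseteq> interior K" using chords [OF e] by (simp add: a_def b_def)
    \<comment> \<open>The map of \<open>e\<close> onto its segment is fixed before the cell is cut.
      Both halves are straightened with these boundary values and therefore agree along the
      cut.\<close>
    obtain se where se: "cbij (path_image e) (closed_segment (\<phi> a) (\<phi> b)) se" "se a = \<phi> a" "se b = \<phi> b"
      using arc_to_segment [OF ch(1) ab'] by (metis a_def b_def)
    obtain m where m: "m \<in> open_segment (\<phi> a) (\<phi> b)" using ab' by (metis ex_in_conv open_segment_eq_empty)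
    \<comment> \<open>Kept general in \<open>u\<close>, \<open>d\<close>, \<open>n\<close> and
      \<open>\<beta>\<close>, as it serves both halves: the second time the arcs are exchanged and
      the signs of \<open>n\<close> and \<open>\<beta>\<close> are reversed.\<close>
    have half: "\<exists>f. cbij (path_image u \<union> path_image e \<union> inside (path_image u \<union> path_image e))
          (K \<inter> {x. n \<bullet> x \<le> \<beta>}) f \<and>
        (\<forall>x\<in>path_image u. f x = \<phi> x) \<and> (\<forall>x\<in>path_image e. f x = se x) \<and>
        (\<forall>e'\<in>E - {e}. path_image e' \<inter> inside (path_image u \<union> path_image e) \<noteq> {} \<longrightarrow>
           f ` path_image e' = closed_segment (\<phi> (pathstart e')) (\<phi> (pathfinish e')))"
      if th: "theta u d e a b" and c: "path_image u \<union> path_image d = path_image c"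
        and n: "n \<noteq> 0" and line: "K \<inter> {x. n \<bullet> x = \<beta>} = closed_segment (\<phi> a) (\<phi> b)"
          "frontier K \<inter> {x. n \<bullet> x = \<beta>} = {\<phi> a, \<phi> b}"
        and im: "\<phi> ` path_image u = frontier K \<inter> {x. n \<bullet> x \<le> \<beta>}"
        and ne: "frontier K \<inter> {x. n \<bullet> x < \<beta>} \<noteq> {}"
      for u d n \<beta>
    proof -
      interpret theta u d e a b by (rule th)
      define E1 where "E1 = {e' \<in> E - {e}. path_image e' \<inter> inside (path_image u \<union> path_image e) \<noteq> {}}"
      define FF1 where "FF1 = {U \<in> FF. U \<subseteq> inside (path_image u \<union> path_image e)}"
      define K1 where "K1 = K \<inter> {x. n \<bullet> x \<le> \<beta>}"
      define \<phi>1 where "\<phi>1 = (\<lambda>x. if x \<in> path_image u then \<phi> x else se x)"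
      note cs = cell_side [OF th cell e c E1_def FF1_def]
      have card: "card E1 < card E"
        using finE e by (intro psubset_card_mono) (auto simp: E1_def)
      have K1: "convex K1" "compact K1"
        using K by (auto simp: K1_def convex_Int convex_halfspace_le compact_Int_closed closed_halfspace_le)
      have "m \<in> K" "n \<bullet> m = \<beta>"
        using line(1) m by (auto simp: open_segment_def)
      then have intK1: "interior K1 \<noteq> {}"
        using convex_cut_interior [OF K(1) clK, of _ n \<beta> m] ne seg m by (auto simp: K1_def)
      have frK1: "frontier K1 = \<phi> ` path_image u \<union> closed_segment (\<phi> a) (\<phi> b)"
        unfolding K1_def frontier_convex_cut [OF clK n] im line(1) by simp
      have "path_image u \<inter> path_image e = {a, b}" by (rule ue)
      have \<phi>1: "cbij (path_image u \<union> path_image e) (frontier K1) \<phi>1"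
        unfolding frK1 \<phi>1_def
      proof (rule cbij_Un [OF _ se(1)])
        show "cbij (path_image u) (\<phi> ` path_image u) \<phi>"
          using cbij_subset [OF \<phi>] c by blast
        show "closed (path_image u)" "closed (path_image e)"
          using arcs by (auto simp: closed_arc_image)
        show "\<phi> x = se x" if "x \<in> path_image u" "x \<in> path_image e" for x
        proof -
          have "x \<in> {a, b}" using that ue by blast
          then show ?thesis using se(2,3) by auto
        qed
        have "\<phi> ` path_image u \<inter> closed_segment (\<phi> a) (\<phi> b) \<subseteq> {\<phi> a, \<phi> b}"
          using im line by blast
        then show "\<phi> ` path_image u \<inter> closed_segment (\<phi> a) (\<phi> b) \<subseteq> \<phi> ` (path_image u \<inter> path_image e)"
          using ue by auto
      qed
      have \<phi>1u: "\<phi>1 x = \<phi> x" if "x \<in> path_image u" for x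
        using that by (simp add: \<phi>1_def)
      have \<phi>1e: "\<phi>1 x = se x" if "x \<in> path_image e" for x
      proof (cases "x \<in> path_image u")
        case True
        then have "x \<in> {a, b}" using that ue by blast
        then show ?thesis using se(2,3) True by (auto simp: \<phi>1_def)
      qed (simp add: \<phi>1_def)
      \<comment> \<open>Strictness is needed for the recursive call: a chord whose ends lie strictly
        below the line has a segment that avoids the cut, hence is interior to the smaller
        body.\<close>
      have str: "n \<bullet> \<phi> x < \<beta>" if "x \<in> path_image u - {a, b}" for x
      proof -
        have "\<phi> x \<notin> {\<phi> a, \<phi> b}"
          using \<phi>'(2) that c ch by (auto dest: inj_onD)
        moreover have "\<phi> x \<in> frontier K \<inter> {x. n \<bullet> x \<le> \<beta>}" using im that by blast
        ultimately show ?thesis using line(2) by force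
      qed
      have ch1: "open_segment (\<phi>1 (pathstart e')) (\<phi>1 (pathfinish e')) \<subseteq> interior K1" if "e' \<in> E1" for e'
      proof -
        have "pathstart e' \<in> path_image u - {a, b}" "pathfinish e' \<in> path_image u - {a, b}"
          using cs(2) that by auto
        then have "{\<phi> (pathstart e'), \<phi> (pathfinish e')} \<subseteq> {x. n \<bullet> x < \<beta>}"
          using str by auto
        then have "closed_segment (\<phi> (pathstart e')) (\<phi> (pathfinish e')) \<subseteq> {x. n \<bullet> x < \<beta>}"
          by (intro closed_segment_subset) (auto simp: convex_halfspace_lt)
        moreover have "open_segment (\<phi> (pathstart e')) (\<phi> (pathfinish e')) \<subseteq> interior K"
          using chords [of e'] that by (auto simp: E1_def)
        moreover have "interior K1 = interior K \<inter> {x. n \<bullet> x < \<beta>}"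
          using n by (simp add: K1_def interior_halfspace_le)
        moreover have "\<phi>1 (pathstart e') = \<phi> (pathstart e')" "\<phi>1 (pathfinish e') = \<phi> (pathfinish e')"
          using \<phi>1u cs(2) [OF that] by auto
        ultimately show ?thesis
          using segment_open_subset_closed [of "\<phi> (pathstart e')" "\<phi> (pathfinish e')"] by auto
      qed
      obtain f where f: "cbij (path_image u \<union> path_image e \<union> inside (path_image u \<union> path_image e)) K1 f"
        "\<And>x. x \<in> path_image u \<union> path_image e \<Longrightarrow> f x = \<phi>1 x"
        "\<And>e'. e' \<in> E1 \<Longrightarrow> f ` path_image e' = closed_segment (\<phi>1 (pathstart e')) (\<phi>1 (pathfinish e'))"
        using less.hyps [OF card cs(1) K1 intK1, of \<phi>1] \<phi>1 ch1 unfolding loop(3) by blast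
      have "f ` path_image e' = closed_segment (\<phi> (pathstart e')) (\<phi> (pathfinish e'))" if "e' \<in> E1" for e'
        using f(3) [OF that] cs(2) [OF that] \<phi>1u by simp
      moreover have "\<forall>x\<in>path_image u. f x = \<phi> x" "\<forall>x\<in>path_image e. f x = se x"
        using f(2) \<phi>1u \<phi>1e by simp_all
      ultimately show ?thesis
        using f(1) by (intro exI [of _ f]) (simp add: K1_def E1_def)
    qed
    obtain n0 \<beta>0 where cut0: "n0 \<noteq> 0" "K \<inter> {x. n0 \<bullet> x = \<beta>0} = closed_segment (\<phi> a) (\<phi> b)"
      "frontier K \<inter> {x. n0 \<bullet> x = \<beta>0} = {\<phi> a, \<phi> b}"
      "frontier K \<inter> {x. n0 \<bullet> x < \<beta>0} \<noteq> {}" "frontier K \<inter> {x. n0 \<bullet> x > \<beta>0} \<noteq> {}"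
      using convex_cut [OF K(1,2) front seg ab'] by metis
    define uo where "uo = \<phi> ` (path_image u - {a, b})"
    define do' where "do' = \<phi> ` (path_image d - {a, b})"
    have con: "connected uo" "connected do'"
      unfolding uo_def do'_def
      using connected_simple_path_endless [of u] connected_simple_path_endless [of d] th c
      by (auto intro!: connected_continuous_image continuous_on_subset [OF \<phi>'(1)]
          simp: theta_def arc_imp_simple_path)
    have un: "uo \<union> do' = frontier K - {\<phi> a, \<phi> b}"
    proof -
      have "\<phi> ` (path_image c - {a, b}) = \<phi> ` path_image c - \<phi> ` {a, b}"
        using \<phi>'(2) ch by (intro inj_on_image_set_diff) auto
      moreover have "path_image c - {a, b} = (path_image u - {a, b}) \<union> (path_image d - {a, b})"
        using c by blast
      ultimately show ?thesis using \<phi>'(3) by (simp add: uo_def do'_def image_Un)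
    qed
    have uno: "uo \<subseteq> frontier K" "do' \<subseteq> frontier K" using un by blast+
    have off: "n \<bullet> x \<noteq> \<beta>" if "frontier K \<inter> {x. n \<bullet> x = \<beta>} = {\<phi> a, \<phi> b}" "x \<in> uo \<union> do'"
      for n \<beta> x
    proof -
      have "x \<in> frontier K" "x \<notin> {\<phi> a, \<phi> b}" using un that(2) by blast+
      then show ?thesis using that(1) by blast
    qed
    \<comment> \<open>There is a frontier point above the line. If \<open>uo\<close> is below, this
      point belongs to \<open>do'\<close>, and the connected set \<open>do'\<close>, which avoids
      the line, follows it.\<close>
    have sides: "uo \<subseteq> {x. n \<bullet> x < \<beta>} \<Longrightarrow> do' \<subseteq> {x. n \<bullet> x > \<beta>}"
      if line: "frontier K \<inter> {x. n \<bullet> x = \<beta>} = {\<phi> a, \<phi> b}" and ne: "frontier K \<inter> {x. n \<bullet> x > \<beta>} \<noteq> {}"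
      for n \<beta>
    proof (rule connected_subset_one_side [OF con(2)])
      assume u: "uo \<subseteq> {x. n \<bullet> x < \<beta>}"
      show "do' \<subseteq> {x. n \<bullet> x > \<beta>} \<union> {x. n \<bullet> x < \<beta>}"
        using off [OF line] by (auto simp: neq_iff)
      obtain y where y: "y \<in> frontier K" "n \<bullet> y > \<beta>" using ne by blast
      have "n \<bullet> \<phi> a = \<beta>" "n \<bullet> \<phi> b = \<beta>" using line by blast+
      then have "y \<notin> {\<phi> a, \<phi> b}" using y(2) by auto
      then have "y \<in> uo \<union> do'" using y(1) unfolding un by blast
      moreover have "y \<notin> uo" using y u by auto
      ultimately show "do' \<inter> {x. n \<bullet> x > \<beta>} \<noteq> {}"
        using y by blast
    qed (auto simp: open_halfspace_lt open_halfspace_gt)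
    \<comment> \<open>The cut alone does not tell on which side the image of \<open>u\<close> lies.
      The open arc is connected and misses the line, so it lies on one side; replacing
      \<open>n0\<close> by its negative, if necessary, puts it below.\<close>
    have "\<exists>n \<beta>. n \<noteq> 0 \<and> K \<inter> {x. n \<bullet> x = \<beta>} = closed_segment (\<phi> a) (\<phi> b) \<and>
      frontier K \<inter> {x. n \<bullet> x = \<beta>} = {\<phi> a, \<phi> b} \<and> frontier K \<inter> {x. n \<bullet> x < \<beta>} \<noteq> {} \<and>
      frontier K \<inter> {x. n \<bullet> x > \<beta>} \<noteq> {} \<and> uo \<subseteq> {x. n \<bullet> x < \<beta>}"
    proof (cases "uo \<inter> {x. n0 \<bullet> x < \<beta>0} = {}")
      case False
      have "uo \<subseteq> {x. n0 \<bullet> x < \<beta>0} \<union> {x. n0 \<bullet> x > \<beta>0}"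
        using off [OF cut0(3)] by (auto simp: neq_iff)
      then have "uo \<subseteq> {x. n0 \<bullet> x < \<beta>0}"
        by (rule connected_subset_one_side [OF con(1)])
           (use False in \<open>auto simp: open_halfspace_lt open_halfspace_gt\<close>)
      then show ?thesis using cut0 by blast
    next
      case True
      have "uo \<subseteq> {x. - n0 \<bullet> x < - \<beta>0}"
      proof
        fix x assume "x \<in> uo"
        then have "\<not> n0 \<bullet> x < \<beta>0" "n0 \<bullet> x \<noteq> \<beta>0"
          using True off [OF cut0(3)] by blast+
        then show "x \<in> {x. - n0 \<bullet> x < - \<beta>0}" by simp
      qed
      then show ?thesis
        by (intro exI [of _ "- n0"] exI [of _ "- \<beta>0"]) (simp add: cut0 [simplified])
    qed
    then obtain n \<beta> where cut: "n \<noteq> 0" "K \<inter> {x. n \<bullet> x = \<beta>} = closed_segment (\<phi> a) (\<phi> b)"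
      "frontier K \<inter> {x. n \<bullet> x = \<beta>} = {\<phi> a, \<phi> b}"
      "frontier K \<inter> {x. n \<bullet> x < \<beta>} \<noteq> {}" "frontier K \<inter> {x. n \<bullet> x > \<beta>} \<noteq> {}"
      and uo: "uo \<subseteq> {x. n \<bullet> x < \<beta>}" by (elim exE conjE) (rule that)
    have do': "do' \<subseteq> {x. n \<bullet> x > \<beta>}" by (rule sides [OF cut(3,5) uo])
    have imud: "\<phi> ` path_image u = uo \<union> {\<phi> a, \<phi> b}" "\<phi> ` path_image d = do' \<union> {\<phi> a, \<phi> b}"
    proof -
      have "{a, b} \<subseteq> path_image u" "{a, b} \<subseteq> path_image d" using th by (auto simp: theta_def)
      then show "\<phi> ` path_image u = uo \<union> {\<phi> a, \<phi> b}" "\<phi> ` path_image d = do' \<union> {\<phi> a, \<phi> b}"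
        unfolding uo_def do'_def by blast+
    qed
    have onl: "n \<bullet> \<phi> a = \<beta>" "n \<bullet> \<phi> b = \<beta>" using cut(3) by blast+
    have imu: "\<phi> ` path_image u = frontier K \<inter> {x. n \<bullet> x \<le> \<beta>}"
    proof (intro equalityI subsetI)
      fix x assume "x \<in> \<phi> ` path_image u"
      then show "x \<in> frontier K \<inter> {x. n \<bullet> x \<le> \<beta>}"
        unfolding imud using uo onl front uno by auto
    next
      fix x assume x: "x \<in> frontier K \<inter> {x. n \<bullet> x \<le> \<beta>}"
      then have "x \<in> uo \<union> do' \<union> {\<phi> a, \<phi> b}" "x \<notin> do'"
        using do' by (auto simp: un)
      then show "x \<in> \<phi> ` path_image u" using imud(1) by blast
    qed
    have imd: "\<phi> ` path_image d = frontier K \<inter> {x. - n \<bullet> x \<le> - \<beta>}"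
    proof (intro equalityI subsetI)
      fix x assume "x \<in> \<phi> ` path_image d"
      then show "x \<in> frontier K \<inter> {x. - n \<bullet> x \<le> - \<beta>}"
        unfolding imud using do' onl front uno by auto
    next
      fix x assume x: "x \<in> frontier K \<inter> {x. - n \<bullet> x \<le> - \<beta>}"
      then have "x \<in> uo \<union> do' \<union> {\<phi> a, \<phi> b}" "x \<notin> uo"
        using uo by (auto simp: un)
      then show "x \<in> \<phi> ` path_image d" using imud(2) by blast
    qed
    interpret theta u d e a b by (rule th)
    obtain f1 where f1: "cbij (path_image u \<union> path_image e \<union> inside (path_image u \<union> path_image e))
          (K \<inter> {x. n \<bullet> x \<le> \<beta>}) f1"
        "\<forall>x\<in>path_image u. f1 x = \<phi> x" "\<forall>x\<in>path_image e. f1 x = se x"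
        "\<forall>e'\<in>E - {e}. path_image e' \<inter> inside (path_image u \<union> path_image e) \<noteq> {} \<longrightarrow>
           f1 ` path_image e' = closed_segment (\<phi> (pathstart e')) (\<phi> (pathfinish e'))"
      using half [OF th c cut(1,2,3) imu cut(4)] by blast
    have c': "path_image d \<union> path_image u = path_image c" using c by blast
    obtain f2 where f2: "cbij (path_image d \<union> path_image e \<union> inside (path_image d \<union> path_image e))
          (K \<inter> {x. - n \<bullet> x \<le> - \<beta>}) f2"
        "\<forall>x\<in>path_image d. f2 x = \<phi> x" "\<forall>x\<in>path_image e. f2 x = se x"
        "\<forall>e'\<in>E - {e}. path_image e' \<inter> inside (path_image d \<union> path_image e) \<noteq> {} \<longrightarrow>
           f2 ` path_image e' = closed_segment (\<phi> (pathstart e')) (\<phi> (pathfinish e'))"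
      using half [OF theta_swap c', of "- n" "- \<beta>"] cut imd by auto
    define S1 where "S1 = path_image u \<union> path_image e \<union> inside (path_image u \<union> path_image e)"
    define S2 where "S2 = path_image d \<union> path_image e \<union> inside (path_image d \<union> path_image e)"
    interpret s: theta d u e a b by (rule theta_swap)
    have comp: "compact S1" "compact S2"
      unfolding S1_def S2_def
      using simple_loop_inside(6) [OF loop(1,2)] simple_loop_inside(6) [OF s.loop(1,2)]
      by (auto simp: loop(3) s.loop(3))
    have noI: "inside (path_image c) \<inter> path_image c = {}" by (rule L(7))
    have noI1: "inside (path_image u \<union> path_image e) \<inter> (path_image u \<union> path_image e) = {}"
      "inside (path_image d \<union> path_image e) \<inter> (path_image d \<union> path_image e) = {}"
      by (rule inside_no_overlap)+
    have sp: "inside (path_image u \<union> path_image e) \<union> inside (path_image d \<union> path_image e) \<union>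
        (path_image e - {a, b}) = inside (path_image c)"
      using split(2) c by simp
    have sub: "{a, b} \<subseteq> path_image u" "{a, b} \<subseteq> path_image e" using ue by blast+
    have S12: "S1 \<union> S2 = path_image c \<union> inside (path_image c)"
      unfolding S1_def S2_def by (rule theta_union [OF c sp sub(1)])
    have S12': "S1 \<inter> S2 = path_image e"
      unfolding S1_def S2_def
      by (rule theta_inter [OF c sp noI noI1 split(1) theta.ud [OF th, THEN equalityD1] sub(2)])
    define f where "f = (\<lambda>x. if x \<in> S1 then f1 x else f2 x)"
    have "cbij (S1 \<union> S2) (K \<inter> {x. n \<bullet> x \<le> \<beta>} \<union> K \<inter> {x. - n \<bullet> x \<le> - \<beta>}) f"
      unfolding f_def
    proof (rule cbij_Un [OF f1(1) [folded S1_def] f2(1) [folded S2_def]])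
      show "closed S1" "closed S2" using comp by (auto simp: compact_imp_closed)
      show "f1 x = f2 x" if "x \<in> S1" "x \<in> S2" for x
      proof -
        have "x \<in> path_image e" using that S12' by blast
        then show ?thesis using f1(3) f2(3) by simp
      qed
      have "f1 ` path_image e = closed_segment (\<phi> a) (\<phi> b)"
        using f1(3) cbijD(3) [OF se(1)] by (metis image_cong)
      then show "K \<inter> {x. n \<bullet> x \<le> \<beta>} \<inter> (K \<inter> {x. - n \<bullet> x \<le> - \<beta>}) \<subseteq> f1 ` (S1 \<inter> S2)"
        using cut(2) unfolding S12' by force
    qed
    moreover have "K \<inter> {x. n \<bullet> x \<le> \<beta>} \<union> K \<inter> {x. - n \<bullet> x \<le> - \<beta>} = K" by auto
    ultimately have cf: "cbij (path_image c \<union> inside (path_image c)) K f" by (simp add: S12)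
    have fS1: "f x = f1 x" if "x \<in> S1" for x using that by (simp add: f_def)
    have fS2: "f x = f2 x" if "x \<in> S2" for x
    proof (cases "x \<in> S1")
      case True
      then have "x \<in> path_image e" using that S12' by blast
      then show ?thesis using f1(3) f2(3) by (simp add: f_def)
    qed (simp add: f_def)
    have f\<phi>: "f x = \<phi> x" if "x \<in> path_image c" for x
    proof -
      have "x \<in> path_image u \<or> x \<in> path_image d" using that c by blast
      then show ?thesis
        using fS1 [of x] fS2 [of x] f1(2) f2(2) by (auto simp: S1_def S2_def)
    qed
    have straight: "f ` path_image e' = closed_segment (\<phi> (pathstart e')) (\<phi> (pathfinish e'))" if e': "e' \<in> E" for e'
    proof (cases "e' = e")
      case True
      have "f ` path_image e = se ` path_image e"
        using fS1 f1(3) by (intro image_cong) (auto simp: S1_def)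
      with True show ?thesis using cbijD(3) [OF se(1)] by (simp add: a_def b_def)
    next
      case False
      have "path_image e' \<inter> path_image e = {}" "chord_of c e'"
        using cell e e' False by (auto simp: cell_def)
      then have "path_image e' - {pathstart e', pathfinish e'} \<subseteq> inside (path_image c) - path_image e"
        "path_image e' - {pathstart e', pathfinish e'} \<noteq> {}"
        using nonempty_simple_path_endless [of e'] by (auto simp: chord_of_def arc_imp_simple_path)
      then consider "path_image e' \<inter> inside (path_image u \<union> path_image e) \<noteq> {}"
        | "path_image e' \<inter> inside (path_image d \<union> path_image e) \<noteq> {}"
        unfolding sp [symmetric] by blast
      then show ?thesis
      proof cases
        case 1
        have "path_image e' \<subseteq> S1"
        proof -
          have "chord_of (u +++ reversepath e) e'"
            using cell_side(1) [OF th cell e c refl refl] 1 e' False unfolding cell_def by simp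
          then show ?thesis
            unfolding S1_def chord_of_def loop(3) by auto
        qed
        then have "f ` path_image e' = f1 ` path_image e'"
          using fS1 by (intro image_cong) auto
        then show ?thesis using f1(4) 1 e' False by auto
      next
        case 2
        have "path_image e' \<subseteq> S2"
        proof -
          have "chord_of (d +++ reversepath e) e'"
            using cell_side(1) [OF theta_swap cell e c' refl refl] 2 e' False unfolding cell_def by simp
          then show ?thesis
            unfolding S2_def chord_of_def s.loop(3) by auto
        qed
        then have "f ` path_image e' = f2 ` path_image e'"
          using fS2 by (intro image_cong) auto
        then show ?thesis using f2(4) 2 e' False by auto
      qed
    qed
    show ?thesis using cf f\<phi> straight by blast
  qed
qed

section \<open>Simple 3-polytopes\<close>

lemma subset_triple:
  assumes "S \<subseteq> {x, y, z}" "S \<noteq> {}" "\<And>w. S \<noteq> {w}" "S \<noteq> {x, y, z}"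
  shows "S = {x, y} \<or> S = {x, z} \<or> S = {y, z}"
proof -
  have "x \<in> S \<Longrightarrow> y \<in> S \<Longrightarrow> z \<in> S \<Longrightarrow> S = {x, y, z}" "x \<in> S \<Longrightarrow> y \<in> S \<Longrightarrow> z \<notin> S \<Longrightarrow> S = {x, y}"
    "x \<in> S \<Longrightarrow> y \<notin> S \<Longrightarrow> z \<in> S \<Longrightarrow> S = {x, z}" "x \<notin> S \<Longrightarrow> y \<in> S \<Longrightarrow> z \<in> S \<Longrightarrow> S = {y, z}"
    "x \<in> S \<Longrightarrow> y \<notin> S \<Longrightarrow> z \<notin> S \<Longrightarrow> S = {x}" "x \<notin> S \<Longrightarrow> y \<in> S \<Longrightarrow> z \<notin> S \<Longrightarrow> S = {y}"
    "x \<notin> S \<Longrightarrow> y \<notin> S \<Longrightarrow> z \<in> S \<Longrightarrow> S = {z}" "x \<notin> S \<Longrightarrow> y \<notin> S \<Longrightarrow> z \<notin> S \<Longrightarrow> S = {}"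
    using assms(1) by blast+
  then show ?thesis using assms(2-4) by metis
qed

locale simple3 =
  fixes P :: "(real^3) set"
  assumes simple: "simple_3polytope P"
begin

lemma poly: "polytope P" "polyhedron P" "convex P" "compact P" "closed P"
  using simple polytope_imp_polyhedron polytope_imp_convex polytope_imp_compact polytope_imp_closed
  by (auto simp: simple_3polytope_def)

lemma dimP: "aff_dim P = 3"
  using simple by (simp add: simple_3polytope_def)

lemma full: "affine hull P = UNIV" "interior P \<noteq> {}" "rel_interior P = interior P" "rel_frontier P = frontier P"
proof -
  show 1: "affine hull P = UNIV"
    using aff_dim_eq_full [of P] dimP by simp
  show "rel_interior P = interior P" using 1 by (rule rel_interior_interior)
  then show "interior P \<noteq> {}"
    using rel_interior_eq_empty [OF poly(3)] dimP by force
  then show "rel_frontier P = frontier P" by (rule rel_frontier_nonempty_interior)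
qed

lemma finite_facets: "finite (p_facets P)"
  unfolding p_facets_def by (rule finite_polytope_facets [OF poly(1)])

lemma finite_edges: "finite (p_edges P)"
  unfolding p_edges_def
  by (rule finite_subset [OF _ finite_polytope_faces [OF poly(1)]]) auto

lemma finite_vertices: "finite (p_vertices P)"
  unfolding p_vertices_def by (rule finite_polyhedron_extreme_points [OF poly(2)])

lemma frontier_facets: "frontier P = \<Union>(p_facets P)"
  using rel_frontier_of_polyhedron [OF poly(2)] full(4) by (simp add: p_facets_def)

lemma facetD:
  assumes "F \<in> p_facets P"
  shows "F facet_of P" "F face_of P" "F \<subseteq> P" "aff_dim F = 2" "F \<noteq> {}" "F \<noteq> P" "polytope F"
    "convex F" "compact F" "closed F"
proof -
  show f: "F facet_of P" using assms by (simp add: p_facets_def)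
  then show "F face_of P" "F \<subseteq> P" "aff_dim F = 2" "F \<noteq> {}"
    using facet_of_imp_face_of [OF f] facet_of_imp_subset [OF f] dimP f by (simp_all add: facet_of_def)
  show "F \<noteq> P" using f by auto
  show "polytope F" using face_of_polytope_polytope [OF poly(1) \<open>F face_of P\<close>] .
  then show "convex F" "compact F" "closed F"
    by (auto simp: polytope_imp_convex polytope_imp_compact polytope_imp_closed)
qed

lemma edgeD:
  assumes "I \<in> p_edges P"
  shows "I face_of P" "aff_dim I = 1" "I \<noteq> {}" "I \<noteq> P" "I \<subseteq> P" "convex I" "compact I" "closed I" "polytope I"
proof -
  show f: "I face_of P" "aff_dim I = 1" using assms by (auto simp: p_edges_def)
  then show "I \<noteq> {}" "I \<noteq> P" "I \<subseteq> P" using dimP face_of_imp_subset by auto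
  show "polytope I" using face_of_polytope_polytope [OF poly(1) f(1)] .
  then show "convex I" "compact I" "closed I"
    by (auto simp: polytope_imp_convex polytope_imp_compact polytope_imp_closed)
qed

text \<open>Minimality makes the correspondence between defining halfspaces and facets injective.\<close>

lemma halfspaces:
  obtains a :: "(real^3) set \<Rightarrow> real^3" and b :: "(real^3) set \<Rightarrow> real"
  where "\<And>F x. F \<in> p_facets P \<Longrightarrow> x \<in> F \<longleftrightarrow> x \<in> P \<and> a F \<bullet> x = b F"
    "\<And>x. x \<in> P \<longleftrightarrow> (\<forall>F\<in>p_facets P. a F \<bullet> x \<le> b F)"
proof -
  obtain H where H: "finite H" "P = affine hull P \<inter> \<Inter>H"
    "\<forall>h\<in>H. \<exists>a b. a \<noteq> 0 \<and> h = {x. a \<bullet> x \<le> b}"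
    "\<And>H'. H' \<subset> H \<Longrightarrow> P \<subset> affine hull P \<inter> \<Inter>H'"
    using poly(2) unfolding polyhedron_Int_affine_minimal by metis
  then obtain a b where ab: "\<And>h. h \<in> H \<Longrightarrow> a h \<noteq> 0 \<and> h = {x. a h \<bullet> x \<le> b h}" by metis
  have mem: "x \<in> h \<longleftrightarrow> a h \<bullet> x \<le> b h" if "h \<in> H" for h x
    using ab [OF that] by (metis mem_Collect_eq)
  have facet: "C facet_of P \<longleftrightarrow> (\<exists>h. h \<in> H \<and> C = P \<inter> {x. a h \<bullet> x = b h})" for C
    by (rule facet_of_polyhedron_explicit [OF H(1,2) ab H(4)])
  have PH: "P = \<Inter>H" using H(2) full(1) by simp
  obtain z where z: "z \<in> interior P" using full(2) by blast
  have zs: "a h \<bullet> z < b h" if "h \<in> H" for h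
  proof -
    have "P \<subseteq> {x. a h \<bullet> x \<le> b h}" using PH mem that by auto
    then have "z \<in> interior {x. a h \<bullet> x \<le> b h}" using z interior_mono by blast
    then have "z \<in> {x. a h \<bullet> x < b h}" using ab [OF that] interior_halfspace_le by metis
    then show ?thesis by simp
  qed
  have inj: "h = h'" if h: "h \<in> H" "h' \<in> H" and eq: "P \<inter> {x. a h \<bullet> x = b h} = P \<inter> {x. a h' \<bullet> x = b h'}" for h h'
  proof (rule ccontr)
    assume "h \<noteq> h'"
    have "H - {h} \<subset> H" using h by blast
    then have "P \<subset> \<Inter>(H - {h})" using H(4) [of "H - {h}"] by (simp add: full(1))
    then obtain x where x: "x \<in> \<Inter>(H - {h})" "x \<notin> P" by blast
    have xo: "a k \<bullet> x \<le> b k" if "k \<in> H" "k \<noteq> h" for k using x(1) that mem by auto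
    have xh: "a h \<bullet> x > b h"
    proof (rule ccontr)
      assume "\<not> a h \<bullet> x > b h"
      then have "x \<in> h" using mem [OF h(1)] by simp
      then have "x \<in> \<Inter>H" using x(1) by blast
      then show False using x(2) PH by blast
    qed
    \<comment> \<open>By minimality \<open>x\<close> violates the inequality of \<open>h\<close>
      alone. The point \<open>y\<close> is where the segment from the interior point
      \<open>z\<close> to \<open>x\<close> crosses the hyperplane of \<open>h\<close>; all other
      inequalities are strict there.\<close>
    define t where "t = (b h - a h \<bullet> z) / (a h \<bullet> x - a h \<bullet> z)"
    have t: "0 < t" "t < 1" using zs [OF h(1)] xh by (auto simp: t_def field_simps)
    define y where "y = z + t *\<^sub>R (x - z)"
    have ay: "a k \<bullet> y = (1 - t) * (a k \<bullet> z) + t * (a k \<bullet> x)" for k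
      by (simp add: y_def inner_add_right inner_diff_right algebra_simps)
    have "a h \<bullet> y = b h"
      using zs [OF h(1)] xh by (simp add: y_def inner_add_right inner_diff_right t_def)
    moreover have lt: "a k \<bullet> y < b k" if "k \<in> H" "k \<noteq> h" for k
    proof -
      have "(1 - t) * (a k \<bullet> z) < (1 - t) * b k" using zs [OF that(1)] t by simp
      moreover have "t * (a k \<bullet> x) \<le> t * b k" using xo [OF that] t by simp
      ultimately show ?thesis unfolding ay by (simp add: algebra_simps)
    qed
    moreover have "y \<in> P"
      unfolding PH
    proof
      fix k assume k: "k \<in> H"
      have "a k \<bullet> y \<le> b k"
        using \<open>a h \<bullet> y = b h\<close> lt [OF k] by (cases "k = h") auto
      then show "y \<in> k" using mem [OF k] by simp
    qed
    ultimately have "y \<in> P \<inter> {x. a h \<bullet> x = b h}" by simp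
    then have "a h' \<bullet> y = b h'" unfolding eq by simp
    then show False using lt [of h'] h \<open>h \<noteq> h'\<close> by simp
  qed
  define g where "g = (\<lambda>F. SOME h. h \<in> H \<and> F = P \<inter> {x. a h \<bullet> x = b h})"
  have g: "g F \<in> H \<and> F = P \<inter> {x. a (g F) \<bullet> x = b (g F)}" if "F \<in> p_facets P" for F
  proof -
    have "\<exists>h. h \<in> H \<and> F = P \<inter> {x. a h \<bullet> x = b h}"
      using facet [of F] that by (simp only: p_facets_def mem_Collect_eq)
    from someI_ex [OF this] show ?thesis unfolding g_def .
  qed
  have gsurj: "\<exists>F\<in>p_facets P. g F = h" if "h \<in> H" for h
  proof -
    let ?F = "P \<inter> {x. a h \<bullet> x = b h}"
    have F: "?F \<in> p_facets P" using facet that by (auto simp: p_facets_def)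
    have "g ?F = h"
      by (rule inj [OF conjunct1 [OF g [OF F]] that conjunct2 [OF g [OF F], symmetric]])
    then show ?thesis using F by blast
  qed
  show thesis
  proof (rule that [of "\<lambda>F. a (g F)" "\<lambda>F. b (g F)"])
    show "x \<in> F \<longleftrightarrow> x \<in> P \<and> a (g F) \<bullet> x = b (g F)" if "F \<in> p_facets P" for F x
      using arg_cong [OF conjunct2 [OF g [OF that]], of "\<lambda>S. x \<in> S"] by simp
    have "x \<in> P \<longleftrightarrow> (\<forall>h\<in>H. a h \<bullet> x \<le> b h)" for x
      unfolding PH using mem by simp
    moreover have "(\<forall>h\<in>H. a h \<bullet> x \<le> b h) \<longleftrightarrow> (\<forall>F\<in>p_facets P. a (g F) \<bullet> x \<le> b (g F))" for x
      using conjunct1 [OF g] gsurj by metis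
    ultimately show "x \<in> P \<longleftrightarrow> (\<forall>F\<in>p_facets P. a (g F) \<bullet> x \<le> b (g F))" for x by simp
  qed
qed

lemma vertex_facets:
  assumes "v \<in> p_vertices P"
  obtains F1 F2 F3 where "F1 \<noteq> F2" "F1 \<noteq> F3" "F2 \<noteq> F3" "{F \<in> p_facets P. v \<in> F} = {F1, F2, F3}"
proof -
  have "card {F \<in> p_facets P. v \<in> F} = 3"
    using simple assms by (auto simp: simple_3polytope_def)
  then obtain F1 F2 F3 where "{F \<in> p_facets P. v \<in> F} = {F1, F2, F3}" "F1 \<noteq> F2" "F2 \<noteq> F3" "F1 \<noteq> F3"
    unfolding card_3_iff by metis
  then show thesis by (intro that)
qed

lemma facet_Int_aff_dim:
  assumes "F \<in> p_facets P" "F' \<in> p_facets P" "F \<noteq> F'"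
  shows "(F \<inter> F') face_of P" "(F \<inter> F') face_of F" "aff_dim (F \<inter> F') \<le> 1"
proof -
  show f: "(F \<inter> F') face_of P" using assms(1,2) facetD(2) face_of_Int by blast
  then show fF: "(F \<inter> F') face_of F" using facetD(3) [OF assms(1)] face_of_subset by blast
  have "F \<inter> F' \<noteq> F"
  proof
    assume "F \<inter> F' = F"
    then have "F \<subseteq> F'" by blast
    then have "F face_of F'" using facetD(2) [OF assms(1)] facetD(3) [OF assms(2)] face_of_subset by blast
    then have "aff_dim F < aff_dim F'" using face_of_aff_dim_lt [of F' F] facetD(8) [OF assms(2)] assms(3) by blast
    then show False using facetD(4) assms(1,2) by simp
  qed
  then have "aff_dim (F \<inter> F') < aff_dim F" using face_of_aff_dim_lt [OF facetD(8) fF] assms(1) by blast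
  then show "aff_dim (F \<inter> F') \<le> 1" using facetD(4) [OF assms(1)] by simp
qed

text \<open>Only three defining inequalities are active at \<open>v\<close>. As \<open>v\<close> is
  extreme, their normals have no common orthogonal direction, which gives the first claim. A
  direction orthogonal to two of the normals and not positive on the third stays in \<open>P\<close>
  for a while and gives the edge.\<close>

lemma vertex_local:
  assumes v: "v \<in> p_vertices P" and F3: "{F \<in> p_facets P. v \<in> F} = {F1, F2, F3}"
    and ne: "F1 \<noteq> F2" "F1 \<noteq> F3" "F2 \<noteq> F3"
  shows "F1 \<inter> F2 \<inter> F3 = {v}" "F1 \<inter> F2 \<in> p_edges P"
proof -
  obtain a b where F: "\<And>F x. F \<in> p_facets P \<Longrightarrow> x \<in> F \<longleftrightarrow> x \<in> P \<and> a F \<bullet> x = b F"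
    and P: "\<And>x. x \<in> P \<longleftrightarrow> (\<forall>F\<in>p_facets P. a F \<bullet> x \<le> b F)" using halfspaces by metis
  have vext: "v extreme_point_of P" using v by (simp add: p_vertices_def)
  then have vP: "v \<in> P" by (simp add: extreme_point_of_def)
  have Fi: "F1 \<in> p_facets P" "F2 \<in> p_facets P" "F3 \<in> p_facets P" "v \<in> F1" "v \<in> F2" "v \<in> F3"
  proof -
    have "F1 \<in> {F \<in> p_facets P. v \<in> F}" "F2 \<in> {F \<in> p_facets P. v \<in> F}" "F3 \<in> {F \<in> p_facets P. v \<in> F}"
      unfolding F3 by auto
    then show "F1 \<in> p_facets P" "F2 \<in> p_facets P" "F3 \<in> p_facets P" "v \<in> F1" "v \<in> F2" "v \<in> F3"
      by blast+
  qed
  have av: "a F1 \<bullet> v = b F1" "a F2 \<bullet> v = b F2" "a F3 \<bullet> v = b F3"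
    using F Fi by auto
  \<comment> \<open>A short step violates nothing: active inequalities are preserved by the choice
    of \<open>d\<close>, and the inactive ones have slack, of which there are finitely many to
    respect.\<close>
  have move: "\<exists>t>0. v + t *\<^sub>R d \<in> P" if d: "a F1 \<bullet> d \<le> 0" "a F2 \<bullet> d \<le> 0" "a F3 \<bullet> d \<le> 0" for d
  proof -
    have "\<forall>\<^sub>F t in at_right 0. \<forall>F\<in>p_facets P. a F \<bullet> (v + t *\<^sub>R d) \<le> b F"
    proof (rule eventually_ball_finite [OF finite_facets], rule ballI)
      fix F0 assume F0: "F0 \<in> p_facets P"
      show "\<forall>\<^sub>F t in at_right 0. a F0 \<bullet> (v + t *\<^sub>R d) \<le> b F0"
      proof (cases "v \<in> F0")
        case True
        then have "F0 \<in> {F1, F2, F3}" using F0 F3 by blast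
        then have "a F0 \<bullet> d \<le> 0" "a F0 \<bullet> v = b F0" using d av by auto
        then have "a F0 \<bullet> (v + t *\<^sub>R d) \<le> b F0" if "t > 0" for t :: real
          using that by (simp add: inner_add_right mult_nonneg_nonpos)
        then show ?thesis by (auto simp: eventually_at_filter)
      next
        case False
        then have "a F0 \<bullet> v \<noteq> b F0" "a F0 \<bullet> v \<le> b F0" using F [OF F0] False vP P F0 by auto
        then have lt: "a F0 \<bullet> v < b F0" by simp
        have "((\<lambda>t. a F0 \<bullet> (v + t *\<^sub>R d)) \<longlongrightarrow> a F0 \<bullet> (v + 0 *\<^sub>R d)) (at_right 0)"
          by (intro tendsto_intros)
        then have "\<forall>\<^sub>F t in at_right 0. a F0 \<bullet> (v + t *\<^sub>R d) < b F0"
          using lt by (simp add: order_tendstoD)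
        then show ?thesis by (rule eventually_mono) simp
      qed
    qed
    then have "\<forall>\<^sub>F t in at_right (0::real). t > 0 \<and> v + t *\<^sub>R d \<in> P"
      unfolding P using eventually_at_right_less by (rule eventually_conj [rotated])
    then show ?thesis using eventually_happens' [OF trivial_limit_at_right_real] by blast
  qed
  have ext: "d = 0" if d: "a F1 \<bullet> d = 0" "a F2 \<bullet> d = 0" "a F3 \<bullet> d = 0" for d
  proof (rule ccontr)
    assume "d \<noteq> 0"
    obtain s where s: "s > 0" "v + s *\<^sub>R d \<in> P" using move [of d] d by auto
    obtain t where t: "t > 0" "v + t *\<^sub>R (- d) \<in> P" using move [of "- d"] d by auto
    have "v \<in> open_segment (v + s *\<^sub>R d) (v + t *\<^sub>R (- d))"
    proof -
      have "v + s *\<^sub>R d \<noteq> v + t *\<^sub>R (- d)"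
      proof
        assume "v + s *\<^sub>R d = v + t *\<^sub>R (- d)"
        then have "(s + t) *\<^sub>R d = 0" by (simp add: algebra_simps add_eq_0_iff)
        then show False using s t \<open>d \<noteq> 0\<close> by simp
      qed
      \<comment> \<open>The weight is the one for which the displacements
        \<open>s *\<^sub>R d\<close> and \<open>t *\<^sub>R (- d)\<close> cancel.\<close>
      moreover have "v = (1 - s / (s + t)) *\<^sub>R (v + s *\<^sub>R d) + (s / (s + t)) *\<^sub>R (v + t *\<^sub>R (- d))"
      proof -
        have "(1 - s / (s + t)) * s - (s / (s + t)) * t = 0" using s t by (simp add: field_simps)
        moreover have "(1 - s / (s + t)) *\<^sub>R (v + s *\<^sub>R d) + (s / (s + t)) *\<^sub>R (v + t *\<^sub>R (- d))
          = v + ((1 - s / (s + t)) * s - (s / (s + t)) * t) *\<^sub>R d"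
          by (simp add: algebra_simps)
        ultimately show ?thesis by simp
      qed
      moreover have "0 < s / (s + t)" "s / (s + t) < 1" using s t by auto
      ultimately show ?thesis unfolding in_segment by blast
    qed
    then show False using vext s t by (auto simp: extreme_point_of_def)
  qed
  show "F1 \<inter> F2 \<inter> F3 = {v}"
  proof (intro equalityI subsetI)
    fix x assume "x \<in> F1 \<inter> F2 \<inter> F3"
    then have "a F1 \<bullet> x = b F1" "a F2 \<bullet> x = b F2" "a F3 \<bullet> x = b F3" using F Fi by auto
    then have "x - v = 0" using av by (intro ext) (simp_all add: inner_diff_right)
    then show "x \<in> {v}" by simp
  qed (use Fi in auto)
  have "dim {a F1, a F2} < DIM(real^3)"
  proof -
    have "dim {a F1, a F2} \<le> card {a F1, a F2}" by (intro dim_le_card') simp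
    also have "\<dots> \<le> 2" by (simp add: card_insert_if)
    finally show ?thesis by simp
  qed
  then obtain d0 where d0: "d0 \<noteq> 0" "\<And>y. y \<in> span {a F1, a F2} \<Longrightarrow> orthogonal d0 y"
    using orthogonal_to_subspace_exists by metis
  have "a F1 \<bullet> d0 = 0" "a F2 \<bullet> d0 = 0"
    using d0(2) [of "a F1"] d0(2) [of "a F2"] by (auto simp: span_base orthogonal_def inner_commute)
  \<comment> \<open>The sign of \<open>d0\<close> is still free and is used to satisfy the third
    inequality.\<close>
  then obtain d where d: "d \<noteq> 0" "a F1 \<bullet> d = 0" "a F2 \<bullet> d = 0" "a F3 \<bullet> d \<le> 0"
  proof (cases "a F3 \<bullet> d0 \<le> 0")
    case False
    with that [of "- d0"] d0(1) \<open>a F1 \<bullet> d0 = 0\<close> \<open>a F2 \<bullet> d0 = 0\<close> show ?thesis by auto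
  qed (use d0(1) in auto)
  then obtain t where t: "t > 0" "v + t *\<^sub>R d \<in> P" using move [of d] by auto
  define w where "w = v + t *\<^sub>R d"
  have "w \<in> F1 \<inter> F2"
    using F [OF Fi(1)] F [OF Fi(2)] t d av by (auto simp: w_def inner_add_right)
  moreover have "w \<noteq> v" using t d by (simp add: w_def)
  ultimately have "{v, w} \<subseteq> F1 \<inter> F2" "aff_dim {v, w} = 1" using Fi by (auto simp: aff_dim_2)
  then have "1 \<le> aff_dim (F1 \<inter> F2)" using aff_dim_subset by metis
  then show "F1 \<inter> F2 \<in> p_edges P"
    using facet_Int_aff_dim [OF Fi(1,2) ne(1)] by (simp add: p_edges_def)
qed

lemma face_has_vertex:
  assumes "C face_of P" "C \<noteq> {}"
  obtains v where "v \<in> p_vertices P" "v \<in> C"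
proof -
  have "compact C" "convex C" using assms poly face_of_imp_compact face_of_imp_convex by blast+
  then obtain v where "v extreme_point_of C" using extreme_point_exists_convex assms(2) by blast
  then show thesis using that extreme_point_of_face [OF assms(1)] by (auto simp: p_vertices_def)
qed

text \<open>The intersection is a nonempty face and so contains a vertex of \<open>P\<close>.
  Simplicity leaves exactly one further facet there, and the local picture at the vertex
  applies.\<close>

lemma facet_Int_edge:
  assumes F: "F \<in> p_facets P" "F' \<in> p_facets P" "F \<noteq> F'" "F \<inter> F' \<noteq> {}"
  shows "F \<inter> F' \<in> p_edges P"
proof -
  obtain v where v: "v \<in> p_vertices P" "v \<in> F" "v \<in> F'"
    using face_has_vertex [OF facet_Int_aff_dim(1) [OF F(1-3)] F(4)] by blast
  have card: "card {G \<in> p_facets P. v \<in> G} = 3"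
    using simple v by (auto simp: simple_3polytope_def)
  moreover have "{F, F'} \<subseteq> {G \<in> p_facets P. v \<in> G}" using F v by blast
  ultimately have "card ({G \<in> p_facets P. v \<in> G} - {F, F'}) = 1"
    using F by (subst card_Diff_subset) auto
  then obtain F3 where "{G \<in> p_facets P. v \<in> G} - {F, F'} = {F3}" by (auto simp: card_1_singleton_iff)
  then have F3: "F3 \<notin> {F, F'}" and ins: "insert F (insert F' ({G \<in> p_facets P. v \<in> G} - {F, F'})) = {F, F', F3}"
    by (metis DiffD2 insertI1, simp)
  have "insert F (insert F' ({G \<in> p_facets P. v \<in> G} - {F, F'})) = {G \<in> p_facets P. v \<in> G}"
    using F(1,2) v(2,3) by auto
  then have "{G \<in> p_facets P. v \<in> G} = {F, F', F3}" unfolding ins by (rule sym)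
  moreover have "F \<noteq> F3" "F' \<noteq> F3" using F3 by blast+
  ultimately show ?thesis using vertex_local(2) [OF v(1) _ F(3)] by metis
qed

text \<open>A proper face is the intersection of the facets containing it, and these are among the
  three facets at a vertex of the edge. Three of them meet in a point only and one alone has
  dimension 2, so there are two.\<close>

lemma edge_facets:
  assumes I: "I \<in> p_edges P"
  obtains F F' where "F \<noteq> F'" "F \<in> p_facets P" "F' \<in> p_facets P" "{G \<in> p_facets P. I \<subseteq> G} = {F, F'}" "I = F \<inter> F'"
proof -
  obtain v where v: "v \<in> p_vertices P" "v \<in> I" using face_has_vertex [OF edgeD(1,3) [OF I]] .
  obtain F1 F2 F3 where ne: "F1 \<noteq> F2" "F1 \<noteq> F3" "F2 \<noteq> F3" and Fv: "{F \<in> p_facets P. v \<in> F} = {F1, F2, F3}"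
    using vertex_facets [OF v(1)] by blast
  define S where "S = {G \<in> p_facets P. I \<subseteq> G}"
  have IS: "I = \<Inter>S"
    using face_of_polyhedron [OF poly(2) edgeD(1,3,4) [OF I]] by (simp add: S_def p_facets_def)
  have S: "S \<subseteq> {F1, F2, F3}" unfolding Fv [symmetric] using v(2) by (auto simp: S_def)
  have tri: "F1 \<inter> F2 \<inter> F3 = {v}" using vertex_local(1) [OF v(1) Fv ne] .
  have "S \<noteq> {F1, F2, F3}"
  proof
    assume "S = {F1, F2, F3}"
    then have "I = F1 \<inter> F2 \<inter> F3" by (subst IS) (simp add: Int_assoc)
    then have "I = {v}" by (simp add: tri)
    then show False using edgeD(2) [OF I] by simp
  qed
  moreover have "S \<noteq> {}"
  proof
    assume "S = {}"
    \<comment> \<open>The intersection of the empty family is the whole space, which is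
      unbounded.\<close>
    then have "I = UNIV" by (subst IS) simp
    then show False using compact_imp_bounded [OF edgeD(7) [OF I]] by simp
  qed
  moreover have "S \<noteq> {G}" for G
  proof
    assume "S = {G}"
    then have "I = G" by (subst IS) simp
    moreover have "G \<in> S" by (simp add: \<open>S = {G}\<close>)
    then have "G \<in> p_facets P" by (simp add: S_def)
    ultimately have "G \<in> p_facets P" "I = G" by simp_all
    then show False using edgeD(2) [OF I] facetD(4) [of G] by simp
  qed
  ultimately have "S = {F1, F2} \<or> S = {F1, F3} \<or> S = {F2, F3}"
    by (intro subset_triple S)
  then obtain F F' where FF: "S = {F, F'}" "F \<noteq> F'"
  proof (elim disjE)
    assume "S = {F1, F2}" then show thesis by (rule that [OF _ ne(1)])
  next
    assume "S = {F1, F3}" then show thesis by (rule that [OF _ ne(2)])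
  next
    assume "S = {F2, F3}" then show thesis by (rule that [OF _ ne(3)])
  qed
  have "F \<in> S" "F' \<in> S" using FF(1) by simp_all
  moreover have "I = F \<inter> F'" using IS unfolding FF(1) by simp
  ultimately show thesis
    by (intro that [of F F'] FF(2) FF(1) [unfolded S_def]) (simp_all add: S_def)
qed

lemma edge_facets_eq:
  assumes "F \<in> p_facets P" "F' \<in> p_facets P" "F \<noteq> F'" "F \<inter> F' \<noteq> {}"
  shows "{G \<in> p_facets P. F \<inter> F' \<subseteq> G} = {F, F'}"
proof -
  obtain G G' where G: "G \<noteq> G'" "{H \<in> p_facets P. F \<inter> F' \<subseteq> H} = {G, G'}"
    using edge_facets [OF facet_Int_edge [OF assms]] by metis
  have "F \<in> {G, G'}" "F' \<in> {G, G'}" unfolding G(2) [symmetric] using assms(1,2) by simp_all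
  then have "F = G \<and> F' = G' \<or> F = G' \<and> F' = G" using assms(3) by simp metis
  then show ?thesis unfolding G(2) by (elim disjE conjE) (simp_all add: insert_commute)
qed

lemma edge_segment:
  assumes I: "I \<in> p_edges P"
  obtains v w where "v \<in> p_vertices P" "w \<in> p_vertices P" "v \<noteq> w" "I = closed_segment v w"
    "I \<inter> p_vertices P = {v, w}"
proof -
  have "collinear I" using edgeD(2) [OF I] by (simp add: collinear_aff_dim)
  then obtain v w where vw: "I = closed_segment v w"
    using compact_convex_collinear_segment [OF edgeD(3,7,6) [OF I]] by metis
  then have "v \<noteq> w" using edgeD(2) [OF I] by auto
  have "I \<inter> p_vertices P = {x. x extreme_point_of I}"
    using extreme_point_of_face [OF edgeD(1) [OF I]] by (auto simp: p_vertices_def)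
  also have "\<dots> = {v, w}" by (auto simp: vw extreme_point_of_segment)
  finally have "I \<inter> p_vertices P = {v, w}" .
  then show thesis using that vw \<open>v \<noteq> w\<close> by blast
qed

text \<open>The intersection is a proper face of an edge, hence has dimension at most 0; as it
  contains \<open>x\<close>, it is the face \<open>{x}\<close>.\<close>

lemma edges_Int_vertex:
  assumes "I \<in> p_edges P" "J \<in> p_edges P" "I \<noteq> J" "x \<in> I" "x \<in> J"
  shows "x \<in> p_vertices P"
proof -
  have f: "(I \<inter> J) face_of P" using assms(1,2) edgeD(1) face_of_Int by blast
  have "\<not> I \<subseteq> J"
  proof
    assume "I \<subseteq> J"
    then have "I face_of J" using edgeD(1) [OF assms(1)] edgeD(5) [OF assms(2)] face_of_subset by blast
    then have "aff_dim I < aff_dim J" using assms(3) edgeD(6) [OF assms(2)] face_of_aff_dim_lt by blast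
    then show False using assms(1,2) edgeD(2) by simp
  qed
  then have "I \<inter> J \<noteq> I" by blast
  moreover have "(I \<inter> J) face_of I" using f edgeD(5) [OF assms(1)] face_of_subset by blast
  ultimately have "aff_dim (I \<inter> J) < 1"
    using face_of_aff_dim_lt [OF edgeD(6) [OF assms(1)]] edgeD(2) [OF assms(1)] by metis
  moreover have "aff_dim (I \<inter> J) \<ge> 0" using assms(4,5) by (metis IntI aff_dim_negative_iff empty_iff not_le)
  ultimately have "aff_dim (I \<inter> J) = 0" by simp
  then obtain y where "I \<inter> J = {y}" by (auto simp: aff_dim_eq_0)
  then have "I \<inter> J = {x}" using assms(4,5) by (metis IntI singletonD)
  then show ?thesis using f by (simp add: face_of_singleton p_vertices_def)
qed

text \<open>The sides of the polygon \<open>F\<close> are edges of \<open>P\<close>. Conversely, a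
  point of \<open>F\<close> on any edge lies in a second facet, whose intersection with
  \<open>F\<close> is a proper face of \<open>F\<close> and so misses the relative interior.\<close>

lemma facet_rel_interior:
  assumes F: "F \<in> p_facets P"
  shows "rel_interior F = F - \<Union>(p_edges P)"
proof
  have pF: "polyhedron F" using facetD(7) [OF F] by (rule polytope_imp_polyhedron)
  show "F - \<Union>(p_edges P) \<subseteq> rel_interior F"
  proof -
    have "C \<in> p_edges P" if "C facet_of F" for C
      using that facetD(2,4) [OF F] face_of_trans by (auto simp: facet_of_def p_edges_def)
    then show ?thesis unfolding rel_interior_of_polyhedron [OF pF] by blast
  qed
  show "rel_interior F \<subseteq> F - \<Union>(p_edges P)"
  proof
    fix x assume x: "x \<in> rel_interior F"
    then have xF: "x \<in> F" using rel_interior_subset by blast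
    have False if I: "I \<in> p_edges P" "x \<in> I" for I
    proof -
      obtain G G' where G: "G \<noteq> G'" "G \<in> p_facets P" "G' \<in> p_facets P" "I = G \<inter> G'"
        using edge_facets [OF I(1)] by metis
      then obtain H where H: "H \<in> p_facets P" "H \<noteq> F" "x \<in> H" using I(2) by (metis IntD1 IntD2)
      have "(F \<inter> H) face_of F" "aff_dim (F \<inter> H) \<le> 1"
        using facet_Int_aff_dim(2,3) [OF F H(1)] H(2) by simp_all
      moreover have "F \<inter> H \<noteq> F"
        using \<open>aff_dim (F \<inter> H) \<le> 1\<close> facetD(4) [OF F] by auto
      ultimately have "(F \<inter> H) \<inter> rel_interior F = {}"
        using face_of_disjoint_rel_interior by blast
      then show False using x xF H by blast
    qed
    then show "x \<in> F - \<Union>(p_edges P)" using xF by blast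
  qed
qed

lemma facets_meet_in_edges:
  assumes "F \<in> p_facets P" "F' \<in> p_facets P" "F \<noteq> F'" "x \<in> F" "x \<in> F'"
  shows "x \<in> \<Union>(p_edges P)"
  using facet_Int_edge [OF assms(1-3)] assms by blast

end

section \<open>Two-regular edge sets\<close>

lemma mod_eq_window:
  assumes "p mod n = q mod n" "p \<le> q" "q \<le> p + n" "0 < (n::nat)"
  shows "q = p \<or> q = p + n"
proof -
  have "n dvd q - p" using assms by (metis mod_eq_dvd_iff_nat)
  then obtain t where t: "q - p = n * t" by blast
  have "t \<le> 1"
  proof (rule ccontr)
    assume "\<not> t \<le> 1"
    then have "n * 2 \<le> n * t" by (intro mult_le_mono2) simp
    then show False using t assms(2-4) by linarith
  qed
  then show ?thesis using t assms by (cases t) auto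
qed

text \<open>Such an edge set is a disjoint union of cycles through all vertices. Connectedness,
  assumed only where it is used, turns it into one Hamiltonian cycle.\<close>

locale two_regular = simple3 +
  fixes C :: "(real^3) set set"
  assumes C_edges: "C \<subseteq> p_edges P"
    and two: "\<And>v. v \<in> p_vertices P \<Longrightarrow> card {I \<in> C. v \<in> I} = 2"
begin

definition nbrs :: "real^3 \<Rightarrow> (real^3) set" where
  "nbrs v = {w \<in> p_vertices P. w \<noteq> v \<and> closed_segment v w \<in> C}"

lemma C_segment:
  assumes "closed_segment v w \<in> C" "v \<noteq> w"
  shows "closed_segment v w \<inter> p_vertices P = {v, w}"
proof -
  obtain a b where ab: "closed_segment v w = closed_segment a b" "closed_segment v w \<inter> p_vertices P = {a, b}"
    using edge_segment C_edges assms(1) by (metis subsetD)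
  then have "{a, b} = {v, w}" by (simp add: closed_segment_eq)
  with ab(2) show ?thesis by simp
qed

lemma nbrs_sym: "w \<in> nbrs v \<Longrightarrow> v \<in> p_vertices P \<Longrightarrow> v \<in> nbrs w"
  by (auto simp: nbrs_def closed_segment_commute)

lemma edge_at_vertex:
  assumes "I \<in> C" "v \<in> I" "v \<in> p_vertices P"
  obtains w where "w \<in> nbrs v" "I = closed_segment v w"
proof -
  obtain a b where ab: "a \<in> p_vertices P" "b \<in> p_vertices P" "a \<noteq> b" "I = closed_segment a b" "I \<inter> p_vertices P = {a, b}"
    using edge_segment C_edges assms(1) by (metis subsetD)
  have "v \<in> I \<inter> p_vertices P" using assms by blast
  then have "v = a \<or> v = b" unfolding ab(5) by simp
  then show thesis
  proof
    assume "v = a" then show thesis using that [of b] ab assms(1) by (simp add: nbrs_def)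
  next
    assume "v = b" then show thesis using that [of a] ab assms(1) by (simp add: nbrs_def closed_segment_commute)
  qed
qed

lemma card_nbrs:
  assumes "v \<in> p_vertices P"
  shows "card (nbrs v) = 2" "finite (nbrs v)"
proof -
  have "bij_betw (closed_segment v) (nbrs v) {I \<in> C. v \<in> I}"
  proof (rule bij_betw_imageI)
    show "inj_on (closed_segment v) (nbrs v)"
    proof (rule inj_onI)
      fix x y assume "x \<in> nbrs v" "y \<in> nbrs v" "closed_segment v x = closed_segment v y"
      then show "x = y" by (auto simp: closed_segment_eq doubleton_eq_iff)
    qed
    show "closed_segment v ` nbrs v = {I \<in> C. v \<in> I}"
      using edge_at_vertex [OF _ _ assms] by (auto simp: nbrs_def)
  qed
  then show "card (nbrs v) = 2" using two [OF assms] by (simp add: bij_betw_same_card)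
  then show "finite (nbrs v)" by (simp add: card_ge_0_finite)
qed

lemma nbrs_eq:
  assumes "v \<in> p_vertices P" "x \<in> nbrs v" "y \<in> nbrs v" "x \<noteq> y"
  shows "nbrs v = {x, y}"
proof -
  have "card {x, y} = card (nbrs v)" using card_nbrs(1) [OF assms(1)] assms(4) by simp
  then show ?thesis using card_subset_eq [of "nbrs v" "{x, y}"] card_nbrs(2) [OF assms(1)] assms(2,3) by simp
qed

lemma vertices_nonempty: "p_vertices P \<noteq> {}"
proof -
  have "P \<noteq> {}" using full(2) by auto
  then show ?thesis using face_has_vertex [OF face_of_refl [OF poly(3)]] by blast
qed

text \<open>An inner vertex of the path already has its two neighbours on the path, so the second
  neighbour of the starting vertex can only be the last vertex. The predecessor is indexed by
  \<open>(k + m - 1) mod m\<close> because subtraction on naturals truncates at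
  \<open>k = 0\<close>.\<close>

lemma path_closes:
  assumes inj: "inj_on w {..<m}" and V: "w ` {..<m} \<subseteq> p_vertices P"
    and adj: "\<And>k. Suc k < m \<Longrightarrow> w (Suc k) \<in> nbrs (w k)"
    and start: "nbrs (w 0) \<subseteq> w ` {..<m}" and m: "m > 0"
  shows "3 \<le> m" "w 0 \<in> nbrs (w (m - 1))"
    "\<And>k. k < m \<Longrightarrow> nbrs (w k) = {w ((k + m - 1) mod m), w (Suc k mod m)}"
proof -
  have wV: "w k \<in> p_vertices P" if "k < m" for k using V that by blast
  have ne: "w i \<noteq> w j" if "i < m" "j < m" "i \<noteq> j" for i j using inj that by (auto dest: inj_onD)
  have c0: "card (nbrs (w 0)) = 2" using card_nbrs(1) wV m by blast
  have "nbrs (w 0) \<subseteq> w ` {..<m} - {w 0}" using start by (auto simp: nbrs_def)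
  then have c2: "2 \<le> card (w ` {..<m} - {w 0})" using c0 card_mono [of "w ` {..<m} - {w 0}" "nbrs (w 0)"] by simp
  have "card (w ` {..<m} - {w 0}) = m - 1" using inj m by (simp add: card_image card_Diff_singleton)
  with c2 show m3: "3 \<le> m" by linarith
  have mid: "nbrs (w k) = {w (k - 1), w (Suc k)}" if "0 < k" "Suc k < m" for k
  proof (rule nbrs_eq)
    have k: "k - 1 < m" "k < m" "Suc (k - 1) = k" "k - 1 \<noteq> Suc k" using that by auto
    show "w k \<in> p_vertices P" using wV k(2) .
    have "w (Suc (k - 1)) \<in> nbrs (w (k - 1))" by (rule adj) (simp only: k)
    then show "w (k - 1) \<in> nbrs (w k)" using nbrs_sym wV [OF k(1)] unfolding k(3) by blast
    show "w (Suc k) \<in> nbrs (w k)" using adj that(2) .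
    show "w (k - 1) \<noteq> w (Suc k)" by (rule ne [OF k(1) that(2) k(4)])
  qed
  have w1: "w 1 \<in> nbrs (w 0)" using adj [of 0] m3 by simp
  obtain x where x: "x \<in> nbrs (w 0)" "x \<noteq> w 1"
  proof -
    have "\<not> nbrs (w 0) \<subseteq> {w 1}"
      using c0 card_mono [of "{w 1}" "nbrs (w 0)"] by auto
    then show thesis using that by blast
  qed
  then obtain j where j: "j < m" "x = w j" using start by blast
  have "x \<noteq> w 0" using x(1) by (simp add: nbrs_def)
  then have "j \<noteq> 0" using j(2) by metis
  have "j = m - 1"
  proof (rule ccontr)
    assume "j \<noteq> m - 1"
    then have j': "0 < j" "Suc j < m" using \<open>j \<noteq> 0\<close> j by auto
    have "w 0 \<in> nbrs (w j)" using nbrs_sym [OF x(1) wV [OF m]] j(2) by simp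
    then have "w 0 = w (j - 1) \<or> w 0 = w (Suc j)" using mid [OF j'] by simp
    moreover have "w 0 \<noteq> w (Suc j)" using ne [OF m j'(2)] by simp
    moreover have "j \<noteq> 1" using x(2) j(2) by metis
    then have "w 0 \<noteq> w (j - 1)" using ne [OF m, of "j - 1"] j' by simp
    ultimately show False by simp
  qed
  then have last: "w (m - 1) \<in> nbrs (w 0)" using x(1) j(2) by simp
  show w0: "w 0 \<in> nbrs (w (m - 1))" by (rule nbrs_sym [OF last wV [OF m]])
  show "nbrs (w k) = {w ((k + m - 1) mod m), w (Suc k mod m)}" if k: "k < m" for k
  proof -
    consider "k = 0" | "k = m - 1" "k \<noteq> 0" | "0 < k" "Suc k < m" using k by linarith
    then show ?thesis
    proof cases
      case 1
      have "w (m - 1) \<noteq> w 1" using ne [of "m - 1" 1] m3 by simp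
      then have "nbrs (w 0) = {w (m - 1), w 1}" by (rule nbrs_eq [OF wV [OF m] last w1])
      then show ?thesis using 1 m3 by simp
    next
      case 2
      have m2: "Suc (m - 2) = m - 1" "m - 2 < m" "m - 1 < m" "m - 2 \<noteq> 0" using m3 by auto
      have "w (Suc (m - 2)) \<in> nbrs (w (m - 2))" by (rule adj) (use m3 in simp)
      then have "w (m - 2) \<in> nbrs (w (m - 1))" using nbrs_sym wV [OF m2(2)] unfolding m2(1) by blast
      then have "nbrs (w (m - 1)) = {w (m - 2), w 0}"
        by (rule nbrs_eq [OF wV [OF m2(3)] _ w0]) (rule ne [OF m2(2) m m2(4)])
      moreover have "(k + m - 1) mod m = m - 2"
      proof -
        have "k + m - 1 = (m - 2) + m" using 2 m3 by simp
        then have "(k + m - 1) mod m = (m - 2) mod m" by (simp only: mod_add_self2)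
        also have "\<dots> = m - 2" using m3 by (intro mod_less) simp
        finally show ?thesis .
      qed
      moreover have "Suc k mod m = 0" using 2 m3 by simp
      ultimately show ?thesis using 2 by simp
    next
      case 3
      have "k + m - 1 = (k - 1) + m" using 3 by simp
      then have "(k + m - 1) mod m = (k - 1) mod m" by (simp only: mod_add_self2)
      also have "\<dots> = k - 1" using 3 by (intro mod_less) simp
      finally have "(k + m - 1) mod m = k - 1" .
      then show ?thesis using mid [OF 3] 3 by simp
    qed
  qed
qed

text \<open>The edges that meet \<open>S\<close> and those that miss it form two closed sets. A
  common point would be a vertex, hence in \<open>S\<close> and not in \<open>S\<close>;
  connectedness then leaves no edge of the second kind.\<close>

lemma closed_set_of_vertices:
  assumes con: "connected (\<Union>C)" and S: "S \<subseteq> p_vertices P" "S \<noteq> {}"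
    and cl: "\<And>v. v \<in> S \<Longrightarrow> nbrs v \<subseteq> S"
  shows "S = p_vertices P"
proof -
  define A where "A = {I \<in> C. I \<inter> S \<noteq> {}}"
  define B where "B = {I \<in> C. I \<inter> S = {}}"
  have finC: "finite C" using finite_subset [OF C_edges finite_edges] .
  have closed: "closed (\<Union>A)" "closed (\<Union>B)"
    using finC edgeD(8) C_edges by (auto simp: A_def B_def intro!: closed_Union)
  have AV: "x \<in> S" if I: "I \<in> A" "x \<in> I" "x \<in> p_vertices P" for x I
  proof -
    obtain v where v: "v \<in> I" "v \<in> S" "I \<in> C" using I by (auto simp: A_def)
    obtain w where w: "w \<in> nbrs v" "I = closed_segment v w" using edge_at_vertex v S by blast
    have "x \<in> I \<inter> p_vertices P" using I by blast
    also have "I \<inter> p_vertices P = {v, w}" using C_segment [of v w] w v(3) by (auto simp: nbrs_def)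
    finally show ?thesis using cl [OF v(2)] v(2) w(1) by blast
  qed
  have "\<Union>A \<inter> \<Union>B = {}"
  proof -
    have False if "x \<in> I" "I \<in> A" "x \<in> J" "J \<in> B" for x I J
    proof -
      have "I \<noteq> J" using that by (auto simp: A_def B_def)
      then have "x \<in> p_vertices P" using edges_Int_vertex [of I J x] that C_edges by (auto simp: A_def B_def)
      then have "x \<in> S" using AV that by blast
      then show False using that by (auto simp: B_def)
    qed
    then show ?thesis by blast
  qed
  moreover have "\<Union>C = \<Union>A \<union> \<Union>B" by (auto simp: A_def B_def)
  moreover have edge: "\<exists>I\<in>C. v \<in> I" if "v \<in> p_vertices P" for v
  proof -
    have "{I \<in> C. v \<in> I} \<noteq> {}" using two [OF that] by (metis card.empty zero_neq_numeral)
    then show ?thesis by blast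
  qed
  then have "\<Union>A \<noteq> {}" using S by (force simp: A_def)
  ultimately have "\<Union>B = {}"
    using connected_closedD [OF con, of "\<Union>A" "\<Union>B"] closed by auto
  have "v \<in> S" if v: "v \<in> p_vertices P" for v
  proof -
    obtain I where "I \<in> C" "v \<in> I" using edge v by blast
    then have "I \<in> A" using \<open>\<Union>B = {}\<close> by (auto simp: A_def B_def)
    then show ?thesis using AV \<open>v \<in> I\<close> v by blast
  qed
  then show ?thesis using S by blast
qed

lemma spanning_path_edges:
  assumes inj: "inj_on w {..<m}" and V: "w ` {..<m} = p_vertices P"
    and adj: "\<And>k. Suc k < m \<Longrightarrow> w (Suc k) \<in> nbrs (w k)"
  shows "3 \<le> m" "C = {closed_segment (w (k mod m)) (w (Suc k mod m)) | k. k < m}"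
proof -
  obtain v0 where "v0 \<in> p_vertices P"
    using vertices_nonempty by blast
  then have m: "m > 0" using V by (cases m) auto
  have nV: "nbrs v \<subseteq> w ` {..<m}" for v using V by (auto simp: nbrs_def)
  note pc = path_closes [OF inj _ adj nV m]
  show m3: "3 \<le> m" using pc(1) V by simp
  show "C = {closed_segment (w (k mod m)) (w (Suc k mod m)) | k. k < m}"
  proof (intro equalityI subsetI)
    fix I assume I: "I \<in> C"
    obtain v where v: "v \<in> I" "v \<in> p_vertices P"
      using edge_segment C_edges I by (metis ends_in_segment(1) subsetD)
    then obtain x where x: "x \<in> nbrs v" "I = closed_segment v x" using edge_at_vertex I by metis
    obtain k where k: "k < m" "v = w k" using v V by blast
    then have "x = w ((k + m - 1) mod m) \<or> x = w (Suc k mod m)" using pc(3) V x by simp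
    then show "I \<in> {closed_segment (w (k mod m)) (w (Suc k mod m)) | k. k < m}"
    proof
      assume "x = w (Suc k mod m)" then show ?thesis using x(2) k by (intro CollectI exI [of _ k]) simp
    next
      assume x': "x = w ((k + m - 1) mod m)"
      let ?j = "(k + m - 1) mod m"
      have "Suc (k + m - 1) = k + m" using m by simp
      then have "Suc ?j mod m = k" using k(1) by (metis mod_Suc_eq mod_add_self2 mod_less)
      moreover have "?j < m" using m by simp
      ultimately show ?thesis using x(2) k x' by (intro CollectI exI [of _ ?j]) (simp add: closed_segment_commute)
    qed
  next
    fix I assume "I \<in> {closed_segment (w (k mod m)) (w (Suc k mod m)) | k. k < m}"
    then obtain k where k: "k < m" "I = closed_segment (w k) (w (Suc k mod m))" by auto
    then have "w (Suc k mod m) \<in> nbrs (w k)" using pc(3) [of k] V by simp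
    then show "I \<in> C" using k by (simp add: nbrs_def)
  qed
qed

text \<open>A longest path cannot be prolonged at its start, so all neighbours of the start lie on
  it. It then closes up to a cycle, its vertex set is closed under neighbours, and connectedness
  makes it everything.\<close>

lemma spanning_path_exists:
  assumes con: "connected (\<Union>C)"
  obtains w where "inj_on w {..<card (p_vertices P)}" "w ` {..<card (p_vertices P)} = p_vertices P"
    "\<And>k. Suc k < card (p_vertices P) \<Longrightarrow> w (Suc k) \<in> nbrs (w k)"
proof -
  define paths where "paths = {xs. distinct xs \<and> set xs \<subseteq> p_vertices P \<and> xs \<noteq> [] \<and>
    (\<forall>k. Suc k < length xs \<longrightarrow> xs ! Suc k \<in> nbrs (xs ! k))}"
  obtain v0 where v0: "v0 \<in> p_vertices P"
    using vertices_nonempty by blast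
  have "[v0] \<in> paths" using v0 by (simp add: paths_def)
  moreover have bound: "length xs \<le> card (p_vertices P)" if "xs \<in> paths" for xs
    using that card_mono [OF finite_vertices, of "set xs"] by (auto simp: paths_def distinct_card)
  ultimately have "\<exists>xs. xs \<in> paths \<and> (\<forall>ys. ys \<in> paths \<longrightarrow> length ys \<le> length xs)"
    by (intro ex_has_greatest_nat [of _ _ _ "Suc (card (p_vertices P))"]) (auto simp: less_Suc_eq_le)
  then obtain xs where xs: "xs \<in> paths" and max: "\<And>ys. ys \<in> paths \<Longrightarrow> length ys \<le> length xs"
    by blast
  define m where "m = length xs"
  define w where "w = (\<lambda>k. xs ! k)"
  have d: "distinct xs" "set xs \<subseteq> p_vertices P" "xs \<noteq> []" using xs by (auto simp: paths_def)
  have inj: "inj_on w {..<m}" using d by (auto simp: w_def m_def inj_on_def nth_eq_iff_index_eq)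
  have im: "w ` {..<m} = set xs" by (auto simp: w_def m_def set_conv_nth)
  have adj: "w (Suc k) \<in> nbrs (w k)" if "Suc k < m" for k using xs that by (simp add: paths_def w_def m_def)
  have m: "m > 0" using d by (simp add: m_def)
  have start: "nbrs (w 0) \<subseteq> w ` {..<m}"
  proof (rule ccontr)
    assume "\<not> nbrs (w 0) \<subseteq> w ` {..<m}"
    then obtain x where x: "x \<in> nbrs (w 0)" "x \<notin> set xs" using im by blast
    then have x': "x \<in> p_vertices P" by (simp add: nbrs_def)
    have "w 0 \<in> p_vertices P" using im m d by (metis image_eqI lessThan_iff subsetD)
    then have "w 0 \<in> nbrs x" using nbrs_sym x by simp
    then have "(x # xs) ! Suc k \<in> nbrs ((x # xs) ! k)" if "Suc k < length (x # xs)" for k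
      using that adj by (cases k) (auto simp: w_def m_def)
    then have "x # xs \<in> paths" using d x x' by (simp add: paths_def)
    then show False using max by fastforce
  qed
  have subV: "w ` {..<m} \<subseteq> p_vertices P" using im d by simp
  note pc = path_closes [OF inj subV adj start m]
  have "nbrs v \<subseteq> w ` {..<m}" if "v \<in> w ` {..<m}" for v
    using that pc(3) m by auto
  then have "w ` {..<m} = p_vertices P"
    using closed_set_of_vertices [OF con subV] m by (metis image_is_empty lessThan_empty_iff neq0_conv)
  moreover from this have m': "card (p_vertices P) = m" using card_image [OF inj] by simp
  ultimately show thesis using inj adj by (intro that [of w]) (simp_all add: m')
qed

lemma hamiltonian:
  assumes "connected (\<Union>C)"
  shows "ham_cycle P C"
proof -
  define n where "n = card (p_vertices P)"
  obtain w where w: "inj_on w {..<n}" "w ` {..<n} = p_vertices P" "\<And>k. Suc k < n \<Longrightarrow> w (Suc k) \<in> nbrs (w k)"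
    using spanning_path_exists [OF assms] unfolding n_def by metis
  have sp: "3 \<le> n" "C = {closed_segment (w (k mod n)) (w (Suc k mod n)) | k. k < n}"
    using spanning_path_edges [OF w(1,2)] w(3) by blast+
  \<comment> \<open>The path is indexed from 0, the numbering in \<open>ham_cycle\<close> from
    1.\<close>
  define num where "num = (\<lambda>v. Suc (inv_into {..<n} w v))"
  have numw: "num (w k) = Suc k" if "k < n" for k using w(1) that by (simp add: num_def)
  have bij: "bij_betw num (p_vertices P) {1..n}"
  proof (rule bij_betw_imageI)
    show "inj_on num (p_vertices P)"
      unfolding w(2) [symmetric] by (rule inj_on_imageI) (simp add: inj_on_def numw)
    show "num ` p_vertices P = {1..n}"
    proof -
      have "num ` p_vertices P = Suc ` {..<n}"
        unfolding w(2) [symmetric] image_image using numw by (intro image_cong) auto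
      also have "\<dots> = {1..n}" by (simp add: image_Suc_lessThan)
      finally show ?thesis .
    qed
  qed
  have inv: "inv_into (p_vertices P) num k = w (k - 1)" if "1 \<le> k" "k \<le> n" for k
  proof -
    have "num (w (k - 1)) = k" "w (k - 1) \<in> p_vertices P" using numw [of "k - 1"] that w(2) by auto
    then show ?thesis using bij_betw_imp_inj_on [OF bij] by (metis inv_into_f_f)
  qed
  have "C = {closed_segment (w (k - 1)) (w k) | k. 1 \<le> k \<and> k < n} \<union> {closed_segment (w (n - 1)) (w 0)}"
    (is "_ = ?R")
  proof -
    have "{closed_segment (w (k mod n)) (w (Suc k mod n)) | k. k < n} \<subseteq> ?R"
    proof
      fix I assume "I \<in> {closed_segment (w (k mod n)) (w (Suc k mod n)) | k. k < n}"
      then obtain k where k: "k < n" "I = closed_segment (w k) (w (Suc k mod n))" by auto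
      show "I \<in> ?R"
      proof (cases "Suc k = n")
        case True
        then have "k = n - 1" "Suc k mod n = 0" using k by auto
        then show ?thesis using k by simp
      next
        case False
        then have "Suc k < n" using k by simp
        then show ?thesis using k by (intro UnI1 CollectI exI [of _ "Suc k"]) simp
      qed
    qed
    moreover have "?R \<subseteq> {closed_segment (w (k mod n)) (w (Suc k mod n)) | k. k < n}"
    proof
      fix I assume "I \<in> ?R"
      then consider k where "1 \<le> k" "k < n" "I = closed_segment (w (k - 1)) (w k)" | "I = closed_segment (w (n - 1)) (w 0)"
        by blast
      then show "I \<in> {closed_segment (w (k mod n)) (w (Suc k mod n)) | k. k < n}"
      proof cases
        case 1 then show ?thesis by (intro CollectI exI [of _ "k - 1"]) simp
      next
        case 2 then show ?thesis using sp(1) by (intro CollectI exI [of _ "n - 1"]) simp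
      qed
    qed
    ultimately show ?thesis by (subst sp(2)) (rule subset_antisym)
  qed
  also have "\<dots> = {closed_segment (inv_into (p_vertices P) num k) (inv_into (p_vertices P) num (k + 1)) | k. 1 \<le> k \<and> k < n} \<union>
      {closed_segment (inv_into (p_vertices P) num n) (inv_into (p_vertices P) num 1)}"
  proof -
    have "{closed_segment (w (k - 1)) (w k) | k. 1 \<le> k \<and> k < n} =
      {closed_segment (inv_into (p_vertices P) num k) (inv_into (p_vertices P) num (k + 1)) | k. 1 \<le> k \<and> k < n}"
      unfolding setcompr_eq_image by (rule image_cong) (auto simp: inv)
    then show ?thesis using sp(1) by (simp add: inv)
  qed
  finally show ?thesis
    unfolding ham_cycle_def Let_def n_def [symmetric] using C_edges bij
    by (intro conjI exI [of _ num])
qed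

end

section \<open>The Hamiltonian cycle as a parametrised circle\<close>

lemma cis_2pi_eq_cases:
  assumes "cis (2 * pi * s) = cis (2 * pi * t)" "0 \<le> s" "s \<le> 1" "0 \<le> t" "t \<le> 1"
  shows "s = t \<or> (s = 0 \<and> t = 1) \<or> (s = 1 \<and> t = 0)"
proof -
  have "sin (2 * pi * s) = sin (2 * pi * t) \<and> cos (2 * pi * s) = cos (2 * pi * t)"
    using assms(1) by (simp add: complex_eq_iff)
  then obtain k :: int where "2 * pi * s = 2 * pi * t + 2 * pi * k"
    unfolding sin_cos_eq_iff by blast
  then have "2 * pi * (s - t - k) = 0" by (simp add: algebra_simps)
  then have k: "s - t = k" by simp
  then have "-1 \<le> k" "k \<le> 1" using assms by linarith+
  then have "k = -1 \<or> k = 0 \<or> k = 1" by linarith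
  then show ?thesis using k assms by auto
qed

lemma simple_loop_circle:
  fixes c :: "real \<Rightarrow> 'a::real_normed_vector"
  assumes c: "simple_path c" "pathfinish c = pathstart c"
  obtains \<phi> where "cbij (path_image c) (sphere (0::complex) 1) \<phi>"
    "\<And>t. t \<in> {0..1} \<Longrightarrow> \<phi> (c t) = cis (2 * pi * t)"
proof -
  have c01: "c 0 = c 1" using c(2) by (simp add: pathstart_def pathfinish_def)
  have contc: "continuous_on {0..1} c" using c(1) by (simp add: simple_path_def path_def)
  have fib: "s = t \<or> s = 0 \<and> t = 1 \<or> s = 1 \<and> t = 0"
    if "s \<in> {0..1}" "t \<in> {0..1}" "c s = c t" for s t
    using c(1) that by (auto simp: simple_path_def loop_free_def)
  \<comment> \<open>The parameter is ambiguous only at the base point of the loop, where the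
    candidates 0 and 1 have the same image on the circle.\<close>
  define \<phi> where "\<phi> = (\<lambda>x. cis (2 * pi * (SOME t. t \<in> {0..1} \<and> c t = x)))"
  have \<phi>: "\<phi> (c t) = cis (2 * pi * t)" if t: "t \<in> {0..1}" for t
  proof -
    define s where "s = (SOME s. s \<in> {0..1} \<and> c s = c t)"
    have "s \<in> {0..1} \<and> c s = c t" unfolding s_def by (rule someI [of _ t]) (use t in simp)
    then have "s = t \<or> s = 0 \<and> t = 1 \<or> s = 1 \<and> t = 0" using fib t by blast
    then have "cis (2 * pi * s) = cis (2 * pi * t)" by auto
    then show ?thesis by (simp add: \<phi>_def s_def)
  qed
  \<comment> \<open>Continuity of \<open>\<phi>\<close> cannot be checked through a continuous
    choice of parameter, as there is none at the base point. Instead \<open>c\<close> is a quotient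
    map, from a compact space to a Hausdorff space, and \<open>\<phi> \<circ> c\<close> is
    continuous.\<close>
  have "quotient_map (top_of_set {0..1}) (top_of_set (path_image c)) c"
  proof (rule continuous_imp_quotient_map)
    show "continuous_map (top_of_set {0..1}) (top_of_set (path_image c)) c"
      using contc by (auto simp: path_image_def)
  qed (auto simp: compact_space_subtopology Hausdorff_space_subtopology path_image_def)
  moreover have "continuous_map (top_of_set {0..1}) euclidean (\<phi> \<circ> c)"
  proof -
    have "continuous_on {0..1} (\<lambda>t. cis (2 * pi * t))" by (intro continuous_intros)
    then have "continuous_on {0..1} (\<phi> \<circ> c)"
      using continuous_on_cong [of "{0..1}" "{0..1}" "\<phi> \<circ> c" "\<lambda>t. cis (2 * pi * t)"] \<phi> by simp
    then show ?thesis by simp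
  qed
  ultimately have "continuous_map (top_of_set (path_image c)) euclidean \<phi>"
    by (rule continuous_compose_quotient_map)
  then have cont: "continuous_on (path_image c) \<phi>" by simp
  have inj: "inj_on \<phi> (path_image c)"
  proof (rule inj_onI)
    fix x y assume "x \<in> path_image c" "y \<in> path_image c" and eq: "\<phi> x = \<phi> y"
    then obtain s t where st: "s \<in> {0..1}" "x = c s" "t \<in> {0..1}" "y = c t" by (auto simp: path_image_def)
    then have "cis (2 * pi * s) = cis (2 * pi * t)" using eq \<phi> by simp
    then have "s = t \<or> (s = 0 \<and> t = 1) \<or> (s = 1 \<and> t = 0)" using st by (intro cis_2pi_eq_cases) auto
    then show "x = y" using st c01 by auto
  qed
  have im: "\<phi> ` path_image c = sphere 0 1"
  proof
    show "\<phi> ` path_image c \<subseteq> sphere 0 1" by (auto simp: path_image_def \<phi>)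
    show "sphere 0 1 \<subseteq> \<phi> ` path_image c"
    proof
      fix z :: complex assume z: "z \<in> sphere 0 1"
      define t where "t = Arg2pi z / (2 * pi)"
      have "cis (2 * pi * t) = z"
        using z complex_norm_eq_1_exp [of z] by (simp add: t_def cis_conv_exp)
      moreover have "t \<in> {0..1}" using Arg2pi [of z] by (auto simp: t_def)
      ultimately show "z \<in> \<phi> ` path_image c"
        using \<phi> [of t] by (intro image_eqI [of _ _ "c t"]) (auto simp: path_image_def)
    qed
  qed
  show thesis using that [of \<phi>] cont inj im \<phi> by (simp add: cbij_def)
qed

text \<open>The vertices are indexed periodically by all naturals. An arc that passes the start of
  the numbering is then an ordinary interval of indices, and rotating the numbering amounts to
  adding \<open>n\<close> to some of the indices.\<close>

locale cyclic_order = two_regular +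
  fixes W :: "nat \<Rightarrow> real^3" and n :: nat
  assumes n3: "3 \<le> n" and W_eq: "\<And>p q. W p = W q \<longleftrightarrow> p mod n = q mod n"
    and W_range: "range W = p_vertices P"
    and C_eq: "C = range (\<lambda>k. closed_segment (W k) (W (Suc k)))"
begin

abbreviation seg :: "nat \<Rightarrow> (real^3) set" where
  "seg k \<equiv> closed_segment (W k) (W (Suc k))"

lemma W_window: "W p = W q \<Longrightarrow> p \<le> q \<Longrightarrow> q \<le> p + n \<Longrightarrow> q = p \<or> q = p + n"
  using mod_eq_window [of p n q] n3 W_eq by auto

lemma W_add [simp]: "W (k + n) = W k"
  using W_eq by simp

lemma W_ne: "p < q \<Longrightarrow> q < p + n \<Longrightarrow> W p \<noteq> W q"
  using W_window [of p q] by auto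

lemma W_Suc_ne: "W k \<noteq> W (Suc k)"
  using W_ne [of k "Suc k"] n3 by simp

lemma seg_C: "seg k \<in> C" using C_eq by blast

lemma seg_vertices: "seg k \<inter> p_vertices P = {W k, W (Suc k)}"
  using C_segment [OF seg_C W_Suc_ne] .

text \<open>A common point of two different edges is a vertex, hence an end of both; within one
  period an end can be shared only by consecutive edges. The second alternative is the step across
  the end of the period.\<close>

lemma seg_Int:
  assumes "a < b" "b < a + n" "x \<in> seg a" "x \<in> seg b"
  shows "b = Suc a \<and> x = W b \<or> Suc b = a + n \<and> x = W a"
proof -
  have 1: "W a \<noteq> W b" by (rule W_ne [OF assms(1,2)])
  have 2: "W (Suc a) \<noteq> W (Suc b)" using W_ne [of "Suc a" "Suc b"] assms(1,2) by simp
  have 3: "b = Suc a" if "W (Suc a) = W b"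
  proof -
    have "b = Suc a \<or> b = Suc a + n" using W_window [OF that] assms(1,2) by simp
    then show ?thesis using assms(2) by linarith
  qed
  have 4: "Suc b = a + n" if "W a = W (Suc b)"
  proof -
    have "Suc b = a \<or> Suc b = a + n" using W_window [OF that] assms(1,2) by simp
    then show ?thesis using assms(1) by linarith
  qed
  have ne: "seg a \<noteq> seg b"
  proof
    assume "seg a = seg b"
    then have "{W a, W (Suc a)} = {W b, W (Suc b)}" using seg_vertices by metis
    then have "W a = W (Suc b)" "W (Suc a) = W b" unfolding doubleton_eq_iff using 1 by simp_all
    then have "Suc b = a + n" "b = Suc a" using 3 4 by blast+
    then show False using n3 by simp
  qed
  have "seg a \<in> p_edges P" "seg b \<in> p_edges P" using seg_C C_edges by blast+
  then have "x \<in> p_vertices P"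
    using edges_Int_vertex ne assms(3,4) by blast
  then have "x \<in> seg a \<inter> p_vertices P" "x \<in> seg b \<inter> p_vertices P" using assms(3,4) by blast+
  then have "x = W a \<or> x = W (Suc a)" "x = W b \<or> x = W (Suc b)"
    unfolding seg_vertices by simp_all
  then show ?thesis using 1 2 3 4 by metis
qed

lemma cycle_arc:
  assumes "i < j" "j < i + n"
  shows "\<exists>g. arc g \<and> pathstart g = W i \<and> pathfinish g = W j \<and> path_image g = (\<Union>k\<in>{i..<j}. seg k)"
  using assms
proof (induction j)
  case (Suc j)
  show ?case
  proof (cases "i = j")
    case True
    have "arc (linepath (W j) (W (Suc j)))" using W_Suc_ne by (rule arc_linepath)
    then show ?thesis using True by (intro exI [of _ "linepath (W j) (W (Suc j))"]) auto
  next
    case False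
    then obtain g where g: "arc g" "pathstart g = W i" "pathfinish g = W j" "path_image g = (\<Union>k\<in>{i..<j}. seg k)"
      using Suc by auto
    have "arc (g +++ linepath (W j) (W (Suc j)))"
    proof (rule arc_join)
      show "path_image g \<inter> path_image (linepath (W j) (W (Suc j))) \<subseteq> {pathstart (linepath (W j) (W (Suc j)))}"
      proof
        fix x assume "x \<in> path_image g \<inter> path_image (linepath (W j) (W (Suc j)))"
        then obtain k where k: "i \<le> k" "k < j" "x \<in> seg k" "x \<in> seg j" unfolding g by auto
        then show "x \<in> {pathstart (linepath (W j) (W (Suc j)))}"
          using seg_Int [of k j x] Suc.prems by auto
      qed
    qed (use g W_Suc_ne in \<open>auto simp: arc_linepath\<close>)
    moreover have "path_image (g +++ linepath (W j) (W (Suc j))) = (\<Union>k\<in>{i..<Suc j}. seg k)"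
      using g False Suc.prems by (auto simp: path_image_join atLeastLessThanSuc)
    ultimately show ?thesis using g by (intro exI [of _ "g +++ linepath (W j) (W (Suc j))"]) auto
  qed
qed simp

lemma arcs_Int:
  assumes "i \<le> p" "p < j" "j \<le> q" "q < m" "m \<le> i + n" "x \<in> seg p" "x \<in> seg q"
  shows "q = j \<and> x = W j \<or> p = i \<and> m = i + n \<and> x = W i"
proof -
  have "q = Suc p \<and> x = W q \<or> Suc q = p + n \<and> x = W p"
    using seg_Int [of p q x] assms by simp
  then show ?thesis
  proof
    assume a: "q = Suc p \<and> x = W q"
    then have "q = j" using assms(2,3) by simp
    then show ?thesis using a by simp
  next
    assume a: "Suc q = p + n \<and> x = W p"
    then have "p = i" "m = i + n" using assms(1,4,5) by linarith+
    then show ?thesis using a by simp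
  qed
qed

lemma C_window: "\<Union>C = (\<Union>k\<in>{i..<i + n}. seg k)"
proof
  show "(\<Union>k\<in>{i..<i + n}. seg k) \<subseteq> \<Union>C" using seg_C by blast
  show "\<Union>C \<subseteq> (\<Union>k\<in>{i..<i + n}. seg k)"
  proof
    fix x assume "x \<in> \<Union>C"
    then obtain k where k: "x \<in> seg k" using C_eq by auto
    \<comment> \<open>The representative of \<open>k\<close> modulo \<open>n\<close> in the window
      that starts at \<open>i\<close>. The summand \<open>n - i mod n\<close> plays the part of
      \<open>- i\<close>.\<close>
    define r where "r = i + (k + (n - i mod n)) mod n"
    have "r mod n = k mod n"
    proof -
      have "r mod n = (i mod n + (k + (n - i mod n))) mod n"
        unfolding r_def by (simp add: mod_add_left_eq mod_add_right_eq)
      also have "i mod n + (k + (n - i mod n)) = k + n"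
        using n3 mod_less_divisor [of n i] by linarith
      finally show ?thesis by simp
    qed
    then have "W r = W k" "W (Suc r) = W (Suc k)" using W_eq by (auto simp: mod_Suc)
    moreover have "r \<in> {i..<i + n}" using n3 by (simp add: r_def)
    ultimately show "x \<in> (\<Union>k\<in>{i..<i + n}. seg k)" using k by (intro UN_I [of r]) auto
  qed
qed

lemma four_arc_loop:
  assumes "i < j" "j < k" "k < m" "m < i + n"
  obtains c where "simple_path c" "pathfinish c = pathstart c" "path_image c = \<Union>C"
    "c 0 = W i" "c (1/4) = W j" "c (1/2) = W k" "c (3/4) = W m"
proof -
  obtain g1 where g1: "arc g1" "pathstart g1 = W i" "pathfinish g1 = W j" "path_image g1 = (\<Union>k\<in>{i..<j}. seg k)"
    using cycle_arc [of i j] assms by auto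
  obtain g2 where g2: "arc g2" "pathstart g2 = W j" "pathfinish g2 = W k" "path_image g2 = (\<Union>k\<in>{j..<k}. seg k)"
    using cycle_arc [of j k] assms by auto
  obtain g3 where g3: "arc g3" "pathstart g3 = W k" "pathfinish g3 = W m" "path_image g3 = (\<Union>k\<in>{k..<m}. seg k)"
    using cycle_arc [of k m] assms by auto
  obtain g4 where g4: "arc g4" "pathstart g4 = W m" "pathfinish g4 = W (i + n)" "path_image g4 = (\<Union>k\<in>{m..<i + n}. seg k)"
    using cycle_arc [of m "i + n"] assms by auto
  have a12: "arc (g1 +++ g2)"
  proof (rule arc_join)
    show "path_image g1 \<inter> path_image g2 \<subseteq> {pathstart g2}"
    proof
      fix x assume "x \<in> path_image g1 \<inter> path_image g2"
      then obtain p q where "i \<le> p" "p < j" "j \<le> q" "q < k" "x \<in> seg p" "x \<in> seg q" unfolding g1 g2 by auto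
      then show "x \<in> {pathstart g2}" using arcs_Int [of i p j q k x] assms g2(2) by auto
    qed
  qed (use g1 g2 in auto)
  have a34: "arc (g3 +++ g4)"
  proof (rule arc_join)
    show "path_image g3 \<inter> path_image g4 \<subseteq> {pathstart g4}"
    proof
      fix x assume "x \<in> path_image g3 \<inter> path_image g4"
      then obtain p q where "k \<le> p" "p < m" "m \<le> q" "q < i + n" "x \<in> seg p" "x \<in> seg q" unfolding g3 g4 by auto
      then show "x \<in> {pathstart g4}" using arcs_Int [of k p m q "i + n" x] assms g4(2) by auto
    qed
  qed (use g3 g4 in auto)
  have im: "path_image (g1 +++ g2) = (\<Union>k\<in>{i..<k}. seg k)" "path_image (g3 +++ g4) = (\<Union>k\<in>{k..<i + n}. seg k)"
  proof -
    have "{i..<k} = {i..<j} \<union> {j..<k}" "{k..<i + n} = {k..<m} \<union> {m..<i + n}" using assms by auto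
    then show "path_image (g1 +++ g2) = (\<Union>k\<in>{i..<k}. seg k)" "path_image (g3 +++ g4) = (\<Union>k\<in>{k..<i + n}. seg k)"
      using g1 g2 g3 g4 by (simp_all add: path_image_join UN_Un)
  qed
  \<comment> \<open>The balanced nesting of the joins gives each arc a quarter of the parameter
    interval, so the four marked vertices sit at the times 0, 1/4, 1/2 and 3/4.\<close>
  have loop: "simple_path ((g1 +++ g2) +++ (g3 +++ g4))"
  proof (rule simple_path_join_loop [OF a12 a34])
    show "path_image (g1 +++ g2) \<inter> path_image (g3 +++ g4) \<subseteq> {pathstart (g1 +++ g2), pathstart (g3 +++ g4)}"
    proof
      fix x assume "x \<in> path_image (g1 +++ g2) \<inter> path_image (g3 +++ g4)"
      then obtain p q where "i \<le> p" "p < k" "k \<le> q" "q < i + n" "x \<in> seg p" "x \<in> seg q" unfolding im by auto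
      then have "x = W i \<or> x = W k" using arcs_Int [of i p k q "i + n" x] by auto
      then show "x \<in> {pathstart (g1 +++ g2), pathstart (g3 +++ g4)}" using g1 g3 by auto
    qed
  qed (use g1 g2 g3 g4 in auto)
  show thesis
  proof
    show "simple_path ((g1 +++ g2) +++ (g3 +++ g4))" by (rule loop)
    show "pathfinish ((g1 +++ g2) +++ (g3 +++ g4)) = pathstart ((g1 +++ g2) +++ (g3 +++ g4))"
      using g1 g4 by simp
    have "path_image ((g1 +++ g2) +++ (g3 +++ g4)) = path_image (g1 +++ g2) \<union> path_image (g3 +++ g4)"
      using g2 g3 by (intro path_image_join) simp
    also have "\<dots> = (\<Union>k\<in>{i..<i + n}. seg k)"
    proof -
      have "{i..<i + n} = {i..<k} \<union> {k..<i + n}" using assms by auto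
      then show ?thesis unfolding im by (simp add: UN_Un)
    qed
    finally show "path_image ((g1 +++ g2) +++ (g3 +++ g4)) = \<Union>C" using C_window by simp
  qed (use g1 g2 g3 g4 in \<open>auto simp: joinpaths_def pathstart_def pathfinish_def\<close>)
qed

text \<open>Opposite marks become opposite points of the circle: interleaved chords can be made
  perpendicular diameters, and non-interleaved ones parallel chords.\<close>

lemma circle_four_marks:
  assumes "i < j" "j < k" "k < m" "m < i + n"
  obtains \<phi> where "cbij (\<Union>C) (sphere (0::complex) 1) \<phi>"
    "\<phi> (W i) = 1" "\<phi> (W j) = \<i>" "\<phi> (W k) = -1" "\<phi> (W m) = -\<i>"
proof -
  obtain c where c: "simple_path c" "pathfinish c = pathstart c" "path_image c = \<Union>C"
    "c 0 = W i" "c (1/4) = W j" "c (1/2) = W k" "c (3/4) = W m"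
    using four_arc_loop [OF assms] .
  obtain \<phi> where \<phi>: "cbij (\<Union>C) (sphere (0::complex) 1) \<phi>"
    "\<And>t. t \<in> {0..1} \<Longrightarrow> \<phi> (c t) = cis (2 * pi * t)"
    using simple_loop_circle [OF c(1,2)] unfolding c(3) by blast
  show thesis
  proof
    show "\<phi> (W i) = 1" "\<phi> (W j) = \<i>" "\<phi> (W k) = -1"
      using \<phi>(2) [of 0] \<phi>(2) [of "1/4"] \<phi>(2) [of "1/2"] c by (auto simp: complex_eq_iff)
    have "2 * pi * (3/4) = 3/2 * pi" by simp
    then have "cis (2 * pi * (3/4)) = - \<i>"
      using cos_3over2_pi sin_3over2_pi by (simp add: complex_eq_iff)
    then show "\<phi> (W m) = - \<i>" using \<phi>(2) [of "3/4"] c by auto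
  qed (rule \<phi>(1))
qed

end

lemma open_segment_sphere_subset_ball:
  fixes a b :: "'a::euclidean_space"
  assumes "norm a = 1" "norm b = 1"
  shows "open_segment a b \<subseteq> ball 0 1"
proof
  fix x assume "x \<in> open_segment a b"
  then have "dist 0 x < dist 0 a \<or> dist 0 x < dist 0 b" by (rule dist_decreases_open_segment)
  then show "x \<in> ball 0 1" using assms by simp
qed

text \<open>This identifies the inside without any drawing: the unbounded connected outside cannot
  enter the bounded open set \<open>A\<close>, so \<open>A\<close> is contained in the connected
  inside and must exhaust it.\<close>

lemma bounded_clopen_inside:
  fixes c :: "real \<Rightarrow> complex"
  assumes c: "simple_path c" "pathfinish c = pathstart c"
    and A: "open A" "bounded A" "A \<noteq> {}" and B: "open B" "A \<inter> B = {}"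
    and un: "A \<union> B = - path_image c"
  shows "inside (path_image c) = A"
proof -
  have J: "connected (inside (path_image c))" "connected (outside (path_image c))"
    "\<not> bounded (outside (path_image c))" "inside (path_image c) \<inter> outside (path_image c) = {}"
    "inside (path_image c) \<union> outside (path_image c) = - path_image c"
    using Jordan_inside_outside [OF c] by simp_all
  have io: "inside (path_image c) \<union> outside (path_image c) = A \<union> B" using J(5) un by simp
  have "outside (path_image c) \<inter> A = {}"
  proof (rule ccontr)
    assume "outside (path_image c) \<inter> A \<noteq> {}"
    moreover have "outside (path_image c) \<subseteq> A \<union> B" using io by blast
    ultimately have "outside (path_image c) \<subseteq> A"
      using connected_subset_one_side J(2) A(1) B by metis
    then show False using J(3) A(2) bounded_subset by metis
  qed
  then have sub: "A \<subseteq> inside (path_image c)" using io by blast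
  moreover have "inside (path_image c) \<subseteq> A"
  proof (rule connected_subset_one_side [OF J(1) _ A(1) B])
    show "inside (path_image c) \<subseteq> A \<union> B" using io by blast
    show "inside (path_image c) \<inter> A \<noteq> {}" using sub A(3) by blast
  qed
  ultimately show ?thesis by blast
qed

section \<open>Two-colourings of the facets\<close>

text \<open>With both colours present among its three facets, a vertex has two facets of one colour
  and one of the other. This local condition is what makes the colour boundary 2-regular.\<close>

locale coloured = simple3 +
  fixes col :: "(real^3) set \<Rightarrow> bool"
  assumes mixed: "\<And>v. v \<in> p_vertices P \<Longrightarrow> \<exists>F\<in>p_facets P. \<exists>F'\<in>p_facets P. v \<in> F \<and> v \<in> F' \<and> col F \<noteq> col F'"
begin

definition U :: "bool \<Rightarrow> (real^3) set" where
  "U b = \<Union>{F \<in> p_facets P. col F = b}"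

definition C :: "(real^3) set set" where
  "C = {I \<in> p_edges P. \<exists>F\<in>p_facets P. \<exists>F'\<in>p_facets P. I \<subseteq> F \<and> I \<subseteq> F' \<and> col F \<noteq> col F'}"

lemma U_closed: "closed (U b)" "compact (U b)"
proof -
  have "finite {F \<in> p_facets P. col F = b}" using finite_facets by simp
  then show "compact (U b)" unfolding U_def using facetD(9) by (intro compact_Union) auto
  then show "closed (U b)" by (rule compact_imp_closed)
qed

lemma U_Un: "U b \<union> U (\<not> b) = frontier P"
  unfolding frontier_facets U_def by auto

lemma C_subset_U: "I \<in> C \<Longrightarrow> I \<subseteq> U b"
  unfolding C_def U_def by (cases b) blast+

lemma U_Int: "U b \<inter> U (\<not> b) = \<Union>C"
proof
  show "\<Union>C \<subseteq> U b \<inter> U (\<not> b)" using C_subset_U by blast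
  show "U b \<inter> U (\<not> b) \<subseteq> \<Union>C"
  proof
    fix x assume "x \<in> U b \<inter> U (\<not> b)"
    then obtain F F' where F: "F \<in> p_facets P" "F' \<in> p_facets P" "x \<in> F" "x \<in> F'" "col F \<noteq> col F'"
      unfolding U_def by blast
    then have "F \<inter> F' \<in> p_edges P" by (intro facet_Int_edge) auto
    then have "F \<inter> F' \<in> C" unfolding C_def using F by blast
    then show "x \<in> \<Union>C" using F by blast
  qed
qed

lemma C_edges: "C \<subseteq> p_edges P"
  by (auto simp: C_def)

lemma edge_in_C_iff:
  assumes "F \<in> p_facets P" "F' \<in> p_facets P" "F \<noteq> F'" "F \<inter> F' \<noteq> {}"
  shows "F \<inter> F' \<in> C \<longleftrightarrow> col F \<noteq> col F'"
proof
  assume "F \<inter> F' \<in> C"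
  then obtain G G' where G: "G \<in> p_facets P" "G' \<in> p_facets P" "F \<inter> F' \<subseteq> G" "F \<inter> F' \<subseteq> G'" "col G \<noteq> col G'"
    unfolding C_def by blast
  then have "G \<in> {H \<in> p_facets P. F \<inter> F' \<subseteq> H}" "G' \<in> {H \<in> p_facets P. F \<inter> F' \<subseteq> H}" by blast+
  then have "G \<in> {F, F'}" "G' \<in> {F, F'}" unfolding edge_facets_eq [OF assms] .
  then show "col F \<noteq> col F'" using G(5) by auto
next
  assume "col F \<noteq> col F'"
  then show "F \<inter> F' \<in> C" using facet_Int_edge [OF assms] assms by (auto simp: C_def)
qed

lemma vertex_structure:
  assumes "v \<in> p_vertices P"
  obtains F1 F2 F3 where "{F \<in> p_facets P. v \<in> F} = {F1, F2, F3}" "F1 \<noteq> F2" "F1 \<noteq> F3" "F2 \<noteq> F3"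
    "col F1 = col F2" "col F3 \<noteq> col F1"
proof -
  obtain F1 F2 F3 where ne: "F1 \<noteq> F2" "F1 \<noteq> F3" "F2 \<noteq> F3" and F: "{F \<in> p_facets P. v \<in> F} = {F1, F2, F3}"
    using vertex_facets [OF assms] by metis
  obtain G G' where "G \<in> {F \<in> p_facets P. v \<in> F}" "G' \<in> {F \<in> p_facets P. v \<in> F}" "col G \<noteq> col G'"
    using mixed [OF assms] by blast
  then have G: "\<not> (col F1 = col F2 \<and> col F1 = col F3)" unfolding F by auto
  have F': "{F \<in> p_facets P. v \<in> F} = {F1, F3, F2}" "{F \<in> p_facets P. v \<in> F} = {F2, F3, F1}"
    unfolding F by (simp_all add: insert_commute)
  consider "col F1 = col F2" "col F3 \<noteq> col F1" | "col F1 = col F3" "col F2 \<noteq> col F1" | "col F2 = col F3" "col F1 \<noteq> col F2"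
    using G by argo
  then show thesis
  proof cases
    case 1 show ?thesis by (rule that [OF F ne 1])
  next
    case 2 show ?thesis by (rule that [OF F'(1) ne(2,1) ne(3) [symmetric] 2])
  next
    case 3 show ?thesis by (rule that [OF F'(2) ne(3) ne(1) [symmetric] ne(2) [symmetric] 3])
  qed
qed

text \<open>Of the three edges at \<open>v\<close> only the one between the two facets of equal
  colour stays out of the boundary. Hence the edges outside \<open>C\<close> form a perfect matching
  of the vertices, which is why different chords are disjoint.\<close>

lemma vertex_edges:
  assumes "v \<in> p_vertices P"
  obtains I1 I2 J where "{I \<in> C. v \<in> I} = {I1, I2}" "I1 \<noteq> I2" "{I \<in> p_edges P - C. v \<in> I} = {J}"
proof -
  obtain F1 F2 F3 where F: "{F \<in> p_facets P. v \<in> F} = {F1, F2, F3}" and ne: "F1 \<noteq> F2" "F1 \<noteq> F3" "F2 \<noteq> F3"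
    and col: "col F1 = col F2" "col F3 \<noteq> col F1" by (rule vertex_structure [OF assms])
  have mem: "F1 \<in> {F \<in> p_facets P. v \<in> F}" "F2 \<in> {F \<in> p_facets P. v \<in> F}" "F3 \<in> {F \<in> p_facets P. v \<in> F}"
    unfolding F by simp_all
  then have f: "F1 \<in> p_facets P" "F2 \<in> p_facets P" "F3 \<in> p_facets P" and v: "v \<in> F1" "v \<in> F2" "v \<in> F3" by simp_all
  have i: "F1 \<inter> F2 \<noteq> {}" "F1 \<inter> F3 \<noteq> {}" "F2 \<inter> F3 \<noteq> {}" using v by blast+
  have c: "F1 \<inter> F2 \<notin> C" "F1 \<inter> F3 \<in> C" "F2 \<inter> F3 \<in> C"
    using edge_in_C_iff [OF f(1,2) ne(1) i(1)] edge_in_C_iff [OF f(1,3) ne(2) i(2)]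
      edge_in_C_iff [OF f(2,3) ne(3) i(3)] col by simp_all
  have all: "I = F1 \<inter> F2 \<or> I = F1 \<inter> F3 \<or> I = F2 \<inter> F3" if I: "I \<in> p_edges P" "v \<in> I" for I
  proof -
    obtain G G' where G: "G \<noteq> G'" "G \<in> p_facets P" "G' \<in> p_facets P" "I = G \<inter> G'"
      using edge_facets [OF I(1)] by metis
    then have "G \<in> {F \<in> p_facets P. v \<in> F}" "G' \<in> {F \<in> p_facets P. v \<in> F}" using I(2) by simp_all
    then have "G = F1 \<or> G = F2 \<or> G = F3" "G' = F1 \<or> G' = F2 \<or> G' = F3" unfolding F by simp_all
    then show ?thesis using G(1,4) by (elim disjE) (simp_all add: Int_commute)
  qed
  have e: "F1 \<inter> F2 \<in> p_edges P" using facet_Int_edge [OF f(1,2) ne(1) i(1)] .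
  show thesis
  proof
    show "{I \<in> C. v \<in> I} = {F1 \<inter> F3, F2 \<inter> F3}"
    proof (intro equalityI subsetI)
      fix I assume "I \<in> {I \<in> C. v \<in> I}"
      then have I: "I \<in> C" "I \<in> p_edges P" "v \<in> I" using C_edges by blast+
      then have "I \<noteq> F1 \<inter> F2" using c(1) by metis
      then show "I \<in> {F1 \<inter> F3, F2 \<inter> F3}" using all [OF I(2,3)] by simp
    qed (use c v in auto)
    show "F1 \<inter> F3 \<noteq> F2 \<inter> F3"
    proof
      assume eq: "F1 \<inter> F3 = F2 \<inter> F3"
      have "F2 \<in> {G \<in> p_facets P. F1 \<inter> F3 \<subseteq> G}" using eq f(2) by auto
      then have "F2 \<in> {F1, F3}" unfolding edge_facets_eq [OF f(1,3) ne(2) i(2)] .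
      then show False using ne by auto
    qed
    show "{I \<in> p_edges P - C. v \<in> I} = {F1 \<inter> F2}"
    proof (intro equalityI subsetI)
      fix I assume "I \<in> {I \<in> p_edges P - C. v \<in> I}"
      then have I: "I \<notin> C" "I \<in> p_edges P" "v \<in> I" by blast+
      then show "I \<in> {F1 \<inter> F2}" using all [OF I(2,3)] c(2,3) by (elim disjE) simp_all
    qed (use c e v in auto)
  qed
qed

sublocale two_regular P C
proof
  show "C \<subseteq> p_edges P" by (rule C_edges)
  fix v assume "v \<in> p_vertices P"
  then obtain I1 I2 where "{I \<in> C. v \<in> I} = {I1, I2}" "I1 \<noteq> I2" using vertex_edges by metis
  then show "card {I \<in> C. v \<in> I} = 2" by simp
qed

lemma vertex_in_UC: "v \<in> p_vertices P \<Longrightarrow> v \<in> \<Union>C"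
proof -
  assume "v \<in> p_vertices P"
  then have "{I \<in> C. v \<in> I} \<noteq> {}" using two by (metis card.empty zero_neq_numeral)
  then show ?thesis by blast
qed

lemma chord_class:
  assumes I: "I \<in> p_edges P - C"
  obtains b where "I \<subseteq> U b" "I \<inter> U (\<not> b) = I \<inter> p_vertices P"
proof -
  obtain F F' where F: "F \<noteq> F'" "F \<in> p_facets P" "F' \<in> p_facets P" "I = F \<inter> F'"
    using edge_facets [of I] I by (metis DiffD1)
  have ne: "F \<inter> F' \<noteq> {}" using edgeD(3) [of I] I F(4) by blast
  have "I \<subseteq> U (col F)" unfolding U_def using F by blast
  moreover have "I \<inter> U (\<not> col F) = I \<inter> p_vertices P"
  proof (intro equalityI subsetI)
    fix x assume x: "x \<in> I \<inter> U (\<not> col F)"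
    then have "x \<in> U (col F) \<inter> U (\<not> col F)" using calculation by blast
    then obtain J where J: "J \<in> C" "x \<in> J" using U_Int by blast
    then have "x \<in> p_vertices P" using edges_Int_vertex [of I J x] I x C_edges by blast
    then show "x \<in> I \<inter> p_vertices P" using x by blast
  next
    fix x assume x: "x \<in> I \<inter> p_vertices P"
    then have "x \<in> \<Union>C" using vertex_in_UC by blast
    then show "x \<in> I \<inter> U (\<not> col F)" using x C_subset_U by blast
  qed
  ultimately show thesis by (rule that)
qed

lemma chords_disjoint:
  assumes "I \<in> p_edges P - C" "J \<in> p_edges P - C" "I \<noteq> J"
  shows "I \<inter> J = {}"
proof (rule ccontr)
  assume "I \<inter> J \<noteq> {}"
  then obtain x where x: "x \<in> I" "x \<in> J" by blast
  then have v: "x \<in> p_vertices P" using edges_Int_vertex [of I J x] assms by blast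
  obtain K where "{I \<in> p_edges P - C. x \<in> I} = {K}" using vertex_edges [OF v] by metis
  moreover have "I \<in> {I \<in> p_edges P - C. x \<in> I}" "J \<in> {I \<in> p_edges P - C. x \<in> I}" using assms x by blast+
  ultimately show False using assms(3) by (metis singletonD)
qed

lemma U_proper: "\<exists>x\<in>U b. x \<notin> U (\<not> b)"
proof -
  obtain v where "v \<in> p_vertices P" using vertices_nonempty by blast
  then obtain F where F: "F \<in> p_facets P" "col F = b" using mixed by metis
  have "rel_interior F \<noteq> {}" using facetD(5,8) [OF F(1)] rel_interior_eq_empty by blast
  then obtain x where x: "x \<in> rel_interior F" by blast
  then have "x \<in> F" "x \<notin> \<Union>(p_edges P)" using facet_rel_interior [OF F(1)] by blast+
  then have "x \<in> U b" "x \<notin> \<Union>C" using F C_edges by (auto simp: U_def)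
  then show ?thesis using U_Int by blast
qed

text \<open>Puncturing the boundary sphere of \<open>P\<close> turns the region into a Jordan disc
  in the plane, subdivided by chords into images of facets, and the planar straightening applies.
  Both regions receive the same values on their common boundary.\<close>

lemma straighten_region:
  assumes c: "simple_path c" "pathfinish c = pathstart c" "path_image c = \<Union>C"
    and \<phi>: "cbij (\<Union>C) (sphere (0::complex) 1) \<phi>"
  obtains f where "cbij (U b) (cball (0::complex) 1) f" "\<And>x. x \<in> \<Union>C \<Longrightarrow> f x = \<phi> x"
    "\<And>v w. closed_segment v w \<in> p_edges P - C \<Longrightarrow> closed_segment v w \<subseteq> U b \<Longrightarrow>
       f ` closed_segment v w = closed_segment (\<phi> v) (\<phi> w)"
proof -
  define \<Gamma> where "\<Gamma> = \<Union>C"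
  have \<Gamma>U: "\<Gamma> \<subseteq> U b" "\<Gamma> \<subseteq> U (\<not> b)" unfolding \<Gamma>_def using C_subset_U by blast+
  have UU: "U b \<inter> U (\<not> b) = \<Gamma>" unfolding \<Gamma>_def by (rule U_Int)
  \<comment> \<open>The puncture is taken in the other region, so the compact set \<open>U b\<close>
    survives and its image is the bounded side of the curve.\<close>
  obtain p0 where p0: "p0 \<in> U (\<not> b)" "p0 \<notin> U b" using U_proper [of "\<not> b"] by auto
  have p0f: "p0 \<in> rel_frontier P" using p0 U_Un [of b] full(4) by blast
  have "rel_frontier P - {p0} homeomorphic (UNIV :: complex set)"
    by (rule homeomorphic_punctured_sphere_affine_gen [OF poly(3) polytope_imp_bounded [OF poly(1)] p0f])
       (simp_all add: dimP)
  then obtain \<sigma> \<tau> where hom: "homeomorphism (frontier P - {p0}) (UNIV :: complex set) \<sigma> \<tau>"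
    unfolding full(4) homeomorphic_def by blast
  define S where "S = frontier P - {p0}"
  have US: "U b \<subseteq> S" using U_Un [of b] p0(2) by (auto simp: S_def)
  have \<Gamma>S: "\<Gamma> \<subseteq> S" using US \<Gamma>U by blast
  have cont\<sigma>: "continuous_on S \<sigma>" and cont\<tau>: "continuous_on UNIV \<tau>" and \<sigma>S: "\<sigma> ` S = UNIV"
    using homeomorphism_cont1 [OF hom] homeomorphism_cont2 [OF hom] homeomorphism_image1 [OF hom]
    by (simp_all add: S_def)
  have \<tau>\<sigma>: "\<tau> (\<sigma> x) = x" if "x \<in> S" for x
    using homeomorphism_apply1 [OF hom] that by (simp add: S_def)
  have inj: "inj_on \<sigma> S" using \<tau>\<sigma> by (rule inj_on_inverseI)
  have opens: "open (\<sigma> ` (S - K))" if "closed K" for K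
  proof -
    have "openin (top_of_set S) (S - K)" unfolding openin_open
      by (intro exI [of _ "- K"]) (use that in auto)
    then have "openin (top_of_set UNIV) (\<sigma> ` (S - K))"
      using homeomorphism_imp_open_map [OF hom [folded S_def]] by blast
    then show ?thesis by simp
  qed
  have imdiff: "\<sigma> ` (X - Y) = \<sigma> ` X - \<sigma> ` Y" if "X \<subseteq> S" "Y \<subseteq> S" for X Y
    using inj_on_image_set_diff [OF inj] that by blast
  have cb\<sigma>: "cbij X (\<sigma> ` X) \<sigma>" if "X \<subseteq> S" for X
    using that continuous_on_subset [OF cont\<sigma>] inj_on_subset [OF inj] by (simp add: cbij_def)
  define c' where "c' = \<sigma> \<circ> c"
  have pc': "path_image c' = \<sigma> ` \<Gamma>" by (simp add: c'_def path_image_compose c(3) \<Gamma>_def)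
  have c': "simple_path c'" "pathfinish c' = pathstart c'"
  proof -
    show "simple_path c'" unfolding c'_def
      by (rule simple_path_continuous_image [OF c(1)])
         (use \<Gamma>S continuous_on_subset [OF cont\<sigma>] inj_on_subset [OF inj] c(3) \<Gamma>_def in auto)
    show "pathfinish c' = pathstart c'" using c(2) by (simp add: c'_def pathfinish_compose pathstart_compose)
  qed
  define A where "A = \<sigma> ` (U b - \<Gamma>)"
  define B where "B = \<sigma> ` (S - U b)"
  \<comment> \<open>Openness of the image of \<open>U b - \<Gamma>\<close> becomes visible in this
    form: it is the complement, in the punctured sphere, of the other closed region.\<close>
  have A_eq: "U b - \<Gamma> = S - U (\<not> b)" using US UU U_Un [of b] p0 by (auto simp: S_def)
  have ins: "inside (path_image c') = A"
  proof (rule bounded_clopen_inside [OF c'])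
    show "open A" unfolding A_def A_eq by (rule opens [OF U_closed(1)])
    show "open B" unfolding B_def by (rule opens [OF U_closed(1)])
    have "compact (\<sigma> ` U b)"
      using U_closed(2) continuous_on_subset [OF cont\<sigma> US] by (rule compact_continuous_image [rotated])
    then show "bounded A" unfolding A_def by (meson bounded_subset compact_imp_bounded image_mono Diff_subset)
    show "A \<noteq> {}" unfolding A_def using U_proper [of b] UU by blast
    have A': "A = \<sigma> ` U b - \<sigma> ` \<Gamma>" unfolding A_def by (rule imdiff [OF US \<Gamma>S])
    have B': "B = UNIV - \<sigma> ` U b" unfolding B_def by (subst imdiff [OF _ US]) (auto simp: \<sigma>S)
    show "A \<inter> B = {}" unfolding A' B' by blast
    show "A \<union> B = - path_image c'" unfolding A' B' pc' using \<Gamma>U by blast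
  qed
  note ins' = ins [unfolded pc']
  define D where "D = {I \<in> p_edges P - C. I \<subseteq> U b}"
  have "\<forall>I\<in>D. \<exists>v w. v \<in> p_vertices P \<and> w \<in> p_vertices P \<and> v \<noteq> w \<and> I = closed_segment v w \<and> I \<inter> p_vertices P = {v, w}"
  proof
    fix I assume "I \<in> D"
    then have "I \<in> p_edges P" by (simp add: D_def)
    then show "\<exists>v w. v \<in> p_vertices P \<and> w \<in> p_vertices P \<and> v \<noteq> w \<and> I = closed_segment v w \<and> I \<inter> p_vertices P = {v, w}"
      using edge_segment by metis
  qed
  then obtain vv ww where vw: "\<And>I. I \<in> D \<Longrightarrow> vv I \<in> p_vertices P \<and> ww I \<in> p_vertices P \<and> vv I \<noteq> ww I \<and>
      I = closed_segment (vv I) (ww I) \<and> I \<inter> p_vertices P = {vv I, ww I}"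
    by metis
  have vwV: "vv I \<in> p_vertices P" "ww I \<in> p_vertices P" and vwne: "vv I \<noteq> ww I"
    and vwseg: "closed_segment (vv I) (ww I) = I" and vwI: "I \<inter> p_vertices P = {vv I, ww I}"
    if "I \<in> D" for I
    using vw [OF that] by simp_all
  define e where "e = (\<lambda>I. \<sigma> \<circ> linepath (vv I) (ww I))"
  have pe: "path_image (e I) = \<sigma> ` I" "pathstart (e I) = \<sigma> (vv I)" "pathfinish (e I) = \<sigma> (ww I)" if "I \<in> D" for I
  proof -
    have "path_image (e I) = \<sigma> ` closed_segment (vv I) (ww I)" by (simp add: e_def path_image_compose)
    then show "path_image (e I) = \<sigma> ` I" unfolding vwseg [OF that] .
  qed (simp_all add: e_def pathstart_compose pathfinish_compose)
  have DS: "I \<subseteq> S" if "I \<in> D" for I using that US by (auto simp: D_def)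
  have D\<Gamma>: "I \<inter> \<Gamma> = {vv I, ww I}" if I: "I \<in> D" for I
  proof -
    have IU: "I \<in> p_edges P - C" "I \<subseteq> U b" using I by (auto simp: D_def)
    have "I \<inter> \<Gamma> = I \<inter> p_vertices P"
    proof (intro equalityI subsetI)
      fix x assume x: "x \<in> I \<inter> \<Gamma>"
      then obtain J where "J \<in> C" "x \<in> J" unfolding \<Gamma>_def by blast
      then have "x \<in> p_vertices P" using edges_Int_vertex [of I J x] IU x C_edges by blast
      then show "x \<in> I \<inter> p_vertices P" using x by blast
    qed (use vertex_in_UC in \<open>auto simp: \<Gamma>_def\<close>)
    then show ?thesis unfolding vwI [OF I] .
  qed
  have vw\<Gamma>: "vv I \<in> \<Gamma>" "ww I \<in> \<Gamma>" if "I \<in> D" for I using vwV [OF that] vertex_in_UC unfolding \<Gamma>_def by blast+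
  have chord: "chord_of c' (e I)" if I: "I \<in> D" for I
  proof -
    have "simple_path (e I)" unfolding e_def
    proof (rule simple_path_continuous_image)
      show "simple_path (linepath (vv I) (ww I))"
        using vwne [OF I] by (intro arc_imp_simple_path arc_linepath)
      have "path_image (linepath (vv I) (ww I)) \<subseteq> S"
        using DS [OF I] vwseg [OF I] by simp
      then show "continuous_on (path_image (linepath (vv I) (ww I))) \<sigma>" "inj_on \<sigma> (path_image (linepath (vv I) (ww I)))"
        using continuous_on_subset [OF cont\<sigma>] inj_on_subset [OF inj] by blast+
    qed
    moreover have "pathfinish (e I) \<noteq> pathstart (e I)"
      unfolding pe [OF I] using inj_onD [OF inj, of "ww I" "vv I"] vw\<Gamma> [OF I] \<Gamma>S vwne [OF I] by auto
    ultimately have "arc (e I)" by (simp add: arc_simple_path)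
    moreover have "path_image (e I) - {pathstart (e I), pathfinish (e I)} \<subseteq> A"
    proof -
      have "\<sigma> ` I - \<sigma> ` {vv I, ww I} = \<sigma> ` (I - {vv I, ww I})"
        using imdiff [OF DS [OF I], of "{vv I, ww I}"] vw\<Gamma> [OF I] \<Gamma>S by auto
      moreover have "I - {vv I, ww I} \<subseteq> U b - \<Gamma>"
        using D\<Gamma> [OF I] I unfolding D_def by blast
      ultimately show ?thesis unfolding pe [OF I] A_def by auto
    qed
    ultimately show ?thesis unfolding chord_of_def pe [OF I] pc' ins' using vw\<Gamma> [OF I] by auto
  qed
  have disD: "path_image (e I) \<inter> path_image (e J) = {}" if "I \<in> D" "J \<in> D" "e I \<noteq> e J" for I J
  proof -
    have "I \<noteq> J" using that(3) by blast
    then have "I \<inter> J = {}" using chords_disjoint that by (auto simp: D_def)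
    then show ?thesis unfolding pe [OF that(1)] pe [OF that(2)]
      using inj_on_image_Int [OF inj DS [OF that(1)] DS [OF that(2)]] by simp
  qed
  define FS where "FS = {F \<in> p_facets P. col F = b}"
  have FSU: "F \<subseteq> U b" if "F \<in> FS" for F using that by (auto simp: FS_def U_def)
  have FSp: "F \<in> p_facets P" if "F \<in> FS" for F using that by (simp add: FS_def)
  have ri: "rel_interior F = F - \<Union>(p_edges P)" if "F \<in> FS" for F using facet_rel_interior FSp [OF that] .
  define FF where "FF = (\<lambda>F. \<sigma> ` rel_interior F) ` FS"
  have FFprop: "open (\<sigma> ` rel_interior F) \<and> connected (\<sigma> ` rel_interior F) \<and> \<sigma> ` rel_interior F \<noteq> {} \<and>
      disc_face (\<sigma> ` rel_interior F)" if F: "F \<in> FS" for F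
  proof -
    note f = FSp [OF F]
    have FS': "F \<subseteq> S" using FSU [OF F] US by blast
    have rs: "rel_interior F \<subseteq> F" by (rule rel_interior_subset)
    have op: "open (\<sigma> ` rel_interior F)"
    proof -
      \<comment> \<open>Written as the complement of a finite union of closed sets, the relative
        interior is seen to be open in the punctured sphere and so has an open image in the
        plane.\<close>
      have "rel_interior F = S - (\<Union>(p_facets P - {F}) \<union> \<Union>(p_edges P))"
      proof (intro equalityI subsetI)
        fix x assume x: "x \<in> rel_interior F"
        then have "x \<in> F" "x \<notin> \<Union>(p_edges P)" using ri [OF F] by blast+
        moreover have "x \<notin> \<Union>(p_facets P - {F})"
          using facets_meet_in_edges [OF f] calculation by blast
        ultimately show "x \<in> S - (\<Union>(p_facets P - {F}) \<union> \<Union>(p_edges P))" using FS' by blast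
      next
        fix x assume x: "x \<in> S - (\<Union>(p_facets P - {F}) \<union> \<Union>(p_edges P))"
        then have "x \<in> \<Union>(p_facets P)" using frontier_facets by (auto simp: S_def)
        then have "x \<in> F" using x by blast
        then show "x \<in> rel_interior F" using x ri [OF F] by blast
      qed
      moreover have "closed (\<Union>(p_facets P - {F}) \<union> \<Union>(p_edges P))"
        using finite_facets finite_edges facetD(10) edgeD(8) by (intro closed_Un closed_Union) auto
      ultimately show ?thesis using opens by simp
    qed
    have con: "connected (\<sigma> ` rel_interior F)"
      using continuous_on_subset [OF cont\<sigma>] rs FS' convex_rel_interior [OF facetD(8) [OF f]]
      by (intro connected_continuous_image convex_connected) blast+
    have ne: "rel_interior F \<noteq> {}" using facetD(5,8) [OF f] rel_interior_eq_empty by blast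
    have comp: "compact (\<sigma> ` F)"
      using facetD(9) [OF f] continuous_on_subset [OF cont\<sigma> FS'] by (rule compact_continuous_image [rotated])
    have cl: "closure (\<sigma> ` rel_interior F) = \<sigma> ` F"
    proof
      show "closure (\<sigma> ` rel_interior F) \<subseteq> \<sigma> ` F"
        using comp rs by (intro closure_minimal) (auto simp: compact_imp_closed)
      have clF: "closure (rel_interior F) = F"
        using convex_closure_rel_interior [OF facetD(8) [OF f]] facetD(10) [OF f] by (simp add: closure_closed)
      have "\<sigma> ` closure (rel_interior F) \<subseteq> closure (\<sigma> ` rel_interior F)"
        by (rule image_closure_subset) (simp_all add: clF continuous_on_subset [OF cont\<sigma> FS'] closure_subset)
      then show "\<sigma> ` F \<subseteq> closure (\<sigma> ` rel_interior F)" unfolding clF .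
    qed
    have fr: "frontier (\<sigma> ` rel_interior F) = \<sigma> ` rel_frontier F"
    proof -
      have "rel_frontier F = F - rel_interior F" using facetD(10) [OF f] by (simp add: rel_frontier_def)
      moreover have "\<sigma> ` (F - rel_interior F) = \<sigma> ` F - \<sigma> ` rel_interior F"
        using FS' rs by (intro imdiff) auto
      ultimately show ?thesis unfolding frontier_def cl by (simp add: interior_open [OF op])
    qed
    \<comment> \<open>The disc condition on faces is met here: the facet is convex and compact of
      dimension 2, and \<open>\<sigma>\<close> is injective and continuous on all of it.\<close>
    obtain g where g: "cbij F (cball (0::complex) 1) g" "g ` rel_frontier F = rel_frontier (cball (0::complex) 1)"
      using convex_body_cbij [of F "cball (0::complex) 1"] facetD(4,8,9) [OF f] by (auto simp: aff_dim_cball)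
    have "cbij (\<sigma> ` F) (cball (0::complex) 1) (g \<circ> inv_into F \<sigma>)"
      by (rule cbij_compose [OF cbij_inv_into [OF cb\<sigma> [OF FS'] facetD(9) [OF f]] g(1)])
    moreover have "(g \<circ> inv_into F \<sigma>) ` (\<sigma> ` rel_frontier F) = sphere 0 1"
    proof -
      have "rel_frontier F \<subseteq> F" using facetD(10) [OF f] by (auto simp: rel_frontier_def)
      then have "inv_into F \<sigma> ` (\<sigma> ` rel_frontier F) = rel_frontier F"
        using inj_on_subset [OF inj FS'] by (simp add: inv_into_image_cancel)
      then have "(g \<circ> inv_into F \<sigma>) ` (\<sigma> ` rel_frontier F) = g ` rel_frontier F" by (metis image_comp)
      then show ?thesis using g(2) by (simp add: rel_frontier_nonempty_interior)
    qed
    ultimately have "disc_face (\<sigma> ` rel_interior F)" unfolding disc_face_def cl fr by blast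
    then show ?thesis using op con ne by simp
  qed
  have disFF: "disjoint FF"
  proof -
    have "\<sigma> ` rel_interior F \<inter> \<sigma> ` rel_interior G = {}" if "F \<in> FS" "G \<in> FS" "F \<noteq> G" for F G
    proof -
      have "rel_interior F \<inter> rel_interior G = {}"
        using facets_meet_in_edges [OF FSp FSp] that ri by blast
      moreover have "rel_interior F \<subseteq> S" "rel_interior G \<subseteq> S"
        using FSU US that rel_interior_subset by blast+
      ultimately show ?thesis using inj_on_image_Int [OF inj, of "rel_interior F" "rel_interior G"] by simp
    qed
    note dis = this
    show ?thesis unfolding disjoint_def
    proof (intro ballI impI)
      fix X Y assume "X \<in> FF" "Y \<in> FF" and ne: "X \<noteq> Y"
      then obtain F G where FG: "F \<in> FS" "G \<in> FS" and XY: "X = \<sigma> ` rel_interior F" "Y = \<sigma> ` rel_interior G"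
        unfolding FF_def by blast
      have "F \<noteq> G" using ne XY by blast
      then show "X \<inter> Y = {}" unfolding XY by (rule dis [OF FG])
    qed
  qed
  have unFF: "\<Union>FF = inside (path_image c') - \<Union>(path_image ` (e ` D))"
  proof -
    have "\<Union>(rel_interior ` FS) = U b - \<Gamma> - \<Union>D"
    proof (intro equalityI subsetI)
      fix x assume "x \<in> \<Union>(rel_interior ` FS)"
      then obtain F where F: "F \<in> FS" "x \<in> rel_interior F" by blast
      then have x: "x \<in> F" "x \<notin> \<Union>(p_edges P)" using ri [OF F(1)] by simp_all
      have "x \<in> U b" using x(1) FSU [OF F(1)] by blast
      moreover have "x \<notin> \<Gamma>" "x \<notin> \<Union>D" using x(2) C_edges unfolding \<Gamma>_def D_def by blast+
      ultimately show "x \<in> U b - \<Gamma> - \<Union>D" by blast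
    next
      fix x assume x: "x \<in> U b - \<Gamma> - \<Union>D"
      then obtain F where F: "F \<in> FS" "x \<in> F" by (auto simp: U_def FS_def)
      have "x \<notin> I" if I: "I \<in> p_edges P" for I
      proof
        assume xI: "x \<in> I"
        have x': "x \<notin> \<Gamma>" "x \<notin> \<Union>D" "x \<in> U b" using x by simp_all
        have "I \<notin> C"
        proof
          assume "I \<in> C"
          then have "x \<in> \<Gamma>" using xI unfolding \<Gamma>_def by (rule UnionI)
          then show False using x'(1) by simp
        qed
        then have "I \<in> p_edges P - C" using I by simp
        then obtain b' where b': "I \<subseteq> U b'" by (rule chord_class)
        show False
        proof (cases "b' = b")
          case True
          then have "I \<in> D" using b' I \<open>I \<notin> C\<close> by (simp add: D_def)
          then have "x \<in> \<Union>D" using xI by (rule UnionI)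
          then show ?thesis using x'(2) by simp
        next
          case False
          then have "b' = (\<not> b)" by simp
          then have "x \<in> U (\<not> b)" using subsetD [OF b' xI] by simp
          then have "x \<in> \<Gamma>" unfolding UU [symmetric] using x'(3) by simp
          then show ?thesis using x'(1) by simp
        qed
      qed
      then have "x \<in> rel_interior F" using F(2) unfolding ri [OF F(1)] by blast
      then show "x \<in> \<Union>(rel_interior ` FS)" using F by blast
    qed
    moreover have "\<Union>FF = \<sigma> ` \<Union>(rel_interior ` FS)" unfolding FF_def by blast
    moreover have "\<sigma> ` (U b - \<Gamma> - \<Union>D) = A - \<sigma> ` \<Union>D"
      unfolding A_def using DS US by (intro imdiff) auto
    moreover have "\<Union>(path_image ` (e ` D)) = \<sigma> ` \<Union>D" using pe(1) by (simp add: image_Union image_image)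
    ultimately show ?thesis unfolding ins by simp
  qed
  have cell: "cell c' (e ` D) FF"
    unfolding cell_def
  proof (intro conjI ballI impI)
    show "finite (e ` D)" using finite_edges by (simp add: D_def)
    show "chord_of c' x" if "x \<in> e ` D" for x using that chord by blast
    show "path_image x \<inter> path_image y = {}" if "x \<in> e ` D" "y \<in> e ` D" "x \<noteq> y" for x y
      using that disD by blast
  qed (use c' FFprop disFF unFF in \<open>auto simp: FF_def\<close>)
  have fcb: "frontier (cball (0::complex) 1) = sphere 0 1" "interior (cball (0::complex) 1) = ball 0 1"
    by (simp_all add: frontier_cball)
  have \<phi>': "cbij (path_image c') (frontier (cball (0::complex) 1)) (\<phi> \<circ> \<tau>)"
  proof -
    have "cbij (\<sigma> ` \<Gamma>) \<Gamma> \<tau>"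
    proof (rule cbijI)
      show "continuous_on (\<sigma> ` \<Gamma>) \<tau>" using continuous_on_subset [OF cont\<tau>] by blast
      have t: "\<tau> (\<sigma> x) = x" if "x \<in> \<Gamma>" for x using \<tau>\<sigma> \<Gamma>S that by blast
      show "inj_on \<tau> (\<sigma> ` \<Gamma>)" by (auto simp: inj_on_def t)
      show "\<tau> ` \<sigma> ` \<Gamma> = \<Gamma>" by (simp add: image_image t cong: image_cong_simp)
    qed
    then show ?thesis unfolding pc' fcb using \<phi> [folded \<Gamma>_def] by (rule cbij_compose)
  qed
  have \<tau>vw: "(\<phi> \<circ> \<tau>) (pathstart (e I)) = \<phi> (vv I)" "(\<phi> \<circ> \<tau>) (pathfinish (e I)) = \<phi> (ww I)" if "I \<in> D" for I
    using \<tau>\<sigma> vw\<Gamma> [OF that] \<Gamma>S pe [OF that] by auto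
  have "\<exists>f. cbij (path_image c' \<union> inside (path_image c')) (cball 0 1) f \<and>
    (\<forall>x\<in>path_image c'. f x = (\<phi> \<circ> \<tau>) x) \<and>
    (\<forall>x\<in>e ` D. f ` path_image x = closed_segment ((\<phi> \<circ> \<tau>) (pathstart x)) ((\<phi> \<circ> \<tau>) (pathfinish x)))"
  proof (rule straighten_chords [OF cell _ _ _ \<phi>'])
    show "open_segment ((\<phi> \<circ> \<tau>) (pathstart x)) ((\<phi> \<circ> \<tau>) (pathfinish x)) \<subseteq> interior (cball 0 1)"
      if x: "x \<in> e ` D" for x
    proof -
      obtain I where I: "I \<in> D" "x = e I" using x by blast
      have "\<phi> (vv I) \<in> sphere 0 1" "\<phi> (ww I) \<in> sphere 0 1"
        using vw\<Gamma> [OF I(1)] cbijD(3) [OF \<phi>] unfolding \<Gamma>_def by blast+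
      then show ?thesis unfolding I(2) \<tau>vw [OF I(1)] fcb
        by (intro open_segment_sphere_subset_ball) auto
    qed
  qed auto
  then obtain f where f: "cbij (path_image c' \<union> inside (path_image c')) (cball 0 1) f"
    "\<And>x. x \<in> path_image c' \<Longrightarrow> f x = (\<phi> \<circ> \<tau>) x"
    "\<And>x. x \<in> e ` D \<Longrightarrow> f ` path_image x = closed_segment ((\<phi> \<circ> \<tau>) (pathstart x)) ((\<phi> \<circ> \<tau>) (pathfinish x))"
    by blast
  have dom: "path_image c' \<union> inside (path_image c') = \<sigma> ` U b"
    unfolding pc' ins' A_def using \<Gamma>U by blast
  show thesis
  proof
    show "cbij (U b) (cball 0 1) (f \<circ> \<sigma>)"
      using cb\<sigma> [OF US] f(1) unfolding dom by (rule cbij_compose)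
    show "(f \<circ> \<sigma>) x = \<phi> x" if "x \<in> \<Union>C" for x
    proof -
      have "x \<in> \<Gamma>" using that by (simp add: \<Gamma>_def)
      then show ?thesis using f(2) [of "\<sigma> x"] \<tau>\<sigma> \<Gamma>S unfolding pc' by auto
    qed
    show "(f \<circ> \<sigma>) ` closed_segment v w = closed_segment (\<phi> v) (\<phi> w)"
      if "closed_segment v w \<in> p_edges P - C" "closed_segment v w \<subseteq> U b" for v w
    proof -
      define I where "I = closed_segment v w"
      have I: "I \<in> D" using that by (simp add: D_def I_def)
      \<comment> \<open>A segment determines its ends only up to order, so the chosen ends may be
        exchanged against the given ones.\<close>
      have "closed_segment (vv I) (ww I) = closed_segment v w" using vwseg [OF I] by (simp add: I_def)
      then have "{vv I, ww I} = {v, w}" by (simp add: closed_segment_eq)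
      then have "closed_segment (\<phi> (vv I)) (\<phi> (ww I)) = closed_segment (\<phi> v) (\<phi> w)"
        by (auto simp: closed_segment_eq doubleton_eq_iff)
      moreover have "(f \<circ> \<sigma>) ` I = closed_segment (\<phi> (vv I)) (\<phi> (ww I))"
        using f(3) [of "e I"] I pe(1) [OF I] \<tau>vw [OF I] by (simp only: image_comp [symmetric]) auto
      ultimately show ?thesis by (simp add: I_def)
    qed
  qed
qed

end

section \<open>A quarter of the 3-sphere\<close>

text \<open>The disc is lifted to the graph of a hemisphere. The sign \<open>e\<close> selects the
  upper or the lower one; over the unit circle both lifts have height 0, which allows
  gluing.\<close>

lemma hemisphere_cbij:
  assumes f: "cbij S (cball (0::complex) 1) f" and e: "e = 1 \<or> e = -1"
  shows "cbij S {p :: complex \<times> real. norm p = 1 \<and> 0 \<le> e * snd p} (\<lambda>x. (f x, e * sqrt (1 - (norm (f x))\<^sup>2)))"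
proof (rule cbijI)
  have n: "norm (f x) \<le> 1" if "x \<in> S" for x using cbijD(3) [OF f] that by auto
  then have n2: "(norm (f x))\<^sup>2 \<le> 1" if "x \<in> S" for x using that by (simp add: power_le_one)
  show "continuous_on S (\<lambda>x. (f x, e * sqrt (1 - (norm (f x))\<^sup>2)))"
    using cbijD(1) [OF f] by (intro continuous_intros)
  show "inj_on (\<lambda>x. (f x, e * sqrt (1 - (norm (f x))\<^sup>2))) S"
    using cbijD(2) [OF f] by (auto simp: inj_on_def)
  show "(\<lambda>x. (f x, e * sqrt (1 - (norm (f x))\<^sup>2))) ` S = {p. norm p = 1 \<and> 0 \<le> e * snd p}"
  proof (intro equalityI subsetI)
    fix p assume "p \<in> (\<lambda>x. (f x, e * sqrt (1 - (norm (f x))\<^sup>2))) ` S"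
    then show "p \<in> {p. norm p = 1 \<and> 0 \<le> e * snd p}"
      using n2 e by (auto simp: norm_Pair)
  next
    fix p :: "complex \<times> real" assume "p \<in> {p. norm p = 1 \<and> 0 \<le> e * snd p}"
    then have p: "norm p = 1" "0 \<le> e * snd p" by auto
    obtain z y where zy: "p = (z, y)" by (cases p)
    have 1: "(norm z)\<^sup>2 + y\<^sup>2 = 1" using p(1) by (simp add: zy norm_Pair)
    then have "(norm z)\<^sup>2 \<le> 1" by (metis add_increasing2 order_refl zero_le_power2 add_le_cancel_left add.right_neutral)
    then have "norm z \<le> 1" by (simp add: power2_le_imp_le abs_square_le_1)
    then obtain x where x: "x \<in> S" "z = f x" using cbijD(3) [OF f] by (metis imageE mem_cball_0)
    have "y\<^sup>2 = 1 - (norm z)\<^sup>2" using 1 by simp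
    then have "\<bar>y\<bar> = sqrt (1 - (norm z)\<^sup>2)" by (metis real_sqrt_abs)
    then have "y = e * sqrt (1 - (norm z)\<^sup>2)" using p(2) e zy by auto
    then show "p \<in> (\<lambda>x. (f x, e * sqrt (1 - (norm (f x))\<^sup>2))) ` S"
      using x zy by auto
  qed
qed

text \<open>The quarter \<open>{(z, s, t). s, t \<ge> 0}\<close> of the 3-sphere is a ball: at height \<open>y\<close> above
  \<open>z\<close> with \<open>\<rho>\<^sup>2 = 1 - |z|\<^sup>2\<close>, the squares of \<open>s\<close> and \<open>t\<close> split \<open>\<rho>\<^sup>2\<close> in the ratio \<open>\<rho> - y : \<rho> + y\<close>.\<close>

definition rad :: "complex \<times> real \<Rightarrow> real" where
  "rad p = sqrt (1 - (norm (fst p))\<^sup>2)"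

definition qs :: "complex \<times> real \<Rightarrow> real" where
  "qs p = sqrt (rad p * (rad p - snd p) / 2)"

definition qt :: "complex \<times> real \<Rightarrow> real" where
  "qt p = sqrt (rad p * (rad p + snd p) / 2)"

lemma rad_props:
  assumes "p \<in> cball 0 1"
  shows "0 \<le> rad p" "(rad p)\<^sup>2 = 1 - (norm (fst p))\<^sup>2" "\<bar>snd p\<bar> \<le> rad p" "norm p = 1 \<longleftrightarrow> \<bar>snd p\<bar> = rad p"
proof -
  obtain z y where p: "p = (z, y)" by (cases p)
  have n: "(norm z)\<^sup>2 + y\<^sup>2 \<le> 1" using assms by (simp add: p norm_Pair)
  then have z: "(norm z)\<^sup>2 \<le> 1" using zero_le_power2 [of y] by linarith
  then show 1: "0 \<le> rad p" and 2: "(rad p)\<^sup>2 = 1 - (norm (fst p))\<^sup>2" by (simp_all add: rad_def p)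
  have "y\<^sup>2 \<le> (rad p)\<^sup>2" using n 2 by (simp add: p)
  then show 3: "\<bar>snd p\<bar> \<le> rad p" using 1 by (simp add: p abs_le_square_iff [symmetric])
  have "norm p = 1 \<longleftrightarrow> (norm z)\<^sup>2 + y\<^sup>2 = 1" by (simp add: p norm_Pair)
  also have "\<dots> \<longleftrightarrow> \<bar>y\<bar>\<^sup>2 = (rad p)\<^sup>2" using 2 by (auto simp: p)
  also have "\<dots> \<longleftrightarrow> \<bar>y\<bar> = rad p" using 1 by (metis abs_ge_zero power2_eq_iff_nonneg)
  finally show "norm p = 1 \<longleftrightarrow> \<bar>snd p\<bar> = rad p" by (simp add: p)
qed

lemma quarter_sphere:
  assumes p: "p \<in> cball 0 1"
  shows "0 \<le> qs p" "0 \<le> qt p" "(qs p)\<^sup>2 = rad p * (rad p - snd p) / 2" "(qt p)\<^sup>2 = rad p * (rad p + snd p) / 2"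
    "(norm (fst p))\<^sup>2 + (qs p)\<^sup>2 + (qt p)\<^sup>2 = 1"
    "qs p = 0 \<longleftrightarrow> norm p = 1 \<and> 0 \<le> snd p" "qt p = 0 \<longleftrightarrow> norm p = 1 \<and> 0 \<le> - snd p"
proof -
  note r = rad_props [OF p]
  have n: "0 \<le> rad p * (rad p - snd p) / 2" "0 \<le> rad p * (rad p + snd p) / 2" using r(1,3) by auto
  then show "0 \<le> qs p" "0 \<le> qt p" by (simp_all add: qs_def qt_def)
  show sq: "(qs p)\<^sup>2 = rad p * (rad p - snd p) / 2" "(qt p)\<^sup>2 = rad p * (rad p + snd p) / 2"
    using n by (simp_all add: qs_def qt_def)
  then show "(norm (fst p))\<^sup>2 + (qs p)\<^sup>2 + (qt p)\<^sup>2 = 1"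
    using r(2) by (simp add: power2_eq_square field_simps)
  show "qs p = 0 \<longleftrightarrow> norm p = 1 \<and> 0 \<le> snd p" "qt p = 0 \<longleftrightarrow> norm p = 1 \<and> 0 \<le> - snd p"
    using r(1,3,4) by (auto simp: qs_def qt_def)
qed

text \<open>The height is recovered from the difference of squares, which is
  \<open>rad p * snd p\<close>. Where the radius vanishes, the height is bounded by 0
  anyway.\<close>

lemma quarter_sphere_inj:
  assumes p: "p \<in> cball 0 1" and p': "p' \<in> cball 0 1"
    and eq: "fst p = fst p'" "qs p = qs p'" "qt p = qt p'"
  shows "p = p'"
proof -
  have r: "rad p = rad p'" by (simp add: rad_def eq)
  have "rad p * snd p = (qt p)\<^sup>2 - (qs p)\<^sup>2" "rad p' * snd p' = (qt p')\<^sup>2 - (qs p')\<^sup>2"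
    using quarter_sphere(3,4) [OF p] quarter_sphere(3,4) [OF p'] by (simp_all add: field_simps)
  then have "rad p * snd p = rad p * snd p'" using eq r by simp
  moreover have "snd p = 0 \<and> snd p' = 0" if "rad p = 0"
    using rad_props(3) [OF p] rad_props(3) [OF p'] that r by simp
  ultimately have "snd p = snd p'" by (cases "rad p = 0") auto
  then show ?thesis using eq(1) by (simp add: prod_eq_iff)
qed

lemma quarter_sphere_surj:
  fixes z :: complex and s t :: real
  assumes 1: "(norm z)\<^sup>2 + s\<^sup>2 + t\<^sup>2 = 1" and st: "0 \<le> s" "0 \<le> t"
  obtains p where "p \<in> cball 0 1" "fst p = z" "qs p = s" "qt p = t"
proof -
  define \<rho> where "\<rho> = sqrt (s\<^sup>2 + t\<^sup>2)"
  \<comment> \<open>The solution of \<open>\<rho> * y = t\<^sup>2 - s\<^sup>2\<close>. For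
    \<open>\<rho> = 0\<close> both \<open>s\<close> and \<open>t\<close> vanish, and division by
    zero returns the required height 0.\<close>
  define y where "y = (t\<^sup>2 - s\<^sup>2) / \<rho>"
  have \<rho>: "0 \<le> \<rho>" "\<rho>\<^sup>2 = s\<^sup>2 + t\<^sup>2" by (simp_all add: \<rho>_def)
  have \<rho>y: "\<rho> * y = t\<^sup>2 - s\<^sup>2"
  proof (cases "\<rho> = 0")
    case True
    then have "s = 0" "t = 0" using \<rho>(2) by (simp_all add: sum_power2_eq_zero_iff)
    then show ?thesis by (simp add: True)
  qed (simp add: y_def)
  have y: "\<bar>y\<bar> \<le> \<rho>"
  proof (cases "\<rho> = 0")
    case False
    have "\<bar>t\<^sup>2 - s\<^sup>2\<bar> \<le> s\<^sup>2 + t\<^sup>2" by (auto simp: abs_le_iff)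
    then have "\<rho> * \<bar>y\<bar> \<le> \<rho> * \<rho>" using \<rho> \<rho>y by (metis abs_mult abs_of_nonneg power2_eq_square)
    then show ?thesis using False \<rho>(1) by simp
  qed (simp add: y_def)
  have "\<rho>\<^sup>2 = 1 - (norm z)\<^sup>2" using 1 \<rho>(2) by simp
  then have rad: "rad (z, y) = \<rho>" using \<rho>(1) by (metis fst_conv rad_def real_sqrt_abs abs_of_nonneg)
  have "y\<^sup>2 \<le> \<rho>\<^sup>2" using y by (metis abs_le_square_iff abs_of_nonneg \<rho>(1))
  then have "(norm z)\<^sup>2 + y\<^sup>2 \<le> 1" using 1 \<rho>(2) by simp
  then have "(z, y) \<in> cball 0 1" by (simp add: norm_Pair)
  moreover have "\<rho> * (\<rho> - y) / 2 = s\<^sup>2" "\<rho> * (\<rho> + y) / 2 = t\<^sup>2"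
    using \<rho>(2) \<rho>y by (simp_all add: power2_eq_square algebra_simps)
  then have "qs (z, y) = s" "qt (z, y) = t" unfolding qs_def qt_def rad using st by simp_all
  ultimately show thesis using that by simp
qed

context coloured
begin

text \<open>The region \<open>U True\<close> is lifted to the upper hemisphere and
  \<open>U False\<close> to the lower one, with \<open>C\<close> on the equator. This identifies the
  boundary of \<open>P\<close> with the 2-sphere, and coning fills in the ball. Lifting is vertical,
  so chords stay straight in the complex coordinate \<open>X\<close>.\<close>

lemma quarter_coordinates:
  assumes c: "simple_path c" "pathfinish c = pathstart c" "path_image c = \<Union>C"
    and \<phi>: "cbij (\<Union>C) (sphere (0::complex) 1) \<phi>"
  obtains X :: "real^3 \<Rightarrow> complex" and s t :: "real^3 \<Rightarrow> real"
  where "continuous_on P X" "continuous_on P s" "continuous_on P t"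
    "\<And>p. p \<in> P \<Longrightarrow> 0 \<le> s p \<and> 0 \<le> t p \<and> (norm (X p))\<^sup>2 + (s p)\<^sup>2 + (t p)\<^sup>2 = 1"
    "\<And>p p'. p \<in> P \<Longrightarrow> p' \<in> P \<Longrightarrow> X p = X p' \<Longrightarrow> s p = s p' \<Longrightarrow> t p = t p' \<Longrightarrow> p = p'"
    "\<And>z a b. 0 \<le> a \<Longrightarrow> 0 \<le> b \<Longrightarrow> (norm z)\<^sup>2 + a\<^sup>2 + b\<^sup>2 = 1 \<Longrightarrow> \<exists>p\<in>P. X p = z \<and> s p = a \<and> t p = b"
    "\<And>p. p \<in> P \<Longrightarrow> s p = 0 \<longleftrightarrow> p \<in> U True" "\<And>p. p \<in> P \<Longrightarrow> t p = 0 \<longleftrightarrow> p \<in> U False"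
    "\<And>v w. closed_segment v w \<in> p_edges P - C \<Longrightarrow> X ` closed_segment v w = closed_segment (\<phi> v) (\<phi> w)"
proof -
  obtain f1 where f1: "cbij (U True) (cball (0::complex) 1) f1" "\<And>x. x \<in> \<Union>C \<Longrightarrow> f1 x = \<phi> x"
    "\<And>v w. closed_segment v w \<in> p_edges P - C \<Longrightarrow> closed_segment v w \<subseteq> U True \<Longrightarrow>
       f1 ` closed_segment v w = closed_segment (\<phi> v) (\<phi> w)"
    using straighten_region [OF c \<phi>, of True] by metis
  obtain f2 where f2: "cbij (U False) (cball (0::complex) 1) f2" "\<And>x. x \<in> \<Union>C \<Longrightarrow> f2 x = \<phi> x"
    "\<And>v w. closed_segment v w \<in> p_edges P - C \<Longrightarrow> closed_segment v w \<subseteq> U False \<Longrightarrow>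
       f2 ` closed_segment v w = closed_segment (\<phi> v) (\<phi> w)"
    using straighten_region [OF c \<phi>, of False] by metis
  define g1 where "g1 = (\<lambda>x. (f1 x, 1 * sqrt (1 - (norm (f1 x))\<^sup>2)))"
  define g2 where "g2 = (\<lambda>x. (f2 x, -1 * sqrt (1 - (norm (f2 x))\<^sup>2)))"
  define T1 where "T1 = {p :: complex \<times> real. norm p = 1 \<and> 0 \<le> 1 * snd p}"
  define T2 where "T2 = {p :: complex \<times> real. norm p = 1 \<and> 0 \<le> -1 * snd p}"
  have g1: "cbij (U True) T1 g1" unfolding g1_def T1_def by (rule hemisphere_cbij [OF f1(1)]) simp
  have g2: "cbij (U False) T2 g2" unfolding g2_def T2_def by (rule hemisphere_cbij [OF f2(1)]) simp
  have inter: "U True \<inter> U False = \<Union>C" using U_Int [of True] by simp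
  have \<phi>1: "norm (\<phi> x) = 1" if "x \<in> \<Union>C" for x using cbijD(3) [OF \<phi>] that by (metis imageI mem_sphere_0)
  have gC: "g1 x = (\<phi> x, 0)" "g2 x = (\<phi> x, 0)" if "x \<in> \<Union>C" for x
    using f1(2) [OF that] f2(2) [OF that] \<phi>1 [OF that] by (simp_all add: g1_def g2_def)
  define g where "g = (\<lambda>x. if x \<in> U True then g1 x else g2 x)"
  have "cbij (U True \<union> U False) (T1 \<union> T2) g" unfolding g_def
  proof (rule cbij_Un [OF g1 g2 U_closed(1) U_closed(1)])
    show "g1 x = g2 x" if "x \<in> U True" "x \<in> U False" for x
    proof -
      have "x \<in> \<Union>C" using that inter by blast
      then show ?thesis using gC by simp
    qed
    show "T1 \<inter> T2 \<subseteq> g1 ` (U True \<inter> U False)"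
    proof
      fix p assume p: "p \<in> T1 \<inter> T2"
      then have "snd p = 0" "norm p = 1" by (auto simp: T1_def T2_def)
      then have "norm (fst p) = 1" by (cases p) (simp add: norm_Pair)
      then have "fst p \<in> \<phi> ` \<Union>C" using cbijD(3) [OF \<phi>] by (metis mem_sphere_0)
      then obtain x where x: "x \<in> \<Union>C" "fst p = \<phi> x" by blast
      then have "p = g1 x" using gC \<open>snd p = 0\<close> by (simp add: prod_eq_iff)
      then show "p \<in> g1 ` (U True \<inter> U False)" unfolding inter using x(1) by blast
    qed
  qed
  moreover have "T1 \<union> T2 = sphere 0 1" by (auto simp: T1_def T2_def)
  moreover have "U True \<union> U False = frontier P" using U_Un [of True] by simp
  ultimately have g: "cbij (frontier P) (sphere (0::complex \<times> real) 1) g" by simp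
  have "aff_dim P = aff_dim (cball (0::complex \<times> real) 1)" by (simp add: dimP aff_dim_cball)
  then obtain k where k: "cbij P (cball (0::complex \<times> real) 1) k"
    "k ` rel_frontier P = rel_frontier (cball (0::complex \<times> real) 1)"
    using convex_body_cbij [OF poly(3,4) convex_cball compact_cball] by blast
  have k2: "k ` frontier P = sphere 0 1" using k(2) full(4) by (simp add: rel_frontier_nonempty_interior)
  have fP: "frontier P \<subseteq> P" using poly(5) by (simp add: frontier_subset_eq)
  have id: "cbij (cball (0::complex \<times> real) 1) (cball 0 1) id" "id ` sphere (0::complex \<times> real) 1 = sphere 0 1"
    by (auto simp: cbij_def)
  obtain h where h: "cbij P (cball (0::complex \<times> real) 1) h" "\<And>x. x \<in> frontier P \<Longrightarrow> h x = g x"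
    using alexander_extension [OF k(1) k2 fP poly(4) id sphere_cball compact_cball g] by blast
  have hP: "h p \<in> cball 0 1" if "p \<in> P" for p using cbijD(3) [OF h(1)] that by blast
  have Ufr: "U b \<subseteq> frontier P" for b using U_Un [of b] by blast
  have hU1: "h p = g1 p" if "p \<in> U True" for p using h(2) [of p] that Ufr by (auto simp: g_def)
  have hU2: "h p = g2 p" if "p \<in> U False" for p
  proof (cases "p \<in> U True")
    case True
    then have "p \<in> \<Union>C" using that inter by blast
    then show ?thesis using hU1 [OF True] gC by simp
  next
    case False
    then show ?thesis using h(2) [of p] that Ufr by (auto simp: g_def)
  qed
  have inj: "p = p'" if "p \<in> P" "p' \<in> P" "h p = h p'" for p p'
    using cbijD(2) [OF h(1)] that by (auto dest: inj_onD)
  have hT1: "h p \<in> T1 \<longleftrightarrow> p \<in> U True" if p: "p \<in> P" for p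
  proof
    assume "h p \<in> T1"
    then obtain x where x: "x \<in> U True" "h p = g1 x" using cbijD(3) [OF g1] by blast
    then have "h p = h x" using hU1 by simp
    then have "p = x" using inj [OF p] x(1) Ufr fP by blast
    then show "p \<in> U True" using x by simp
  next
    assume "p \<in> U True" then show "h p \<in> T1" using hU1 cbijD(3) [OF g1] by auto
  qed
  have hT2: "h p \<in> T2 \<longleftrightarrow> p \<in> U False" if p: "p \<in> P" for p
  proof
    assume "h p \<in> T2"
    then obtain x where x: "x \<in> U False" "h p = g2 x" using cbijD(3) [OF g2] by blast
    then have "h p = h x" using hU2 by simp
    then have "p = x" using inj [OF p] x(1) Ufr fP by blast
    then show "p \<in> U False" using x by simp
  next
    assume "p \<in> U False" then show "h p \<in> T2" using hU2 cbijD(3) [OF g2] by auto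
  qed
  have conth: "continuous_on P h" by (rule cbijD(1) [OF h(1)])
  show thesis
  proof (rule that [of "\<lambda>p. fst (h p)" "\<lambda>p. qs (h p)" "\<lambda>p. qt (h p)"])
    show "continuous_on P (\<lambda>p. fst (h p))" "continuous_on P (\<lambda>p. qs (h p))" "continuous_on P (\<lambda>p. qt (h p))"
      unfolding qs_def qt_def rad_def using conth by (intro continuous_intros; simp)+
    show "0 \<le> qs (h p) \<and> 0 \<le> qt (h p) \<and> (norm (fst (h p)))\<^sup>2 + (qs (h p))\<^sup>2 + (qt (h p))\<^sup>2 = 1" if "p \<in> P" for p
      using quarter_sphere(1,2,5) [OF hP [OF that]] by blast
    show "p = p'" if "p \<in> P" "p' \<in> P" "fst (h p) = fst (h p')" "qs (h p) = qs (h p')" "qt (h p) = qt (h p')" for p p'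
      using inj [OF that(1,2)] quarter_sphere_inj [OF hP [OF that(1)] hP [OF that(2)] that(3-5)] by blast
    show "\<exists>p\<in>P. fst (h p) = z \<and> qs (h p) = a \<and> qt (h p) = b" if abz: "0 \<le> a" "0 \<le> b" "(norm z)\<^sup>2 + a\<^sup>2 + b\<^sup>2 = 1" for z a b
    proof -
      obtain y where y: "y \<in> cball 0 1" "fst y = z" "qs y = a" "qt y = b"
        by (rule quarter_sphere_surj [OF abz(3,1,2)])
      have "y \<in> h ` P" unfolding cbijD(3) [OF h(1)] by (rule y(1))
      then obtain p where p: "y = h p" "p \<in> P" by (rule imageE)
      show ?thesis using y(2-4) p(2) unfolding p(1) by (intro bexI [of _ p] conjI)
    qed
    show "qs (h p) = 0 \<longleftrightarrow> p \<in> U True" if "p \<in> P" for p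
      using quarter_sphere(6) [OF hP [OF that]] hT1 [OF that] by (simp add: T1_def)
    show "qt (h p) = 0 \<longleftrightarrow> p \<in> U False" if "p \<in> P" for p
      using quarter_sphere(7) [OF hP [OF that]] hT2 [OF that] by (simp add: T2_def)
    show "(\<lambda>p. fst (h p)) ` closed_segment v w = closed_segment (\<phi> v) (\<phi> w)"
      if vw: "closed_segment v w \<in> p_edges P - C" for v w
    proof -
      obtain b where b: "closed_segment v w \<subseteq> U b" using vw by (rule chord_class)
      show ?thesis
      proof (cases b)
        case True
        then have "(\<lambda>p. fst (h p)) ` closed_segment v w = f1 ` closed_segment v w"
          using b hU1 by (intro image_cong) (auto simp: g1_def)
        then show ?thesis using f1(3) [OF vw] b True by simp
      next
        case False
        then have "(\<lambda>p. fst (h p)) ` closed_segment v w = f2 ` closed_segment v w"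
          using b hU2 by (intro image_cong) (auto simp: g2_def)
        then show ?thesis using f2(3) [OF vw] b False by simp
      qed
    qed
  qed
qed

end

section \<open>The quotient by the involution\<close>

declare add_bit_eq_xor [simp del] mult_bit_eq_and [simp del]

section \<open>Linear algebra over the field with two elements\<close>

instance bit :: finite
proof
  have "(UNIV :: bit set) \<subseteq> {0, 1}" using bit.exhaust by blast
  then show "finite (UNIV :: bit set)" by (rule finite_subset) simp
qed

lemma CARD_bit: "CARD(bit) = 2"
proof -
  have "(UNIV :: bit set) = {0, 1}" using bit.exhaust by blast
  then have "CARD(bit) = card {0, 1 :: bit}" by (rule arg_cong)
  also have "\<dots> = 2" by simp
  finally show ?thesis .
qed

lemma bit_add_self: "x + x = (0 :: bit)"
  by (cases x) (simp_all add: add_bit_eq_xor)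

lemma bit_add_eq_0_iff: "x + y = 0 \<longleftrightarrow> x = (y :: bit)"
  by (cases x; cases y) (simp_all add: bit_add_self)

lemma bit_vec_self [simp]: "u + u = (0 :: bit^'n)"
  by (simp add: vec_eq_iff bit_add_self)

lemma bit_vec_diff: "u - v = u + (v :: bit^'n)"
  by (simp add: vec_eq_iff)

lemma bit_vec_add_cancel [simp]: "u + (u + v) = (v :: bit^'n)"
  by (simp add: add.assoc [symmetric])

lemma bit_vec_eq_iff_add: "u + v = 0 \<longleftrightarrow> u = (v :: bit^'n)"
  by (simp add: vec_eq_iff bit_add_eq_0_iff)

definition additive_bit :: "(bit^3 \<Rightarrow> bit) \<Rightarrow> bool" where
  "additive_bit k \<longleftrightarrow> (\<forall>u v. k (u + v) = k u + k v)"

lemma additive_bit_add: "additive_bit k \<Longrightarrow> k (u + v) = k u + k v"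
  by (simp add: additive_bit_def)

lemma additive_bit_0: "additive_bit k \<Longrightarrow> k 0 = 0"
  using additive_bit_add [of k 0 0] by (simp add: bit_add_self)

text \<open>The maps \<open>k1\<close> and \<open>k2\<close> are coordinates on the quotient modulo \<open>g\<close> in which every element of
  \<open>L\<close> is one of the two basis vectors.\<close>

definition splitting :: "(bit^3 \<Rightarrow> bit) \<Rightarrow> (bit^3 \<Rightarrow> bit) \<Rightarrow> (bit^3) set \<Rightarrow> bit^3 \<Rightarrow> bool" where
  "splitting k1 k2 L g \<longleftrightarrow> additive_bit k1 \<and> additive_bit k2 \<and>
     (\<forall>u. k1 u = 0 \<and> k2 u = 0 \<longleftrightarrow> u = 0 \<or> u = g) \<and>
     (\<forall>l\<in>L. k1 l = 1 \<longleftrightarrow> k2 l = 0)"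

text \<open>The seven nonzero combinations do not vanish, so the map is injective, and it is
  surjective by counting: both sides have eight elements.\<close>

lemma coordinates:
  fixes a b c :: "bit^3"
  assumes ne: "a \<noteq> 0" "b \<noteq> 0" "c \<noteq> 0" "a + b \<noteq> 0" "a + c \<noteq> 0" "b + c \<noteq> 0" "a + b + c \<noteq> 0"
  shows "bij (\<lambda>(x, y, z). x *s a + y *s b + z *s c :: bit^3)"
proof -
  let ?m = "\<lambda>(x, y, z). x *s a + y *s b + z *s c :: bit^3"
  have z: "x = 0 \<and> y = 0 \<and> z = 0" if "x *s a + y *s b + z *s c = 0" for x y z
    using that ne by (cases x; cases y; cases z) simp_all
  have "inj ?m"
  proof (rule injI)
    fix p p' assume eq: "?m p = ?m p'"
    obtain x y w where p: "p = (x, y, w)" by (metis prod_cases3)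
    obtain x' y' w' where p': "p' = (x', y', w')" by (metis prod_cases3)
    have "?m p + ?m p' = 0" using eq by simp
    then have "(x + x') *s a + (y + y') *s b + (w + w') *s c = 0"
      by (simp add: p p' vector_sadd_rdistrib ac_simps)
    then have "x + x' = 0 \<and> y + y' = 0 \<and> w + w' = 0" by (rule z)
    then show "p = p'" by (simp add: p p' bit_add_eq_0_iff)
  qed
  moreover have "card (range ?m) = CARD(bit^3)"
    using card_image [OF \<open>inj ?m\<close>] by (simp add: CARD_bit)
  then have "range ?m = UNIV" by (intro card_subset_eq) simp_all
  ultimately show ?thesis by (simp add: bij_def)
qed

lemma splitting_sum:
  fixes a b c :: "bit^3"
  assumes ne: "a \<noteq> 0" "b \<noteq> 0" "c \<noteq> 0" "a + b \<noteq> 0" "a + c \<noteq> 0" "b + c \<noteq> 0" "a + b + c \<noteq> 0"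
  shows "\<exists>k1 k2. splitting k1 k2 {a, b, c, a + b + c} (a + b)"
proof -
  let ?m = "\<lambda>(x, y, z). x *s a + y *s b + z *s c :: bit^3"
  have bij: "bij ?m" by (rule coordinates [OF ne])
  \<comment> \<open>The first coordinate has to be 1 on \<open>a\<close> and \<open>b\<close> and to
    vanish on their sum, which suggests \<open>x + y\<close>; the second one reads off the
    coefficient of \<open>c\<close>.\<close>
  define k1 where "k1 = (\<lambda>u. case inv_into UNIV ?m u of (x, y, z) \<Rightarrow> x + y)"
  define k2 where "k2 = (\<lambda>u. case inv_into UNIV ?m u of (x, y, z) \<Rightarrow> z)"
  have inv: "inv_into UNIV ?m (x *s a + y *s b + z *s c) = (x, y, z)" for x y z
    using inv_f_f [OF bij_is_inj [OF bij], of "(x, y, z)"] by simp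
  have k: "k1 (x *s a + y *s b + z *s c) = x + y" "k2 (x *s a + y *s b + z *s c) = z" for x y z
    by (simp_all add: k1_def k2_def inv)
  have ex: "\<exists>x y z. u = x *s a + y *s b + z *s c" for u
  proof -
    obtain p where p: "u = ?m p" using surjD [OF bij_is_surj [OF bij], of u] by blast
    show ?thesis unfolding p by (cases p) auto
  qed
  have "k1 (u + v) = k1 u + k1 v \<and> k2 (u + v) = k2 u + k2 v" for u v
  proof -
    obtain x y z x' y' z' where u: "u = x *s a + y *s b + z *s c" and v: "v = x' *s a + y' *s b + z' *s c"
      using ex by metis
    have "u + v = (x + x') *s a + (y + y') *s b + (z + z') *s c"
      by (simp add: u v vector_sadd_rdistrib ac_simps)
    then have "k1 (u + v) = (x + x') + (y + y')" "k2 (u + v) = z + z'" by (simp_all only: k)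
    then show ?thesis unfolding u v k by (simp add: ac_simps)
  qed
  moreover have "k1 u = 0 \<and> k2 u = 0 \<longleftrightarrow> u = 0 \<or> u = a + b" for u
  proof -
    obtain x y z where u: "u = x *s a + y *s b + z *s c" using ex by metis
    have "u = 0 \<longleftrightarrow> (x, y, z) = (0, 0, 0)" "u = a + b \<longleftrightarrow> (x, y, z) = (1, 1, 0)"
      using inv [of 0 0 0] inv [of 1 1 0] inv [of x y z] unfolding u by auto
    then show ?thesis unfolding u k by (cases x; cases y) (simp_all add: bit_add_eq_0_iff)
  qed
  moreover have "k1 l = 1 \<longleftrightarrow> k2 l = 0" if "l \<in> {a, b, c, a + b + c}" for l
  proof -
    have "k1 a = 1" "k1 b = 1" "k1 c = 0" "k1 (a + b + c) = 0" "k2 a = 0" "k2 b = 0" "k2 c = 1" "k2 (a + b + c) = 1"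
      using k [of 1 0 0] k [of 0 1 0] k [of 0 0 1] k [of 1 1 1] by (simp_all add: bit_add_self)
    then show ?thesis using that by auto
  qed
  ultimately have "splitting k1 k2 {a, b, c, a + b + c} (a + b)"
    unfolding splitting_def additive_bit_def by (intro conjI allI ballI) simp_all
  then show ?thesis by blast
qed

lemma card_3_distinct: "card {a, b, c} = 3 \<Longrightarrow> a \<noteq> b \<and> a \<noteq> c \<and> b \<noteq> c"
  by (simp add: card_insert_if split: if_split_asm)

lemma splitting_exists:
  fixes a b c g :: "bit^3"
  assumes "card {a, b, c} = 3" "z2_indep id {a, b, c}" "g \<noteq> 0" "g \<notin> {a, b, c, a + b + c}"
  obtains k1 k2 where "splitting k1 k2 {a, b, c, a + b + c} g"
proof -
  have d: "a \<noteq> b" "a \<noteq> c" "b \<noteq> c" using assms(1) card_3_distinct by metis+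
  have ind: "T \<subseteq> {a, b, c} \<Longrightarrow> T \<noteq> {} \<Longrightarrow> \<Sum>T \<noteq> 0" for T
    using assms(2) by (simp add: z2_indep_def)
  have ne: "a \<noteq> 0" "b \<noteq> 0" "c \<noteq> 0" "a + b \<noteq> 0" "a + c \<noteq> 0" "b + c \<noteq> 0" "a + b + c \<noteq> 0"
    using ind [of "{a}"] ind [of "{b}"] ind [of "{c}"] ind [of "{a, b}"] ind [of "{a, c}"] ind [of "{b, c}"]
      ind [of "{a, b, c}"] d by (simp_all add: add.assoc)
  obtain p where "g = (\<lambda>(x, y, z). x *s a + y *s b + z *s c) p"
    using surjD [OF bij_is_surj [OF coordinates [OF ne]], of g] by blast
  then obtain x y z where g: "g = x *s a + y *s b + z *s c" by (cases p) simp
  \<comment> \<open>Of the seven nonzero vectors three are basis vectors and one is their total sum;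
    the three that remain are the sums of two basis vectors.\<close>
  have "g = a + b \<or> g = a + c \<or> g = b + c"
    using assms(3,4) unfolding g by (cases x; cases y; cases z) simp_all
  then show thesis
  proof (elim disjE)
    assume g': "g = a + b"
    show thesis using splitting_sum [OF ne] that unfolding g' by blast
  next
    assume g': "g = a + c"
    have set: "{a, c, b, a + c + b} = {a, b, c, a + b + c}" by (simp add: insert_commute ac_simps)
    have "\<exists>k1 k2. splitting k1 k2 {a, c, b, a + c + b} (a + c)"
      by (rule splitting_sum) (use ne in \<open>simp_all add: ac_simps\<close>)
    then show thesis using that unfolding set g' by blast
  next
    assume g': "g = b + c"
    have set: "{b, c, a, b + c + a} = {a, b, c, a + b + c}" by (simp add: insert_commute ac_simps)
    have "\<exists>k1 k2. splitting k1 k2 {b, c, a, b + c + a} (b + c)"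
      by (rule splitting_sum) (use ne in \<open>simp_all add: ac_simps\<close>)
    then show thesis using that unfolding set g' by blast
  qed
qed

lemma continuous_map_prod_discrete:
  assumes "\<And>u. continuous_map X Z (\<lambda>p. f (p, u))"
  shows "continuous_map (prod_topology X (discrete_topology UNIV)) Z f"
  unfolding continuous_map_def
proof (intro conjI allI impI)
  show "f \<in> topspace (prod_topology X (discrete_topology UNIV)) \<rightarrow> topspace Z"
    using assms by (auto simp: continuous_map_def Pi_iff)
  fix W assume W: "openin Z W"
  have "{x \<in> topspace (prod_topology X (discrete_topology UNIV)). f x \<in> W}
      = (\<Union>u. {p \<in> topspace X. f (p, u) \<in> W} \<times> {u})"
    by auto
  moreover have "openin (prod_topology X (discrete_topology UNIV)) ({p \<in> topspace X. f (p, u) \<in> W} \<times> {u})" for u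
    using assms [of u] W by (auto simp: openin_prod_Times_iff continuous_map_def)
  ultimately show "openin (prod_topology X (discrete_topology UNIV))
      {x \<in> topspace (prod_topology X (discrete_topology UNIV)). f x \<in> W}"
    by auto
qed

section \<open>The quotient map from the copies of the polytope and its fibres\<close>

locale branched = simple3 P for P +
  fixes lam :: "(real^3) set \<Rightarrow> bit^3" and Xt :: "'x topology" and q :: "(real^3) \<times> (bit^3) \<Rightarrow> 'x"
    and Yt :: "'y topology" and r :: "'x \<Rightarrow> 'y" and g :: "bit^3"
  assumes char: "char_fun P lam" and quot: "small_cover_quot P lam Xt q"
    and rquot: "quotient_map Xt Yt r"
    and rfib: "\<forall>x\<in>topspace Xt. \<forall>y\<in>topspace Xt. r x = r y \<longleftrightarrow> (y = x \<or> y = sc_act P q g x)"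
    and sph: "Yt homeomorphic_space S3" and g0: "g \<noteq> 0"
begin

abbreviation PU :: "((real^3) \<times> (bit^3)) topology" where
  "PU \<equiv> prod_topology (top_of_set P) (discrete_topology UNIV)"

definition spn :: "real^3 \<Rightarrow> (bit^3) set" where
  "spn p = {(\<Sum>F\<in>T. lam F) | T. T \<subseteq> {F \<in> p_facets P. p \<in> F}}"

definition R :: "(real^3) \<times> (bit^3) \<Rightarrow> 'y" where
  "R = r \<circ> q"

lemma top_PU [simp]: "topspace PU = P \<times> UNIV"
  by simp

lemma qquot: "quotient_map PU Xt q"
  using quot by (simp add: small_cover_quot_def)

lemma top_Xt: "topspace Xt = q ` (P \<times> UNIV)"
  using quotient_imp_surjective_map [OF qquot] by simp

lemma q_in: "p \<in> P \<Longrightarrow> q (p, u) \<in> topspace Xt"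
  unfolding top_Xt by blast

lemma Rquot: "quotient_map PU Yt R"
  unfolding R_def by (rule quotient_map_compose [OF qquot rquot])

lemma top_Yt: "topspace Yt = R ` (P \<times> UNIV)"
  using quotient_imp_surjective_map [OF Rquot] by simp

lemma q_eq:
  assumes "p \<in> P" "p' \<in> P"
  shows "q (p, u) = q (p', u') \<longleftrightarrow> p = p' \<and> u + u' \<in> spn p"
proof -
  have "q (p, u) = q (p', u') \<longleftrightarrow> sc_rel P lam (p, u) (p', u')"
    using quot assms by (simp add: small_cover_quot_def)
  also have "\<dots> \<longleftrightarrow> p = p' \<and> u + u' \<in> spn p"
    using assms by (simp add: sc_rel_def spn_def bit_vec_diff add.commute)
  finally show ?thesis .
qed

lemma spn_0: "0 \<in> spn p"
  unfolding spn_def by (rule CollectI, rule exI [of _ "{}"]) simp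

lemma spn_lam: "F \<in> p_facets P \<Longrightarrow> p \<in> F \<Longrightarrow> lam F \<in> spn p"
  unfolding spn_def by (rule CollectI, rule exI [of _ "{F}"]) simp

text \<open>That the sums over subsets form a subgroup is read off from the identification: if
  \<open>v\<close> and \<open>w\<close> are both identified with 0 over \<open>p\<close>, they are
  identified with each other, and their difference is their sum.\<close>

lemma spn_add:
  assumes "p \<in> P" "v \<in> spn p" "w \<in> spn p"
  shows "v + w \<in> spn p"
proof -
  have "q (p, v) = q (p, 0)" "q (p, w) = q (p, 0)" using q_eq assms by simp_all
  then have "q (p, v) = q (p, w)" by simp
  then show ?thesis using q_eq assms by simp
qed

text \<open>The choice in \<open>sc_act\<close> is harmless: two representatives of a point differ
  by an element of \<open>spn p\<close>, and translating both by \<open>g\<close> does not change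
  the difference.\<close>

lemma act:
  assumes "p \<in> P"
  shows "sc_act P q g (q (p, u)) = q (p, u + g)"
  unfolding sc_act_def
proof (rule some_equality)
  show "\<exists>p' v. p' \<in> P \<and> q (p, u) = q (p', v) \<and> q (p, u + g) = q (p', v + g)" using assms by blast
  fix y assume "\<exists>p' v. p' \<in> P \<and> q (p, u) = q (p', v) \<and> y = q (p', v + g)"
  then obtain p' v where v: "p' \<in> P" "q (p, u) = q (p', v)" "y = q (p', v + g)" by blast
  have "p = p' \<and> u + v \<in> spn p" by (rule iffD1 [OF q_eq [OF assms v(1)] v(2)])
  then have "p = p'" "u + v \<in> spn p" by blast+
  moreover have "(u + g) + (v + g) = u + v" by (metis add.assoc add.commute bit_vec_add_cancel)
  ultimately show "y = q (p, u + g)" using q_eq [OF assms assms, of "u + g" "v + g"] v(3) by simp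
qed

lemma R_eq:
  assumes "p \<in> P" "p' \<in> P"
  shows "R (p, u) = R (p', u') \<longleftrightarrow> p = p' \<and> (u + u' \<in> spn p \<or> u + u' + g \<in> spn p)"
proof -
  have "R (p, u) = R (p', u') \<longleftrightarrow> q (p', u') = q (p, u) \<or> q (p', u') = sc_act P q g (q (p, u))"
    using rfib q_in assms by (simp add: R_def)
  also have "\<dots> \<longleftrightarrow> q (p, u) = q (p', u') \<or> q (p, u + g) = q (p', u')"
    using act [OF assms(1)] by metis
  also have "\<dots> \<longleftrightarrow> p = p' \<and> (u + u' \<in> spn p \<or> u + u' + g \<in> spn p)"
    unfolding q_eq [OF assms] by (auto simp: ac_simps)
  finally show ?thesis .
qed

lemma proj: "\<exists>\<pi>. continuous_map Yt (top_of_set P) \<pi> \<and> (\<forall>p\<in>P. \<forall>u. \<pi> (R (p, u)) = p)"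
proof -
  have 1: "continuous_map PU (top_of_set P) fst" by (rule continuous_map_fst)
  show ?thesis
  proof (rule quotient_map_lift_exists [OF Rquot 1])
    show "fst x = fst y" if "x \<in> topspace PU" "y \<in> topspace PU" "R x = R y" for x y
      using that R_eq by (cases x; cases y) auto
    fix \<pi> assume "continuous_map Yt (top_of_set P) \<pi>" "\<And>x. x \<in> topspace PU \<Longrightarrow> \<pi> (R x) = fst x"
    then show ?thesis by (intro exI [of _ \<pi>]) simp
  qed
qed

lemma sphere_homeo:
  "\<exists>k k'. homeomorphic_map Yt S3 k \<and> continuous_map S3 Yt k' \<and>
    (\<forall>y\<in>topspace Yt. k' (k y) = y) \<and> (\<forall>x\<in>sphere 0 1. k (k' x) = x)"
proof -
  obtain k k' where "homeomorphic_maps Yt S3 k k'" using sph by (auto simp: homeomorphic_space_def)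
  then show ?thesis
    by (intro exI [of _ k] exI [of _ k']) (auto simp: homeomorphic_maps_map homeomorphic_imp_continuous_map)
qed

text \<open>If \<open>g\<close> were the reflection in a facet, an interior point of that facet would have a
  half-ball neighbourhood in \<open>S\<^sup>3\<close>, against invariance of domain.\<close>

lemma lam_neq_g:
  assumes F0: "F0 \<in> p_facets P"
  shows "lam F0 \<noteq> g"
proof
  assume lg: "lam F0 = g"
  obtain p0 where p0: "p0 \<in> rel_interior F0" using facetD(5,8) [OF F0] rel_interior_eq_empty by blast
  have p0F: "p0 \<in> F0" "p0 \<notin> \<Union>(p_edges P)" using p0 facet_rel_interior [OF F0] by simp_all
  \<comment> \<open>A neighbourhood of \<open>p0\<close> in \<open>P\<close> that touches no other
    facet, so that the identifications over it are only those by \<open>g\<close>.\<close>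
  define N where "N = P - \<Union>(p_facets P - {F0})"
  have p0N: "p0 \<in> N"
  proof -
    have "p0 \<in> P" using p0F(1) facetD(3) [OF F0] by blast
    moreover have "p0 \<notin> F" if "F \<in> p_facets P - {F0}" for F
      using facets_meet_in_edges [OF F0, of F p0] that p0F by blast
    ultimately show ?thesis unfolding N_def by blast
  qed
  have clo: "closed (\<Union>(p_facets P - {F0}))" using finite_facets facetD(10) by (intro closed_Union) auto
  have opN: "openin (top_of_set P) N"
    unfolding openin_open by (intro exI [of _ "- \<Union>(p_facets P - {F0})"]) (use clo in \<open>auto simp: N_def\<close>)
  have spN: "spn p \<subseteq> {0, g}" if "p \<in> N" for p
  proof
    fix v assume "v \<in> spn p"
    then obtain T where T: "T \<subseteq> {F \<in> p_facets P. p \<in> F}" "v = (\<Sum>F\<in>T. lam F)" by (auto simp: spn_def)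
    moreover have "{F \<in> p_facets P. p \<in> F} \<subseteq> {F0}" using that by (auto simp: N_def)
    ultimately have "T = {} \<or> T = {F0}" by blast
    then show "v \<in> {0, g}" using T(2) lg by auto
  qed
  have NP: "N \<subseteq> P" by (auto simp: N_def)
  define Q where "Q = R ` (N \<times> {0})"
  \<comment> \<open>The full preimage of one sheet consists of the sheet and its translate by
    \<open>g\<close>, both open. Thus a single copy of \<open>N\<close>, including its part of the
    facet, is open in the quotient.\<close>
  have pre: "{x \<in> topspace PU. R x \<in> Q} = N \<times> {0, g}"
  proof (intro equalityI subsetI)
    fix x assume x: "x \<in> {x \<in> topspace PU. R x \<in> Q}"
    then obtain p u where pu: "x = (p, u)" "p \<in> P" by auto
    obtain p' where p': "p' \<in> N" "R (p, u) = R (p', 0)" using x pu by (auto simp: Q_def)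
    then have "p = p'" "u \<in> spn p \<or> u + g \<in> spn p" using R_eq [of p p' u 0] pu NP by auto
    then have "u \<in> {0, g} \<or> u + g \<in> {0, g}" using spN p'(1) by blast
    then have "u \<in> {0, g}" using bit_vec_eq_iff_add [of u g] by auto
    then show "x \<in> N \<times> {0, g}" using pu p'(1) \<open>p = p'\<close> by simp
  next
    fix x assume x: "x \<in> N \<times> {0, g}"
    then obtain p u where pu: "x = (p, u)" "p \<in> N" "u = 0 \<or> u = g" by blast
    then have "R (p, u) = R (p, 0)" using R_eq [of p p u 0] NP spn_0 by auto
    then show "x \<in> {x \<in> topspace PU. R x \<in> Q}" using pu NP by (auto simp: Q_def)
  qed
  have opQ: "openin Yt Q"
  proof -
    have "Q \<subseteq> topspace Yt" using NP by (auto simp: Q_def top_Yt)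
    moreover have "openin PU {x \<in> topspace PU. R x \<in> Q}"
      unfolding pre using opN by (simp add: openin_prod_Times_iff)
    ultimately show ?thesis using Rquot unfolding quotient_map_def by blast
  qed
  obtain k k' where k: "homeomorphic_map Yt S3 k" "continuous_map S3 Yt k'"
    "\<And>y. y \<in> topspace Yt \<Longrightarrow> k' (k y) = y" "\<And>x. x \<in> sphere 0 1 \<Longrightarrow> k (k' x) = x"
    using sphere_homeo by blast
  obtain \<pi> where \<pi>: "continuous_map Yt (top_of_set P) \<pi>" "\<And>p u. p \<in> P \<Longrightarrow> \<pi> (R (p, u)) = p"
    using proj by blast
  define W where "W = k ` Q"
  have QY: "Q \<subseteq> topspace Yt" using NP by (auto simp: Q_def top_Yt)
  have opW: "openin S3 W"
    unfolding W_def using homeomorphic_map_openness_eq [OF k(1)] opQ by blast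
  have WS: "W \<subseteq> sphere 0 1" using openin_subset [OF opW] by simp
  have k'W: "k' x \<in> Q" if "x \<in> W" for x using that k(3) QY by (auto simp: W_def)
  have \<pi>N: "\<pi> (R (p, 0)) = p" if "p \<in> N" for p using \<pi>(2) that NP by blast
  \<comment> \<open>The projection embeds this open piece of the 3-sphere in 3-space with image
    \<open>N\<close>. By invariance of domain \<open>N\<close> would be open, although it contains
    the boundary point \<open>p0\<close> of \<open>P\<close>.\<close>
  have "openin (top_of_set (UNIV :: (real^3) set)) ((\<pi> \<circ> k') ` W)"
  proof (rule invariance_of_domain_sphere_affine_set [OF _ _ _ _ _ _ opW])
    have "continuous_map S3 (top_of_set P) (\<pi> \<circ> k')" using k(2) \<pi>(1) by (rule continuous_map_compose)
    then have "continuous_on (sphere 0 1) (\<pi> \<circ> k')"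
      by (simp add: continuous_map_in_subtopology del: comp_apply)
    then show "continuous_on W (\<pi> \<circ> k')" using WS continuous_on_subset by blast
    show "inj_on (\<pi> \<circ> k') W"
    proof (rule inj_onI)
      fix x y assume xy: "x \<in> W" "y \<in> W" "(\<pi> \<circ> k') x = (\<pi> \<circ> k') y"
      obtain p where p: "p \<in> N" "k' x = R (p, 0)" using k'W [OF xy(1)] by (auto simp: Q_def)
      obtain p' where p': "p' \<in> N" "k' y = R (p', 0)" using k'W [OF xy(2)] by (auto simp: Q_def)
      have "k' x = k' y" using xy(3) p p' \<pi>N by simp
      then show "x = y" using k(4) WS xy(1,2) by (metis subsetD)
    qed
  qed auto
  moreover have "(\<pi> \<circ> k') ` W = N"
  proof -
    have "(\<pi> \<circ> k') ` W = (\<lambda>y. \<pi> (k' (k y))) ` Q" by (simp add: W_def image_image)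
    also have "\<dots> = \<pi> ` Q" by (rule image_cong [OF refl]) (use k(3) QY in auto)
    also have "\<dots> = (\<lambda>p. p) ` N" unfolding Q_def image_image
      by (simp add: image_paired_Times image_image \<pi>N cong: image_cong_simp) (use \<pi>N in force)
    finally show ?thesis by simp
  qed
  ultimately have "open N" by simp
  then have "N \<subseteq> interior P" using NP by (simp add: interior_maximal)
  moreover have "p0 \<in> frontier P" using p0F(1) F0 frontier_facets by blast
  ultimately show False using p0N by (auto simp: frontier_def)
qed

end

lemma (in two_regular) cyclic_order_of_path:
  assumes w: "inj_on w {..<n}" "w ` {..<n} = p_vertices P" "\<And>k. Suc k < n \<Longrightarrow> w (Suc k) \<in> nbrs (w k)"
  shows "cyclic_order P C (\<lambda>k. w (k mod n)) n"
proof
  have sp: "3 \<le> n" "C = {closed_segment (w (k mod n)) (w (Suc k mod n)) | k. k < n}"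
    using spanning_path_edges [OF w(1,2)] w(3) by blast+
  show n3: "3 \<le> n" by (rule sp(1))
  have lt: "k mod n < n" for k using n3 by simp
  show "w (p mod n) = w (q mod n) \<longleftrightarrow> p mod n = q mod n" for p q
    using inj_onD [OF w(1), of "p mod n" "q mod n"] lt by auto
  show "range (\<lambda>k. w (k mod n)) = p_vertices P"
  proof -
    have "range (\<lambda>k. k mod n) = {..<n}"
    proof (intro equalityI subsetI)
      fix k assume "k \<in> {..<n}"
      then show "k \<in> range (\<lambda>k. k mod n)" by (intro range_eqI [of _ _ k]) simp
    qed (use lt in auto)
    then have "range (\<lambda>k. w (k mod n)) = w ` {..<n}" by (metis image_image)
    then show ?thesis using w(2) by simp
  qed
  show "C = range (\<lambda>k. closed_segment (w (k mod n)) (w (Suc k mod n)))"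
  proof
    show "C \<subseteq> range (\<lambda>k. closed_segment (w (k mod n)) (w (Suc k mod n)))" by (subst sp(2)) blast
    show "range (\<lambda>k. closed_segment (w (k mod n)) (w (Suc k mod n))) \<subseteq> C"
    proof
      fix I assume "I \<in> range (\<lambda>k. closed_segment (w (k mod n)) (w (Suc k mod n)))"
      then obtain k where "I = closed_segment (w (k mod n)) (w (Suc k mod n))" by blast
      then have "I = closed_segment (w (k mod n mod n)) (w (Suc (k mod n) mod n))" by (simp add: mod_Suc_eq)
      then show "I \<in> C" by (subst sp(2)) (use lt in blast)
    qed
  qed
qed

section \<open>Coordinates modulo the involution\<close>

locale branched_split = branched P lam Xt q Yt r g
  for P lam and Xt :: "'x topology" and q and Yt :: "'y topology" and r g +
  fixes k1 k2 :: "bit^3 \<Rightarrow> bit"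
  assumes spl: "splitting k1 k2 (lam ` p_facets P) g"
begin

text \<open>Indexing the coordinates by colour lets statements about both colours be proved once: a
  facet has colour \<open>b\<close> exactly if \<open>kk b\<close> is 1 on its label, and then the
  other coordinate is 0.\<close>

definition kk :: "bool \<Rightarrow> bit^3 \<Rightarrow> bit" where
  "kk b = (if b then k1 else k2)"

lemma kk_additive: "additive_bit (kk b)"
  using spl by (simp add: splitting_def kk_def)

lemma kk_add: "kk b (u + v) = kk b u + kk b v"
  by (rule additive_bit_add [OF kk_additive])

lemma kk_0: "kk b 0 = 0"
  by (rule additive_bit_0 [OF kk_additive])

lemma kk_kernel: "(\<forall>b. kk b u = 0) \<longleftrightarrow> u = 0 \<or> u = g"
  using spl by (simp add: splitting_def kk_def all_bool_eq)

lemma kk_g: "kk b g = 0"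
  using kk_kernel [of g] by simp

lemma kk_lam: "F \<in> p_facets P \<Longrightarrow> kk (\<not> b) (lam F) = 0 \<longleftrightarrow> kk b (lam F) = 1"
  using spl by (cases b) (auto simp: splitting_def kk_def)

lemma kk_eq_iff: "kk b u = kk b v \<longleftrightarrow> kk b (u + v) = 0"
  by (simp add: kk_add bit_add_eq_0_iff)

lemma kk_sum: "finite T \<Longrightarrow> kk b (\<Sum>F\<in>T. lam F) = (\<Sum>F\<in>T. kk b (lam F))"
  by (induction T rule: finite_induct) (simp_all add: kk_0 kk_add)

lemma same_colour_sum:
  assumes "F \<in> p_facets P" "F' \<in> p_facets P" "kk True (lam F) = 1 \<longleftrightarrow> kk True (lam F') = 1" "lam F \<noteq> lam F'"
  shows "lam F + lam F' = g"
proof -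
  have 1: "kk True (lam F) = kk True (lam F')" using assms(3) by (cases "kk True (lam F)"; cases "kk True (lam F')") simp_all
  have "kk False (lam F) = 0 \<longleftrightarrow> kk False (lam F') = 0"
    using kk_lam [OF assms(1), of True] kk_lam [OF assms(2), of True] assms(3) by simp
  then have 2: "kk False (lam F) = kk False (lam F')" by (cases "kk False (lam F)"; cases "kk False (lam F')") simp_all
  have "\<forall>b. kk b (lam F + lam F') = 0" using 1 2 by (simp add: all_bool_eq kk_eq_iff)
  then have "lam F + lam F' = 0 \<or> lam F + lam F' = g" using kk_kernel by blast
  then show ?thesis using assms(4) bit_vec_eq_iff_add by blast
qed

lemma face_lam_inj:
  assumes "C face_of P" "C \<noteq> {}" "C \<noteq> P"
  shows "inj_on lam {G \<in> p_facets P. C \<subseteq> G}"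
  using char assms by (simp add: char_fun_def z2_indep_def)

text \<open>The labels at a vertex are distinct, and distinct labels of equal colour differ by
  \<open>g\<close>. If all three facets had one colour, the second and the third label would both be
  the first plus \<open>g\<close>.\<close>

sublocale coloured P "\<lambda>F. kk True (lam F) = 1"
proof
  fix v assume v: "v \<in> p_vertices P"
  obtain F1 F2 F3 where ne: "F1 \<noteq> F2" "F1 \<noteq> F3" "F2 \<noteq> F3" and F: "{F \<in> p_facets P. v \<in> F} = {F1, F2, F3}"
    using vertex_facets [OF v] by metis
  have "{v} face_of P" using v by (simp add: face_of_singleton p_vertices_def)
  moreover have "{v} \<noteq> P" using dimP by force
  ultimately have "inj_on lam {G \<in> p_facets P. {v} \<subseteq> G}" by (intro face_lam_inj) simp_all
  then have inj: "inj_on lam {F1, F2, F3}" using F by simp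
  have "F1 \<in> {F \<in> p_facets P. v \<in> F}" "F2 \<in> {F \<in> p_facets P. v \<in> F}" "F3 \<in> {F \<in> p_facets P. v \<in> F}"
    unfolding F by simp_all
  then have f: "F1 \<in> p_facets P" "F2 \<in> p_facets P" "F3 \<in> p_facets P" "v \<in> F1" "v \<in> F2" "v \<in> F3" by simp_all
  have l: "lam F1 \<noteq> lam F2" "lam F1 \<noteq> lam F3" "lam F2 \<noteq> lam F3"
    using inj ne by (auto simp: inj_on_def)
  have "\<not> ((kk True (lam F1) = 1 \<longleftrightarrow> kk True (lam F2) = 1) \<and> (kk True (lam F1) = 1 \<longleftrightarrow> kk True (lam F3) = 1))"
  proof
    assume "(kk True (lam F1) = 1 \<longleftrightarrow> kk True (lam F2) = 1) \<and> (kk True (lam F1) = 1 \<longleftrightarrow> kk True (lam F3) = 1)"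
    then have "lam F1 + lam F2 = g" "lam F1 + lam F3 = g"
      using same_colour_sum f l by blast+
    then have "lam F2 = lam F3" by (metis bit_vec_add_cancel)
    then show False using l(3) by simp
  qed
  then show "\<exists>F\<in>p_facets P. \<exists>F'\<in>p_facets P. v \<in> F \<and> v \<in> F' \<and> (kk True (lam F) = 1) \<noteq> (kk True (lam F') = 1)"
    using f by metis
qed

lemma U_iff: "p \<in> U b \<longleftrightarrow> (\<exists>F\<in>p_facets P. p \<in> F \<and> kk b (lam F) = 1)"
proof (cases b)
  case True
  then show ?thesis by (auto simp: U_def)
next
  case False
  have "kk False (lam F) = 1 \<longleftrightarrow> \<not> kk True (lam F) = 1" if "F \<in> p_facets P" for F
    using kk_lam [OF that, of False] by simp
  then show ?thesis using False by (auto simp: U_def)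
qed

lemma edge_label_sum:
  assumes F: "F \<in> p_facets P" "F' \<in> p_facets P" "F \<noteq> F'" "F \<inter> F' \<noteq> {}"
  shows "edge_label P lam (F \<inter> F') = lam F + lam F'" "lam F \<noteq> lam F'"
proof -
  have e: "{G \<in> p_facets P. F \<inter> F' \<subseteq> G} = {F, F'}" by (rule edge_facets_eq [OF F])
  show "edge_label P lam (F \<inter> F') = lam F + lam F'" unfolding edge_label_def e using F(3) by simp
  have "F \<inter> F' \<in> p_edges P" by (rule facet_Int_edge [OF F])
  then have "inj_on lam {G \<in> p_facets P. F \<inter> F' \<subseteq> G}" using edgeD(1,3,4) face_lam_inj by blast
  then show "lam F \<noteq> lam F'" unfolding e using F(3) by (auto simp: inj_on_def)
qed

lemma C_edge_label: "C = {I \<in> p_edges P. edge_label P lam I \<noteq> g}"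
proof -
  have "I \<in> C \<longleftrightarrow> edge_label P lam I \<noteq> g" if I: "I \<in> p_edges P" for I
  proof -
    obtain F F' where F: "F \<noteq> F'" "F \<in> p_facets P" "F' \<in> p_facets P" "I = F \<inter> F'"
      using edge_facets [OF I] by metis
    have ne: "F \<inter> F' \<noteq> {}" using edgeD(3) [OF I] F(4) by simp
    note el = edge_label_sum [OF F(2,3,1) ne]
    have "lam F + lam F' = g \<longleftrightarrow> (kk True (lam F) = 1 \<longleftrightarrow> kk True (lam F') = 1)"
    proof
      assume "lam F + lam F' = g"
      then have "kk True (lam F) = kk True (lam F')" using kk_eq_iff kk_g by simp
      then show "kk True (lam F) = 1 \<longleftrightarrow> kk True (lam F') = 1" by simp
    qed (use same_colour_sum F el(2) in blast)
    then show ?thesis using edge_in_C_iff [OF F(2,3,1) ne] el(1) unfolding F(4) by simp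
  qed
  then show ?thesis using C_edges by blast
qed

lemma kk_spn:
  assumes "v \<in> spn p" "p \<notin> U b"
  shows "kk b v = 0"
proof -
  obtain T where T: "T \<subseteq> {F \<in> p_facets P. p \<in> F}" "v = (\<Sum>F\<in>T. lam F)" using assms(1) by (auto simp: spn_def)
  have fin: "finite T" using finite_subset [OF T(1)] finite_facets by simp
  have "kk b (lam F) = 0" if "F \<in> T" for F
    using that T(1) assms(2) by (auto simp: U_iff)
  then show ?thesis unfolding T(2) kk_sum [OF fin] by simp
qed

text \<open>The fibres decouple: over a point the coordinate \<open>kk b\<close> is forgotten
  exactly if the point lies in \<open>U b\<close>. After this lemma the characteristic function
  itself is no longer visible, only the colouring.\<close>

lemma R_split:
  assumes "p \<in> P" "p' \<in> P"
  shows "R (p, u) = R (p', u') \<longleftrightarrow> p = p' \<and> (\<forall>b. kk b u = kk b u' \<or> p \<in> U b)"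
proof
  assume "R (p, u) = R (p', u')"
  then have "p = p' \<and> (u + u' \<in> spn p \<or> u + u' + g \<in> spn p)" unfolding R_eq [OF assms] .
  then have p: "p = p'" and s: "u + u' \<in> spn p \<or> u + u' + g \<in> spn p" by blast+
  have "kk b u = kk b u'" if "p \<notin> U b" for b
  proof -
    have "kk b (u + u') = 0 \<or> kk b (u + u' + g) = 0" using s kk_spn that by blast
    then show ?thesis by (simp add: kk_eq_iff kk_add kk_g)
  qed
  then show "p = p' \<and> (\<forall>b. kk b u = kk b u' \<or> p \<in> U b)" using p by blast
next
  assume A: "p = p' \<and> (\<forall>b. kk b u = kk b u' \<or> p \<in> U b)"
  \<comment> \<open>The two coordinates are corrected separately: where \<open>kk b\<close> differs,
    \<open>p\<close> lies on a facet of colour \<open>b\<close>, whose label changes this coordinate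
    alone.\<close>
  have "\<exists>l\<in>spn p. kk b l = kk b (u + u') \<and> kk (\<not> b) l = 0" for b
  proof (cases "kk b (u + u') = 0")
    case True
    then show ?thesis using spn_0 kk_0 by (intro bexI [of _ 0]) auto
  next
    case False
    then have "p \<in> U b" using A kk_eq_iff by blast
    then obtain F where F: "F \<in> p_facets P" "p \<in> F" "kk b (lam F) = 1" using U_iff by blast
    then show ?thesis using False spn_lam kk_lam [OF F(1)] by (intro bexI [of _ "lam F"]) auto
  qed
  then obtain l1 l2 where l: "l1 \<in> spn p" "kk True l1 = kk True (u + u')" "kk False l1 = 0"
    "l2 \<in> spn p" "kk False l2 = kk False (u + u')" "kk True l2 = 0" by (metis (full_types))
  have "\<forall>b. kk b ((l1 + l2) + (u + u')) = 0"
    using l by (simp add: all_bool_eq kk_add [of _ "l1 + l2"] kk_add [of _ l1] bit_add_self)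
  then have "(l1 + l2) + (u + u') = 0 \<or> (l1 + l2) + (u + u') = g" using kk_kernel by blast
  then have "u + u' = l1 + l2 \<or> u + u' + g = l1 + l2"
    by (metis add.commute bit_vec_add_cancel bit_vec_eq_iff_add)
  moreover have "l1 + l2 \<in> spn p" using spn_add [OF assms(1)] l by blast
  ultimately show "R (p, u) = R (p', u')" using R_eq [OF assms] A by metis
qed

lemma kk_surj: "\<exists>u. kk True u = i \<and> kk False u = j"
proof -
  have "\<exists>l. kk b l = 1 \<and> kk (\<not> b) l = 0" for b
  proof -
    obtain x where "x \<in> U b" using U_proper by blast
    then obtain F where "F \<in> p_facets P" "kk b (lam F) = 1" using U_iff by blast
    then show ?thesis using kk_lam by blast
  qed
  then obtain l1 l2 where l: "kk True l1 = 1" "kk False l1 = 0" "kk False l2 = 1" "kk True l2 = 0" by (metis (full_types))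
  consider "i = 0" "j = 0" | "i = 1" "j = 0" | "i = 0" "j = 1" | "i = 1" "j = 1" by (cases i; cases j) blast+
  then show ?thesis
  proof cases
    case 1 then show ?thesis using kk_0 by blast
  next
    case 2 then show ?thesis using l by blast
  next
    case 3 then show ?thesis using l by blast
  next
    case 4 then show ?thesis using l by (intro exI [of _ "l1 + l2"]) (simp add: kk_add)
  qed
qed

lemma U_subset: "U b \<subseteq> P"
  using facetD(3) unfolding U_def by blast

text \<open>\<open>Y\<close> is the union of the two closed connected sets on which \<open>kk b\<close> is constant, and they meet over
  \<open>U b\<close>; so unicoherence of \<open>S\<^sup>3\<close> makes \<open>U b\<close> connected.\<close>

lemma U_connected: "connected (U b)"
proof -
  obtain k k' where k: "homeomorphic_map Yt S3 k" "continuous_map S3 Yt k'"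
    "\<And>y. y \<in> topspace Yt \<Longrightarrow> k' (k y) = y" "\<And>x. x \<in> sphere 0 1 \<Longrightarrow> k (k' x) = x"
    using sphere_homeo by blast
  obtain \<pi> where \<pi>: "continuous_map Yt (top_of_set P) \<pi>" "\<And>p u. p \<in> P \<Longrightarrow> \<pi> (R (p, u)) = p"
    using proj by blast
  define M where "M = (\<lambda>i. \<Union>u\<in>{u. kk b u = i}. (k \<circ> R) ` (P \<times> {u}))"
  have contkR: "continuous_map PU S3 (k \<circ> R)"
    using quotient_imp_continuous_map [OF Rquot] homeomorphic_imp_continuous_map [OF k(1)]
    by (rule continuous_map_compose)
  have slice: "continuous_on P (\<lambda>p. (k \<circ> R) (p, u))" for u
  proof -
    have "continuous_map (top_of_set P) PU (\<lambda>p. (p, u))"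
      by (intro continuous_map_pairedI) auto
    then have "continuous_map (top_of_set P) S3 ((k \<circ> R) \<circ> (\<lambda>p. (p, u)))"
      using contkR by (rule continuous_map_compose)
    then show ?thesis by (simp add: continuous_map_in_subtopology o_def)
  qed
  have sl: "(k \<circ> R) ` (P \<times> {u}) = (\<lambda>p. (k \<circ> R) (p, u)) ` P" for u by auto
  have con1: "connected ((k \<circ> R) ` (P \<times> {u}))" and com1: "compact ((k \<circ> R) ` (P \<times> {u}))" for u
    unfolding sl using slice poly(3,4) by (auto intro: connected_continuous_image compact_continuous_image convex_connected)
  \<comment> \<open>Over a point of the other region the other coordinate is forgotten, so all
    copies of \<open>P\<close> with a given value of \<open>kk b\<close> pass through one common
    point.\<close>
  obtain p0 where p0: "p0 \<in> U (\<not> b)" "p0 \<in> P" using U_proper [of "\<not> b"] U_subset by blast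
  have conM: "connected (M i)" for i
    unfolding M_def
  proof (rule connected_Union)
    show "connected s" if "s \<in> (\<lambda>u. (k \<circ> R) ` (P \<times> {u})) ` {u. kk b u = i}" for s using that con1 by blast
    obtain u0 where u0: "kk b u0 = i" using kk_surj by (cases b) metis+
    have "(k \<circ> R) (p0, u0) \<in> (k \<circ> R) ` (P \<times> {u})" if "kk b u = i" for u
    proof -
      have "R (p0, u0) = R (p0, u)"
        unfolding R_split [OF p0(2) p0(2)] using u0 that p0(1) by (metis (full_types))
      then show ?thesis using p0(2) by auto
    qed
    then show "\<Inter> ((\<lambda>u. (k \<circ> R) ` (P \<times> {u})) ` {u. kk b u = i}) \<noteq> {}" by blast
  qed
  have comM: "compact (M i)" for i
    unfolding M_def by (intro compact_UN com1) simp
  have MS: "M i \<subseteq> sphere 0 1" for i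
    using continuous_map_image_subset_topspace [OF contkR] by (auto simp: M_def)
  have un: "sphere 0 1 = M 0 \<union> M 1"
  proof
    show "sphere 0 1 \<subseteq> M 0 \<union> M 1"
    proof
      fix x :: "real^4" assume x: "x \<in> sphere 0 1"
      then have "k' x \<in> topspace Yt" using k(2) by (auto simp: continuous_map_def)
      then obtain p u where pu: "p \<in> P" "k' x = R (p, u)" unfolding top_Yt by auto
      then have "x = (k \<circ> R) (p, u)" using k(4) [OF x] by simp
      then have "x \<in> M (kk b u)" unfolding M_def using pu(1) by blast
      then show "x \<in> M 0 \<union> M 1" by (cases "kk b u") auto
    qed
  qed (use MS in blast)
  have "unicoherent (sphere (0 :: real^4) 1)" by (intro Borsukian_imp_unicoherent Borsukian_sphere) simp
  then have "connected (M 0 \<inter> M 1)"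
    by (rule unicoherentD [OF _ conM conM un])
       (use MS comM in \<open>auto intro!: closed_subset compact_imp_closed\<close>)
  moreover have "continuous_on (sphere 0 1) (\<pi> \<circ> k')"
  proof -
    have "continuous_map S3 (top_of_set P) (\<pi> \<circ> k')" using k(2) \<pi>(1) by (rule continuous_map_compose)
    then show ?thesis by (simp add: continuous_map_in_subtopology del: comp_apply)
  qed
  ultimately have "connected ((\<pi> \<circ> k') ` (M 0 \<inter> M 1))"
    using MS by (intro connected_continuous_image) (auto intro: continuous_on_subset)
  moreover have "(\<pi> \<circ> k') ` (M 0 \<inter> M 1) = U b"
  proof (intro equalityI subsetI)
    fix p assume "p \<in> (\<pi> \<circ> k') ` (M 0 \<inter> M 1)"
    then obtain x where x: "x \<in> M 0" "x \<in> M 1" "p = \<pi> (k' x)" by auto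
    obtain p1 u1 where 1: "kk b u1 = 0" "p1 \<in> P" "x = k (R (p1, u1))" using x(1) by (auto simp: M_def)
    obtain p2 u2 where 2: "kk b u2 = 1" "p2 \<in> P" "x = k (R (p2, u2))" using x(2) by (auto simp: M_def)
    have "R (p1, u1) \<in> topspace Yt" "R (p2, u2) \<in> topspace Yt" using 1(2) 2(2) by (auto simp: top_Yt)
    then have e: "k' x = R (p1, u1)" "k' x = R (p2, u2)" using k(3) 1(3) 2(3) by metis+
    then have "R (p1, u1) = R (p2, u2)" by simp
    then have "kk b u1 = kk b u2 \<or> p1 \<in> U b" unfolding R_split [OF 1(2) 2(2)] by blast
    then have "p1 \<in> U b" using 1(1) 2(1) by simp
    then show "p \<in> U b" using x(3) e(1) \<pi>(2) 1(2) by simp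
  next
    fix p assume p: "p \<in> U b"
    then have pP: "p \<in> P" using U_subset by blast
    obtain u v where uv: "kk b u = 0" "kk (\<not> b) u = 0" "kk b v = 1" "kk (\<not> b) v = 0"
      using kk_surj by (cases b) metis+
    have "R (p, u) = R (p, v)"
      unfolding R_split [OF pP pP] using p uv by (metis (full_types))
    moreover have "k (R (p, u)) \<in> M 0" "k (R (p, v)) \<in> M 1"
      unfolding M_def using uv pP by auto
    ultimately have "k (R (p, u)) \<in> M 0" "k (R (p, u)) \<in> M 1" by simp_all
    moreover have "\<pi> (k' (k (R (p, u)))) = p"
      using k(3) [of "R (p, u)"] \<pi>(2) pP by (simp add: top_Yt)
    ultimately show "p \<in> (\<pi> \<circ> k') ` (M 0 \<inter> M 1)" by (intro image_eqI [of _ _ "k (R (p, u))"]) auto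
  qed
  ultimately show ?thesis by simp
qed

lemma C_connected: "connected (\<Union>C)"
proof -
  have "aff_dim P = aff_dim (cball (0 :: real^3) 1)" by (simp add: dimP aff_dim_cball)
  then have "rel_frontier P homeomorphic rel_frontier (cball (0 :: real^3) 1)"
    using poly(3) polytope_imp_bounded [OF poly(1)]
    by (intro homeomorphic_rel_frontiers_convex_bounded_sets) simp_all
  then have "frontier P homeomorphic sphere (0 :: real^3) 1"
    using full(4) by (simp add: rel_frontier_nonempty_interior)
  moreover have "unicoherent (sphere (0 :: real^3) 1)" by (intro Borsukian_imp_unicoherent Borsukian_sphere) simp
  ultimately have "unicoherent (frontier P)" using homeomorphic_unicoherent_eq by blast
  then have "connected (U True \<inter> U False)"
    by (rule unicoherentD [OF _ U_connected U_connected])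
       (use U_Un [of True] U_closed in \<open>auto intro!: closed_subset\<close>)
  then show ?thesis using U_Int [of True] by simp
qed

end

section \<open>Identification with the 3-sphere\<close>

lemma norm4: "(norm (x :: real^4))\<^sup>2 = (x $ 1)\<^sup>2 + (x $ 2)\<^sup>2 + (x $ 3)\<^sup>2 + (x $ 4)\<^sup>2"
  unfolding power2_norm_eq_inner inner_vec_def sum_4 by (simp add: power2_eq_square)

lemma sphere4: "x \<in> sphere (0 :: real^4) 1 \<longleftrightarrow> (x $ 1)\<^sup>2 + (x $ 2)\<^sup>2 + (x $ 3)\<^sup>2 + (x $ 4)\<^sup>2 = 1"
proof -
  have "x \<in> sphere 0 1 \<longleftrightarrow> (norm x)\<^sup>2 = 1" by (auto simp: power2_eq_1_iff) (smt (verit) norm_ge_zero)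
  then show ?thesis by (simp only: norm4)
qed

definition sg :: "bit \<Rightarrow> real" where
  "sg b = (if b = 0 then 1 else -1)"

lemma sg_props: "sg b \<noteq> 0" "(sg b)\<^sup>2 = 1" "sg b = sg b' \<longleftrightarrow> b = b'" "\<bar>sg b\<bar> = 1"
  by (cases b; cases b'; simp add: sg_def)+

context branched_split
begin

definition K :: "(real^3) set \<Rightarrow> 'y set" where
  "K I = R ` (I \<times> UNIV)"

text \<open>The four copies of \<open>P\<close> go to the four quarters of the sphere given by the signs of \<open>x\<^sub>3\<close> and \<open>x\<^sub>4\<close>.\<close>

lemma model_homeomorphism:
  assumes cX: "continuous_on P X" and cs: "continuous_on P s" and ct: "continuous_on P t"
    and unit: "\<And>p. p \<in> P \<Longrightarrow> 0 \<le> s p \<and> 0 \<le> t p \<and> (norm (X p :: complex))\<^sup>2 + (s p)\<^sup>2 + (t p)\<^sup>2 = 1"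
    and inj: "\<And>p p'. p \<in> P \<Longrightarrow> p' \<in> P \<Longrightarrow> X p = X p' \<Longrightarrow> s p = s p' \<Longrightarrow> t p = t p' \<Longrightarrow> p = p'"
    and surj: "\<And>z a b. 0 \<le> a \<Longrightarrow> 0 \<le> b \<Longrightarrow> (norm z)\<^sup>2 + a\<^sup>2 + b\<^sup>2 = 1 \<Longrightarrow> \<exists>p\<in>P. X p = z \<and> s p = a \<and> t p = b"
    and s0: "\<And>p. p \<in> P \<Longrightarrow> s p = 0 \<longleftrightarrow> p \<in> U True" and t0: "\<And>p. p \<in> P \<Longrightarrow> t p = 0 \<longleftrightarrow> p \<in> U False"
  shows "\<exists>\<psi>. homeomorphic_map Yt S3 \<psi> \<and> (\<forall>p\<in>P. \<forall>u. \<psi> (R (p, u)) $ 1 = Re (X p) \<and>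
    \<psi> (R (p, u)) $ 2 = Im (X p) \<and> \<psi> (R (p, u)) $ 3 = sg (kk True u) * s p \<and> \<psi> (R (p, u)) $ 4 = sg (kk False u) * t p)"
proof -
  define \<Theta> :: "(real^3) \<times> (bit^3) \<Rightarrow> real^4" where
    "\<Theta> = (\<lambda>(p, u). \<chi> l. if l = 1 then Re (X p) else if l = 2 then Im (X p) else
       if l = 3 then sg (kk True u) * s p else sg (kk False u) * t p)"
  have \<Theta>: "\<Theta> (p, u) $ 1 = Re (X p)" "\<Theta> (p, u) $ 2 = Im (X p)"
    "\<Theta> (p, u) $ 3 = sg (kk True u) * s p" "\<Theta> (p, u) $ 4 = sg (kk False u) * t p" for p u
    by (simp_all add: \<Theta>_def)
  have \<Theta>S: "\<Theta> (p, u) \<in> sphere 0 1" if "p \<in> P" for p u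
    using unit [OF that] unfolding sphere4 \<Theta> by (simp add: power_mult_distrib sg_props cmod_power2)
  have cont: "continuous_map PU S3 \<Theta>"
  proof (rule continuous_map_prod_discrete)
    fix u
    have "continuous_on P (\<lambda>p. \<Theta> (p, u))"
      unfolding \<Theta>_def prod.case
    proof (rule continuous_on_vec_lambda)
      fix l :: 4
      show "continuous_on P (\<lambda>p. if l = 1 then Re (X p) else if l = 2 then Im (X p) else
          if l = 3 then sg (kk True u) * s p else sg (kk False u) * t p)"
        by (cases "l = 1"; cases "l = 2"; cases "l = 3") (auto intro!: continuous_intros cX cs ct)
    qed
    then show "continuous_map (top_of_set P) S3 (\<lambda>p. \<Theta> (p, u))"
      using \<Theta>S by (auto simp: continuous_map_in_subtopology)
  qed
  \<comment> \<open>As \<open>s\<close> and \<open>t\<close> are nonnegative, absolute values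
    recover them and with them \<open>p\<close>. The signs can then be compared only where the
    coordinate is nonzero, which is the description of the fibres of \<open>R\<close>.\<close>
  have fib: "R (p, u) = R (p', u') \<longleftrightarrow> \<Theta> (p, u) = \<Theta> (p', u')" if p: "p \<in> P" "p' \<in> P" for p p' u u'
  proof -
    have "\<Theta> (p, u) = \<Theta> (p', u') \<longleftrightarrow> X p = X p' \<and> sg (kk True u) * s p = sg (kk True u') * s p' \<and>
        sg (kk False u) * t p = sg (kk False u') * t p'"
      by (auto simp: vec_eq_iff forall_4 \<Theta> complex_eq_iff)
    also have "\<dots> \<longleftrightarrow> p = p' \<and> sg (kk True u) * s p = sg (kk True u') * s p \<and>
        sg (kk False u) * t p = sg (kk False u') * t p"
    proof
      assume A: "X p = X p' \<and> sg (kk True u) * s p = sg (kk True u') * s p' \<and>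
        sg (kk False u) * t p = sg (kk False u') * t p'"
      then have "\<bar>sg (kk True u) * s p\<bar> = \<bar>sg (kk True u') * s p'\<bar>" "\<bar>sg (kk False u) * t p\<bar> = \<bar>sg (kk False u') * t p'\<bar>"
        by simp_all
      then have "s p = s p'" "t p = t p'" using unit [OF p(1)] unit [OF p(2)] by (simp_all add: abs_mult sg_props)
      then have "p = p'" using inj p A by blast
      then show "p = p' \<and> sg (kk True u) * s p = sg (kk True u') * s p \<and> sg (kk False u) * t p = sg (kk False u') * t p"
        using A by simp
    qed auto
    also have "\<dots> \<longleftrightarrow> p = p' \<and> (kk True u = kk True u' \<or> s p = 0) \<and> (kk False u = kk False u' \<or> t p = 0)"
      by (auto simp: sg_props)
    also have "\<dots> \<longleftrightarrow> R (p, u) = R (p', u')"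
      unfolding R_split [OF p] s0 [OF p(1)] t0 [OF p(1)] by (simp add: all_bool_eq conj_commute)
    finally show ?thesis by simp
  qed
  have "\<exists>\<psi>. continuous_map Yt S3 \<psi> \<and> \<psi> ` topspace Yt = \<Theta> ` topspace PU \<and>
    (\<forall>x\<in>topspace PU. \<psi> (R x) = \<Theta> x)"
  proof (rule quotient_map_lift_exists [OF Rquot cont])
    show "\<Theta> x = \<Theta> y" if "x \<in> topspace PU" "y \<in> topspace PU" "R x = R y" for x y
      using that fib by (cases x; cases y) auto
    fix \<psi> assume "continuous_map Yt S3 \<psi>" "\<psi> ` topspace Yt = \<Theta> ` topspace PU"
      "\<And>x. x \<in> topspace PU \<Longrightarrow> \<psi> (R x) = \<Theta> x"
    then show ?thesis by (intro exI [of _ \<psi>]) simp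
  qed
  then obtain \<psi> where \<psi>: "continuous_map Yt S3 \<psi>" "\<psi> ` topspace Yt = \<Theta> ` topspace PU"
    "\<forall>x\<in>topspace PU. \<psi> (R x) = \<Theta> x" by blast
  have \<psi>R: "\<psi> (R (p, u)) = \<Theta> (p, u)" if "p \<in> P" for p u using \<psi>(3) that by simp
  have "homeomorphic_map Yt S3 \<psi>"
  proof (rule continuous_imp_homeomorphic_map [OF \<psi>(1)])
    have "compact_space S3" by (simp add: compact_space_subtopology)
    then show "compact_space Yt" using sph homeomorphic_compact_space by blast
    show "Hausdorff_space S3" by (simp add: Hausdorff_space_subtopology)
    show "\<psi> ` topspace Yt = topspace S3"
    proof -
      have "sphere 0 1 \<subseteq> \<Theta> ` (P \<times> UNIV)"
      proof
        fix x :: "real^4" assume x: "x \<in> sphere 0 1"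
        have "(norm (Complex (x $ 1) (x $ 2)))\<^sup>2 + \<bar>x $ 3\<bar>\<^sup>2 + \<bar>x $ 4\<bar>\<^sup>2 = 1"
          using x [unfolded sphere4] by (simp add: cmod_power2)
        then obtain p where p: "p \<in> P" "X p = Complex (x $ 1) (x $ 2)" "s p = \<bar>x $ 3\<bar>" "t p = \<bar>x $ 4\<bar>"
          using surj by (metis abs_ge_zero)
        obtain u where u: "kk True u = (if x $ 3 < 0 then 1 else 0)" "kk False u = (if x $ 4 < 0 then 1 else 0)"
          using kk_surj by blast
        have "\<Theta> (p, u) = x"
          by (simp add: vec_eq_iff forall_4 \<Theta> p u sg_def)
        then show "x \<in> \<Theta> ` (P \<times> UNIV)" using p(1) by force
      qed
      then show ?thesis unfolding \<psi>(2) using \<Theta>S by auto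
    qed
    show "inj_on \<psi> (topspace Yt)"
    proof (rule inj_onI)
      fix x y assume "x \<in> topspace Yt" "y \<in> topspace Yt" and eq: "\<psi> x = \<psi> y"
      then obtain p u p' u' where xy: "p \<in> P" "x = R (p, u)" "p' \<in> P" "y = R (p', u')" unfolding top_Yt by auto
      then have "\<Theta> (p, u) = \<Theta> (p', u')" using eq \<psi>R by simp
      then show "x = y" using fib xy by simp
    qed
  qed
  then show ?thesis using \<psi>R \<Theta> by auto
qed

text \<open>The rotation \<open>\<omega>\<close> is used to place two non-crossing chords strictly on either side of the real axis.\<close>

lemma normal_form:
  assumes cyc: "cyclic_order P C W n" and ord: "i < j" "j < k" "k < m" "m < i + n" and \<omega>: "norm \<omega> = 1"
  shows "\<exists>\<phi> \<psi>. homeomorphic_map Yt S3 \<psi> \<and>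
    \<phi> (W i) = \<omega> \<and> \<phi> (W j) = \<omega> * \<i> \<and> \<phi> (W k) = - \<omega> \<and> \<phi> (W m) = - (\<omega> * \<i>) \<and>
    (\<forall>v w b. closed_segment v w \<in> p_edges P - C \<longrightarrow> closed_segment v w \<subseteq> U b \<longrightarrow>
      \<psi> ` K (closed_segment v w) = {x \<in> sphere 0 1. x $ (if b then 3 else 4) = 0 \<and>
        Complex (x $ 1) (x $ 2) \<in> closed_segment (\<phi> v) (\<phi> w)})"
proof -
  interpret cy: cyclic_order P C W n by (rule cyc)
  obtain c where c: "simple_path c" "pathfinish c = pathstart c" "path_image c = \<Union>C"
    by (rule cy.four_arc_loop [OF ord])
  obtain \<phi>0 where \<phi>0: "cbij (\<Union>C) (sphere (0::complex) 1) \<phi>0"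
    "\<phi>0 (W i) = 1" "\<phi>0 (W j) = \<i>" "\<phi>0 (W k) = -1" "\<phi>0 (W m) = -\<i>"
    by (rule cy.circle_four_marks [OF ord])
  define \<phi> where "\<phi> = (*) \<omega> \<circ> \<phi>0"
  have "\<omega> \<noteq> 0" using \<omega> by auto
  have "cbij (sphere (0::complex) 1) (sphere 0 1) ((*) \<omega>)"
  proof (rule cbijI)
    show "continuous_on (sphere 0 1) ((*) \<omega>)" by (intro continuous_intros)
    show "inj_on ((*) \<omega>) (sphere 0 1)" using \<open>\<omega> \<noteq> 0\<close> by (auto simp: inj_on_def)
    show "(*) \<omega> ` sphere 0 1 = sphere 0 1"
    proof (intro equalityI subsetI)
      fix z :: complex assume z: "z \<in> sphere 0 1"
      have "z = \<omega> * (z / \<omega>)" "z / \<omega> \<in> sphere 0 1" using z \<omega> \<open>\<omega> \<noteq> 0\<close> by (simp_all add: norm_divide)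
      then show "z \<in> (*) \<omega> ` sphere 0 1" by blast
    qed (use \<omega> in \<open>auto simp: norm_mult\<close>)
  qed
  then have \<phi>: "cbij (\<Union>C) (sphere 0 1) \<phi>" unfolding \<phi>_def by (rule cbij_compose [OF \<phi>0(1)])
  show ?thesis
  proof (rule quarter_coordinates [OF c \<phi>])
    fix X s t
    assume q: "continuous_on P X" "continuous_on P s" "continuous_on P t"
    "\<And>p. p \<in> P \<Longrightarrow> 0 \<le> s p \<and> 0 \<le> t p \<and> (norm (X p))\<^sup>2 + (s p)\<^sup>2 + (t p)\<^sup>2 = 1"
    "\<And>p p'. p \<in> P \<Longrightarrow> p' \<in> P \<Longrightarrow> X p = X p' \<Longrightarrow> s p = s p' \<Longrightarrow> t p = t p' \<Longrightarrow> p = p'"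
    "\<And>z a b. 0 \<le> a \<Longrightarrow> 0 \<le> b \<Longrightarrow> (norm z)\<^sup>2 + a\<^sup>2 + b\<^sup>2 = 1 \<Longrightarrow> \<exists>p\<in>P. X p = z \<and> s p = a \<and> t p = b"
    "\<And>p. p \<in> P \<Longrightarrow> s p = 0 \<longleftrightarrow> p \<in> U True" "\<And>p. p \<in> P \<Longrightarrow> t p = 0 \<longleftrightarrow> p \<in> U False"
    and seg: "\<And>v w. closed_segment v w \<in> p_edges P - C \<Longrightarrow> X ` closed_segment v w = closed_segment (\<phi> v) (\<phi> w)"
  obtain \<psi> where \<psi>: "homeomorphic_map Yt S3 \<psi>"
    and \<psi>R: "\<And>p u. p \<in> P \<Longrightarrow> \<psi> (R (p, u)) $ 1 = Re (X p) \<and> \<psi> (R (p, u)) $ 2 = Im (X p) \<and>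
      \<psi> (R (p, u)) $ 3 = sg (kk True u) * s p \<and> \<psi> (R (p, u)) $ 4 = sg (kk False u) * t p"
    using model_homeomorphism [OF q] by blast
  have \<psi>S: "\<psi> (R (p, u)) \<in> sphere 0 1" if "p \<in> P" for p u
  proof -
    have "R (p, u) \<in> topspace Yt" using that top_Yt by blast
    then show ?thesis using homeomorphic_imp_surjective_map [OF \<psi>] by auto
  qed
  have im: "\<psi> ` K I = {x \<in> sphere 0 1. x $ (if b then 3 else 4) = 0 \<and> Complex (x $ 1) (x $ 2) \<in> X ` I}"
    if I: "I \<subseteq> U b" for I b
  proof (intro equalityI subsetI)
    have IP: "I \<subseteq> P" using I U_subset by blast
    {
      fix x assume "x \<in> \<psi> ` K I"
      then obtain p u where pu: "p \<in> I" "x = \<psi> (R (p, u))" unfolding K_def by auto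
      have pP: "p \<in> P" using pu(1) IP by blast
      have "p \<in> U b" using pu(1) I by blast
      then have "x $ (if b then 3 else 4) = 0"
        using \<psi>R [OF pP, of u] q(7,8) [OF pP] pu(2) by (cases b) simp_all
      moreover have "Complex (x $ 1) (x $ 2) = X p" using \<psi>R [OF pP, of u] pu(2) by simp
      ultimately show "x \<in> {x \<in> sphere 0 1. x $ (if b then 3 else 4) = 0 \<and> Complex (x $ 1) (x $ 2) \<in> X ` I}"
        using \<psi>S [OF pP] pu by auto
    next
      fix x :: "real^4" assume x: "x \<in> {x \<in> sphere 0 1. x $ (if b then 3 else 4) = 0 \<and> Complex (x $ 1) (x $ 2) \<in> X ` I}"
      then obtain p where p: "p \<in> I" "Complex (x $ 1) (x $ 2) = X p" by auto
      have pP: "p \<in> P" using p(1) IP by blast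
      have pU: "p \<in> U b" using p(1) I by blast
      obtain u where u: "kk True u = (if x $ 3 < 0 then 1 else 0)" "kk False u = (if x $ 4 < 0 then 1 else 0)"
        using kk_surj by blast
      have nX: "(norm (X p))\<^sup>2 = (x $ 1)\<^sup>2 + (x $ 2)\<^sup>2" unfolding p(2) [symmetric] by (simp add: cmod_power2)
      have "(norm (X p))\<^sup>2 + (x $ 3)\<^sup>2 + (x $ 4)\<^sup>2 = 1" using x sphere4 [of x] by (simp add: nX)
      then have eq: "(s p)\<^sup>2 + (t p)\<^sup>2 = (x $ 3)\<^sup>2 + (x $ 4)\<^sup>2" using q(4) [OF pP] by simp
      \<comment> \<open>One of the last two coordinates vanishes on \<open>U b\<close>; the equation
        of the sphere then fixes the absolute value of the other one, and \<open>u\<close> was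
        chosen to supply the signs.\<close>
      have "s p = \<bar>x $ 3\<bar> \<and> t p = \<bar>x $ 4\<bar>"
      proof (cases b)
        case True
        then have "s p = 0" "x $ 3 = 0" using q(7) [OF pP] pU x by auto
        then have "(t p)\<^sup>2 = \<bar>x $ 4\<bar>\<^sup>2" using eq by simp
        then show ?thesis using q(4) [OF pP] \<open>s p = 0\<close> \<open>x $ 3 = 0\<close> by (metis abs_ge_zero abs_zero power2_eq_iff_nonneg)
      next
        case False
        then have "t p = 0" "x $ 4 = 0" using q(8) [OF pP] pU x by auto
        then have "(s p)\<^sup>2 = \<bar>x $ 3\<bar>\<^sup>2" using eq by simp
        then show ?thesis using q(4) [OF pP] \<open>t p = 0\<close> \<open>x $ 4 = 0\<close> by (metis abs_ge_zero abs_zero power2_eq_iff_nonneg)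
      qed
      then have "\<psi> (R (p, u)) = x"
        using \<psi>R [OF pP, of u] by (simp add: vec_eq_iff forall_4 p(2) [symmetric] u sg_def)
      then show "x \<in> \<psi> ` K I" unfolding K_def using p(1) by force
    }
  qed
  show ?thesis
  proof (intro exI [of _ \<phi>] exI [of _ \<psi>] conjI allI impI)
    show "homeomorphic_map Yt S3 \<psi>" by (rule \<psi>)
    fix v w b assume vw: "closed_segment v w \<in> p_edges P - C" "closed_segment v w \<subseteq> U b"
    show "\<psi> ` K (closed_segment v w) = {x \<in> sphere 0 1. x $ (if b then 3 else 4) = 0 \<and>
        Complex (x $ 1) (x $ 2) \<in> closed_segment (\<phi> v) (\<phi> w)}"
      unfolding im [OF vw(2)] seg [OF vw(1)] by simp
  qed (simp_all add: \<phi>_def \<phi>0)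
  qed
qed

text \<open>All copies of the edge share the point over an end: a vertex lies in both regions, so
  there both coordinates are forgotten.\<close>

lemma K_connected:
  assumes "I \<in> p_edges P - C"
  shows "connectedin Yt (K I)"
proof -
  have Ie: "I \<in> p_edges P" using assms by blast
  have IP: "I \<subseteq> P" by (rule edgeD(5) [OF Ie])
  obtain v where v: "v \<in> p_vertices P" "v \<in> I" using face_has_vertex [OF edgeD(1,3) [OF Ie]] .
  have vU: "v \<in> U b" for b using vertex_in_UC [OF v(1)] C_subset_U by blast
  have "K I = (\<Union>u. R ` (I \<times> {u}))" unfolding K_def by auto
  moreover have "connectedin Yt (\<Union>u. R ` (I \<times> {u}))"
  proof (rule connectedin_Union)
    show "connectedin Yt S" if S: "S \<in> range (\<lambda>u. R ` (I \<times> {u}))" for S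
    proof -
      obtain u where u: "S = R ` (I \<times> {u})" using S by blast
      have "continuous_map (top_of_set P) PU (\<lambda>p. (p, u))"
        by (intro continuous_map_pairedI) auto
      then have "continuous_map (top_of_set P) Yt (R \<circ> (\<lambda>p. (p, u)))"
        using quotient_imp_continuous_map [OF Rquot] by (rule continuous_map_compose)
      moreover have "connectedin (top_of_set P) I"
        using convex_connected [OF edgeD(6) [OF Ie]] IP by (simp add: connectedin_subtopology)
      ultimately have "connectedin Yt ((R \<circ> (\<lambda>p. (p, u))) ` I)" by (rule connectedin_continuous_map_image)
      moreover have "(R \<circ> (\<lambda>p. (p, u))) ` I = S" unfolding u by auto
      ultimately show ?thesis by simp
    qed
    have "R (v, 0) \<in> R ` (I \<times> {u})" for u
    proof -
      have "R (v, 0) = R (v, u)" using R_split [of v v 0 u] vU IP v(2) by auto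
      then show ?thesis using v(2) by auto
    qed
    then show "\<Inter> (range (\<lambda>u. R ` (I \<times> {u}))) \<noteq> {}" by blast
  qed
  ultimately show ?thesis by simp
qed

lemma K_disjoint:
  assumes "I \<in> p_edges P - C" "J \<in> p_edges P - C" "I \<noteq> J"
  shows "K I \<inter> K J = {}"
proof -
  have "I \<inter> J = {}" by (rule chords_disjoint [OF assms])
  moreover have "I \<subseteq> P" "J \<subseteq> P" using assms edgeD(5) by blast+
  ultimately show ?thesis unfolding K_def using R_split by (auto simp: disjoint_iff) (metis subsetD)
qed

lemma K_nonempty: "I \<in> p_edges P \<Longrightarrow> K I \<noteq> {}"
  using edgeD(3) by (auto simp: K_def)

lemma K_inj: "inj_on K (p_edges P - C)"
proof (rule inj_onI, rule ccontr)
  fix I J assume "I \<in> p_edges P - C" "J \<in> p_edges P - C" "K I = K J" "I \<noteq> J"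
  then have "K I = {}" using K_disjoint by blast
  then show False using K_nonempty \<open>I \<in> p_edges P - C\<close> by blast
qed

text \<open>A point over \<open>p\<close> is fixed if and only if \<open>g\<close> is a sum of
  labels of facets at \<open>p\<close>. On edges outside \<open>C\<close> the two labels have this
  sum.\<close>

lemma fixed_points:
  "r ` {x \<in> topspace Xt. sc_act P q g x = x} = \<Union>(K ` (p_edges P - C))"
proof -
  have fx: "sc_act P q g (q (p, u)) = q (p, u) \<longleftrightarrow> p \<in> \<Union>(p_edges P - C)" if p: "p \<in> P" for p u
  proof -
    have "sc_act P q g (q (p, u)) = q (p, u) \<longleftrightarrow> g \<in> spn p"
      unfolding act [OF p] q_eq [OF p p] by (simp add: add.commute [of u g] add.assoc)
    also have "\<dots> \<longleftrightarrow> p \<in> \<Union>(p_edges P - C)"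
    proof
      assume "g \<in> spn p"
      then obtain T where T: "T \<subseteq> {F \<in> p_facets P. p \<in> F}" "g = (\<Sum>F\<in>T. lam F)" by (auto simp: spn_def)
      have fin: "finite T" using finite_subset [OF T(1)] finite_facets by simp
      have "T \<noteq> {}" using T(2) g0 by auto
      then obtain F where F: "F \<in> T" by blast
      then have Fp: "F \<in> p_facets P" "p \<in> F" using T(1) by blast+
      obtain b where b: "kk b (lam F) = 1" using kk_lam [OF Fp(1), of True] by (cases "kk True (lam F)") auto
      \<comment> \<open>Parity: \<open>kk b\<close> vanishes on \<open>g\<close>, so the summands of
        colour \<open>b\<close> cannot consist of \<open>F\<close> alone. Two facets of one colour
        at \<open>p\<close> then meet in an edge outside \<open>C\<close>.\<close>
      have "\<exists>F'\<in>T - {F}. kk b (lam F') = 1"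
      proof (rule ccontr)
        assume "\<not> (\<exists>F'\<in>T - {F}. kk b (lam F') = 1)"
        then have "kk b (lam F') = 0" if "F' \<in> T - {F}" for F' using that by auto
        then have "(\<Sum>F'\<in>T. kk b (lam F')) = kk b (lam F)"
          using fin F by (simp add: sum.remove)
        then have "kk b g = 1" unfolding T(2) kk_sum [OF fin] using b by simp
        then show False using kk_g by simp
      qed
      then obtain F' where F': "F' \<in> T" "F' \<noteq> F" "kk b (lam F') = 1" by blast
      then have Fp': "F' \<in> p_facets P" "p \<in> F'" using T(1) by blast+
      have ne: "F \<inter> F' \<noteq> {}" using Fp(2) Fp'(2) by blast
      have "kk True (lam F) = 1 \<longleftrightarrow> kk True (lam F') = 1"
        using b F'(3) kk_lam [OF Fp(1), of True] kk_lam [OF Fp'(1), of True] by (cases b) auto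
      then have "F \<inter> F' \<notin> C" using edge_in_C_iff [OF Fp(1) Fp'(1) F'(2) [symmetric] ne] by simp
      moreover have "F \<inter> F' \<in> p_edges P" by (rule facet_Int_edge [OF Fp(1) Fp'(1) F'(2) [symmetric] ne])
      ultimately show "p \<in> \<Union>(p_edges P - C)" using Fp(2) Fp'(2) by blast
    next
      assume "p \<in> \<Union>(p_edges P - C)"
      then obtain I where I: "I \<in> p_edges P" "I \<notin> C" "p \<in> I" by blast
      obtain F F' where F: "F \<noteq> F'" "F \<in> p_facets P" "F' \<in> p_facets P" "I = F \<inter> F'"
        using edge_facets [OF I(1)] by metis
      have ne: "F \<inter> F' \<noteq> {}" using I(3) F(4) by blast
      have "lam F + lam F' = g"
        using edge_label_sum(1) [OF F(2,3,1) ne] I(1,2) F(4) C_edge_label by auto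
      moreover have "lam F \<in> spn p" "lam F' \<in> spn p" using spn_lam F(2,3,4) I(3) by auto
      ultimately show "g \<in> spn p" using spn_add [OF p] by metis
    qed
    finally show ?thesis .
  qed
  have edgesP: "\<Union>(p_edges P - C) \<subseteq> P" using edgeD(5) by blast
  show ?thesis
  proof (intro equalityI subsetI)
    fix y assume "y \<in> r ` {x \<in> topspace Xt. sc_act P q g x = x}"
    then obtain p u where pu: "p \<in> P" "sc_act P q g (q (p, u)) = q (p, u)" "y = R (p, u)"
      unfolding top_Xt R_def by auto
    then have "p \<in> \<Union>(p_edges P - C)" using fx by blast
    then show "y \<in> \<Union>(K ` (p_edges P - C))" using pu(3) unfolding K_def by auto
  next
    fix y assume "y \<in> \<Union>(K ` (p_edges P - C))"
    then obtain I p u where I: "I \<in> p_edges P - C" "p \<in> I" "y = R (p, u)" unfolding K_def by auto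
    then have "p \<in> \<Union>(p_edges P - C)" by blast
    then have pP: "p \<in> P" "sc_act P q g (q (p, u)) = q (p, u)" using edgesP fx by blast+
    then show "y \<in> r ` {x \<in> topspace Xt. sc_act P q g x = x}"
      using q_in I(3) by (auto simp: R_def)
  qed
qed

end

section \<open>Linking of great circles and chords\<close>

definition swap4 :: "4 \<Rightarrow> 4 \<Rightarrow> real^4 \<Rightarrow> real^4" where
  "swap4 a b x = (\<chi> l. x $ (if l = a then b else if l = b then a else l))"

lemma swap4_homeomorphic_map: "homeomorphic_map S3 S3 (swap4 a b)"
proof -
  define \<sigma> where "\<sigma> = (\<lambda>l. if l = a then b else if l = b then a else l)"
  have \<sigma>\<sigma>: "\<sigma> (\<sigma> l) = l" for l by (simp add: \<sigma>_def)
  then have bij: "bij \<sigma>" by (rule involuntory_imp_bij)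
  have sw: "swap4 a b x = (\<chi> l. x $ \<sigma> l)" for x by (simp add: swap4_def \<sigma>_def)
  have n: "norm (swap4 a b x) = norm x" for x
  proof -
    have "(\<Sum>l\<in>UNIV. x $ \<sigma> l * x $ \<sigma> l) = (\<Sum>l\<in>UNIV. x $ l * x $ l)"
      by (rule sum.reindex_bij_betw [OF bij])
    then show ?thesis by (simp add: norm_eq_sqrt_inner inner_vec_def sw)
  qed
  have c: "continuous_on (sphere 0 1) (swap4 a b)"
    unfolding swap4_def by (intro continuous_intros)
  have "homeomorphic_maps S3 S3 (swap4 a b) (swap4 a b)"
    unfolding homeomorphic_maps_def
    using c n by (auto simp: continuous_map_in_subtopology sw \<sigma>\<sigma>)
  then show ?thesis by (rule homeomorphic_maps_map [THEN iffD1, THEN conjunct1])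
qed

text \<open>The standard unknot is prescribed as the great circle in the first two coordinates; a
  transposition of coordinates moves the given great circle there.\<close>

lemma trivial_knot_great_circle:
  assumes \<psi>: "homeomorphic_map Y S3 \<psi>" and a: "a = 3 \<or> a = 4"
    and K: "\<psi> ` K = {x \<in> sphere 0 1. x $ a = 0 \<and> x $ 2 = 0}"
  shows "trivial_knot Y K"
proof -
  define b :: 4 where "b = (if a = 3 then 4 else 3)"
  have ab: "a = 3 \<and> b = 4 \<or> a = 4 \<and> b = 3" using a by (auto simp: b_def)
  have "homeomorphic_map Y S3 (swap4 2 b \<circ> \<psi>)"
    using \<psi> swap4_homeomorphic_map by (rule homeomorphic_map_compose)
  moreover have "(swap4 2 b \<circ> \<psi>) ` K = {x \<in> sphere 0 1. x $ 3 = 0 \<and> x $ 4 = 0}"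
  proof -
    have inv: "swap4 2 b (swap4 2 b x) = x" for x by (simp add: swap4_def vec_eq_iff)
    have coords: "swap4 2 b x $ a = x $ a" "swap4 2 b x $ 2 = x $ b" "swap4 2 b x $ b = x $ 2" for x
      using ab by (auto simp: swap4_def)
    have S: "swap4 2 b x \<in> sphere 0 1" if "x \<in> sphere 0 1" for x
      using homeomorphic_imp_surjective_map [OF swap4_homeomorphic_map [of 2 b]] that by auto
    have e: "{x \<in> sphere 0 1. x $ 3 = 0 \<and> x $ 4 = 0} = {x :: real^4. x \<in> sphere 0 1 \<and> x $ a = 0 \<and> x $ b = 0}"
      using ab by auto
    have "swap4 2 b ` {x \<in> sphere 0 1. x $ a = 0 \<and> x $ 2 = 0} = {x :: real^4. x \<in> sphere 0 1 \<and> x $ a = 0 \<and> x $ b = 0}"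
    proof (intro equalityI subsetI)
      fix x :: "real^4" assume x: "x \<in> {x. x \<in> sphere 0 1 \<and> x $ a = 0 \<and> x $ b = 0}"
      then have "swap4 2 b x \<in> {x \<in> sphere 0 1. x $ a = 0 \<and> x $ 2 = 0}" using S [of x] coords by simp
      then have "swap4 2 b (swap4 2 b x) \<in> swap4 2 b ` {x \<in> sphere 0 1. x $ a = 0 \<and> x $ 2 = 0}" by (rule imageI)
      then show "x \<in> swap4 2 b ` {x \<in> sphere 0 1. x $ a = 0 \<and> x $ 2 = 0}" by (simp only: inv)
    next
      fix y assume "y \<in> swap4 2 b ` {x \<in> sphere 0 1. x $ a = 0 \<and> x $ 2 = 0}"
      then obtain x where x: "y = swap4 2 b x" "x \<in> sphere 0 1" "x $ a = 0" "x $ 2 = 0" by blast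
      then show "y \<in> {x. x \<in> sphere 0 1 \<and> x $ a = 0 \<and> x $ b = 0}" using S [of x] coords [of x] by simp
    qed
    then show ?thesis unfolding e image_comp [symmetric] K .
  qed
  ultimately show ?thesis unfolding trivial_knot_def by blast
qed

lemma split_link_separated:
  assumes \<psi>: "homeomorphic_map Y S3 \<psi>"
    and K: "\<psi> ` K1 \<subseteq> {x. x $ 2 > 0}" "\<psi> ` K2 \<subseteq> {x. x $ 2 < 0}"
  shows "split_link Y K1 K2"
proof -
  have "homeomorphic_map Y S3 (swap4 2 4 \<circ> \<psi>)"
    using \<psi> swap4_homeomorphic_map by (rule homeomorphic_map_compose)
  moreover have "swap4 2 4 x $ 4 = x $ 2" for x by (simp add: swap4_def)
  then have "(swap4 2 4 \<circ> \<psi>) ` K1 \<subseteq> {x. x $ 4 > 0}" "(swap4 2 4 \<circ> \<psi>) ` K2 \<subseteq> {x. x $ 4 < 0}"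
    using K by auto
  ultimately show ?thesis unfolding split_link_def by blast
qed

text \<open>Two complementary great circles: the second one is essential in the complement of the first,
  whereas a curve in an open hemisphere missing the first would be null-homotopic there.\<close>

lemma hopf_link_not_split:
  assumes \<psi>: "homeomorphic_map Y S3 \<psi>" and K12: "K1 \<subseteq> topspace Y" "K2 \<subseteq> topspace Y"
    and K1: "\<psi> ` K1 = {x \<in> sphere 0 1. x $ i = 0 \<and> x $ 2 = 0}"
    and K2: "\<psi> ` K2 = {x \<in> sphere 0 1. x $ j = 0 \<and> x $ 1 = 0}"
    and ij: "i = 3 \<and> j = 4 \<or> i = 4 \<and> j = 3"
  shows "\<not> split_link Y K1 K2"
proof
  assume "split_link Y K1 K2"
  then obtain h where h: "homeomorphic_map Y S3 h" "h ` K1 \<subseteq> {x. x $ 4 > 0}" "h ` K2 \<subseteq> {x. x $ 4 < 0}"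
    unfolding split_link_def by blast
  obtain \<psi>' where \<psi>': "homeomorphic_maps Y S3 \<psi> \<psi>'" using \<psi> homeomorphic_map_maps by blast
  obtain h' where h': "homeomorphic_maps Y S3 h h'" using h(1) homeomorphic_map_maps by blast
  have inv: "\<And>y. y \<in> topspace Y \<Longrightarrow> \<psi>' (\<psi> y) = y" "\<And>y. y \<in> topspace Y \<Longrightarrow> h' (h y) = y"
    "\<And>x. x \<in> sphere 0 1 \<Longrightarrow> \<psi> (\<psi>' x) = x" "\<And>x. x \<in> sphere 0 1 \<Longrightarrow> h (h' x) = x"
    and cm: "continuous_map S3 Y \<psi>'" "continuous_map S3 Y h'" "continuous_map Y S3 \<psi>" "continuous_map Y S3 h"
    using \<psi>' h' by (auto simp: homeomorphic_maps_def)
  have cont1: "continuous_on (sphere 0 1) (h \<circ> \<psi>')" "continuous_on (sphere 0 1) (\<psi> \<circ> h')"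
    using continuous_map_compose [OF cm(1,4)] continuous_map_compose [OF cm(2,3)]
    by (simp_all add: continuous_map_in_subtopology del: comp_apply)
  have into: "h' x \<in> topspace Y" "(\<psi> \<circ> h') x \<in> sphere 0 1" if "x \<in> sphere 0 1" for x
  proof -
    show "h' x \<in> topspace Y" using cm(2) that by (auto simp: continuous_map_def)
    then show "(\<psi> \<circ> h') x \<in> sphere 0 1" using cm(3) by (auto simp: continuous_map_def)
  qed
  \<comment> \<open>The second great circle, parametrised by its coordinates 2 and \<open>i\<close>;
    these are precisely the coordinates that vanish on the first circle.\<close>
  define e :: "complex \<Rightarrow> real^4" where "e = (\<lambda>z. \<chi> l. if l = 2 then Re z else if l = i then Im z else 0)"
  have e: "e z $ 1 = 0" "e z $ 2 = Re z" "e z $ i = Im z" "e z $ j = 0" for z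
    using ij by (auto simp: e_def)
  have eS: "e z \<in> sphere 0 1" if "z \<in> sphere 0 1" for z
    unfolding sphere4 using that ij e [of z] by (auto simp: cmod_def)
  have ce: "continuous_on (sphere 0 1) e"
    unfolding e_def
  proof (rule continuous_on_vec_lambda)
    fix l show "continuous_on (sphere 0 1) (\<lambda>z. if l = 2 then Re z else if l = i then Im z else 0)"
      by (cases "l = 2"; cases "l = i") (auto intro!: continuous_intros)
  qed
  define J where "J = (h \<circ> \<psi>') \<circ> e"
  have cJ: "continuous_on (sphere 0 1) J"
    unfolding J_def using ce cont1(1) eS by (intro continuous_on_compose) (auto intro: continuous_on_subset)
  have Jz: "J z $ 4 < 0" "J z \<in> sphere 0 1" "(\<psi> \<circ> h') (J z) = e z" if z: "z \<in> sphere 0 1" for z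
  proof -
    have "e z \<in> \<psi> ` K2" unfolding K2 using eS [OF z] e by simp
    then obtain k where k: "k \<in> K2" "e z = \<psi> k" by blast
    then have \<psi>'e: "\<psi>' (e z) = k" using inv(1) K12 by auto
    then show "J z $ 4 < 0" using h(3) k by (auto simp: J_def)
    have "h k \<in> sphere 0 1" using cm(4) k(1) K12 by (auto simp: continuous_map_def)
    then show "J z \<in> sphere 0 1" using \<psi>'e by (simp add: J_def)
    show "(\<psi> \<circ> h') (J z) = e z" using \<psi>'e inv(2) [of k] k K12 by (auto simp: J_def)
  qed
  define H where "H = {y :: real^4. y $ 4 < 0}"
  \<comment> \<open>The open half-space is pushed radially onto the open hemisphere and then taken
    over to the model \<open>\<psi>\<close>. The half-space is preferred to the hemisphere because
    it is convex.\<close>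
  define m where "m = (\<lambda>y :: real^4. (\<psi> \<circ> h') (y /\<^sub>R norm y))"
  \<comment> \<open>On the model sphere these two coordinates vanish together only on the first
    circle, which \<open>h\<close> keeps in the other hemisphere. So \<open>f\<close> has no zero
    and maps to the circle after normalisation.\<close>
  define f where "f = (\<lambda>y. Complex (m y $ 2) (m y $ i))"
  have Hne: "y \<noteq> 0" if "y \<in> H" for y using that by (auto simp: H_def)
  have yS: "y /\<^sub>R norm y \<in> sphere 0 1" if "y \<in> H" for y using Hne [OF that] by simp
  have cm': "continuous_on H m"
    unfolding m_def
    by (rule continuous_on_compose2 [OF cont1(2)]) (use Hne yS in \<open>auto intro!: continuous_intros\<close>)
  have f0: "f y \<noteq> 0" if y: "y \<in> H" for y
  proof
    assume "f y = 0"
    then have "m y $ 2 = 0" "m y $ i = 0" by (auto simp: f_def complex_eq_iff)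
    moreover have "m y \<in> sphere 0 1" unfolding m_def by (rule into(2) [OF yS [OF y]])
    ultimately have "m y \<in> \<psi> ` K1" unfolding K1 by simp
    then obtain k where k: "k \<in> K1" "\<psi> (h' (y /\<^sub>R norm y)) = \<psi> k" by (auto simp: m_def)
    have "h' (y /\<^sub>R norm y) = k"
      using k K12(1) inv(1) into(1) [OF yS [OF y]] by (metis subsetD)
    then have "y /\<^sub>R norm y = h k" using inv(4) [OF yS [OF y]] by simp
    then have "(y /\<^sub>R norm y) $ 4 > 0" using h(2) k(1) by auto
    moreover have "(y /\<^sub>R norm y) $ 4 < 0" using y Hne [OF y] by (simp add: H_def mult_less_0_iff)
    ultimately show False by simp
  qed
  define F where "F = (\<lambda>y. f y /\<^sub>R norm (f y))"
  have cf: "continuous_on H f"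
    unfolding f_def Complex_eq by (intro continuous_intros cm')
  have cF: "continuous_on H F"
    unfolding F_def by (intro continuous_intros cf) (use f0 in auto)
  have FS: "F \<in> H \<rightarrow> sphere 0 1" using f0 by (auto simp: F_def)
  have "convex H" unfolding H_def
  proof -
    have "{y :: real^4. y $ 4 < 0} = {y. axis 4 1 \<bullet> y < 0}" by (simp add: inner_axis')
    then show "convex {y :: real^4. y $ 4 < 0}" by (simp only: convex_halfspace_lt)
  qed
  then have "contractible H" by (rule convex_imp_contractible)
  then obtain c where c: "homotopic_with_canon (\<lambda>h. True) H (sphere 0 1) F (\<lambda>x. c)"
    using nullhomotopic_from_contractible [OF cF FS] by blast
  have JH: "J \<in> sphere 0 1 \<rightarrow> H" using Jz(1) by (auto simp: H_def)
  have hom: "homotopic_with_canon (\<lambda>h. True) (sphere 0 1) (sphere 0 1) (F \<circ> J) ((\<lambda>x. c) \<circ> J)"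
    using homotopic_with_compose_continuous_right [OF c cJ JH] .
  \<comment> \<open>Along the second circle \<open>F\<close> inverts the parametrisation, so the
    identity of the circle would factor through a contractible set.\<close>
  have FJ: "(F \<circ> J) z = z" if z: "z \<in> sphere 0 1" for z
  proof -
    have "J z /\<^sub>R norm (J z) = J z" using Jz(2) [OF z] by simp
    then have "m (J z) = e z" using Jz(3) [OF z] by (simp add: m_def)
    then have "f (J z) = z" by (simp add: f_def e)
    then show ?thesis using z by (simp add: F_def)
  qed
  have "homotopic_with_canon (\<lambda>h. True) (sphere (0::complex) 1) (sphere 0 1) id (\<lambda>x. c)"
    by (rule homotopic_with_eq [OF hom]) (use FJ in simp_all)
  then have "contractible (sphere (0::complex) 1)" unfolding contractible_def by blast
  then show False by (simp add: contractible_sphere)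
qed

lemma segment_real: "z \<in> closed_segment 1 (-1) \<longleftrightarrow> Im z = 0 \<and> \<bar>Re z\<bar> \<le> 1"
proof
  assume "z \<in> closed_segment 1 (-1)"
  then show "Im z = 0 \<and> \<bar>Re z\<bar> \<le> 1" by (auto simp: in_segment)
next
  assume z: "Im z = 0 \<and> \<bar>Re z\<bar> \<le> 1"
  then show "z \<in> closed_segment 1 (-1)"
    unfolding in_segment by (intro exI [of _ "(1 - Re z) / 2"]) (auto simp: complex_eq_iff field_simps)
qed

lemma segment_imaginary: "z \<in> closed_segment \<i> (-\<i>) \<longleftrightarrow> Re z = 0 \<and> \<bar>Im z\<bar> \<le> 1"
proof
  assume "z \<in> closed_segment \<i> (-\<i>)"
  then show "Re z = 0 \<and> \<bar>Im z\<bar> \<le> 1" by (auto simp: in_segment)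
next
  assume z: "Re z = 0 \<and> \<bar>Im z\<bar> \<le> 1"
  then show "z \<in> closed_segment \<i> (-\<i>)"
    unfolding in_segment by (intro exI [of _ "(1 - Im z) / 2"]) (auto simp: complex_eq_iff field_simps)
qed

lemma sphere4_coord_le: "x \<in> sphere (0 :: real^4) 1 \<Longrightarrow> \<bar>x $ l\<bar> \<le> 1"
  using component_le_norm_cart [of x l] by simp

section \<open>Chords of the diagram and the linking of their knots\<close>

context branched_split
begin

lemma K_subset: "I \<in> p_edges P \<Longrightarrow> K I \<subseteq> topspace Yt"
  unfolding K_def top_Yt using edgeD(5) by blast

lemma linked_if_interleaved:
  assumes cyc: "cyclic_order P C W n" and ord: "i < j" "j < i'" "i' < j'" "j' < i + n"
    and I: "closed_segment (W i) (W i') \<in> p_edges P - C" and J: "closed_segment (W j) (W j') \<in> p_edges P - C"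
    and ne: "closed_segment (W i) (W i') \<noteq> closed_segment (W j) (W j')"
  shows "\<not> split_link Yt (K (closed_segment (W i) (W i'))) (K (closed_segment (W j) (W j')))"
proof -
  let ?I = "closed_segment (W i) (W i')" and ?J = "closed_segment (W j) (W j')"
  obtain \<phi> \<psi> where \<psi>: "homeomorphic_map Yt S3 \<psi>"
    and \<phi>: "\<phi> (W i) = 1" "\<phi> (W j) = 1 * \<i>" "\<phi> (W i') = - 1" "\<phi> (W j') = - (1 * \<i>)"
    and im: "\<forall>v w b. closed_segment v w \<in> p_edges P - C \<longrightarrow> closed_segment v w \<subseteq> U b \<longrightarrow>
      \<psi> ` K (closed_segment v w) = {x \<in> sphere 0 1. x $ (if b then 3 else 4) = 0 \<and>
        Complex (x $ 1) (x $ 2) \<in> closed_segment (\<phi> v) (\<phi> w)}"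
    using normal_form [OF cyc ord norm_one] by (elim exE conjE)
  obtain b where b: "?I \<subseteq> U b" using I by (rule chord_class)
  obtain b' where b': "?J \<subseteq> U b'" using J by (rule chord_class)
  have KI: "\<psi> ` K ?I = {x \<in> sphere 0 1. x $ (if b then 3 else 4) = 0 \<and> x $ 2 = 0}"
    unfolding im [rule_format, OF I b] \<phi> by (auto simp: segment_real sphere4_coord_le)
  have KJ: "\<psi> ` K ?J = {x \<in> sphere 0 1. x $ (if b' then 3 else 4) = 0 \<and> x $ 1 = 0}"
    unfolding im [rule_format, OF J b'] \<phi> by (auto simp: segment_imaginary sphere4_coord_le)
  have sub: "K ?I \<subseteq> topspace Yt" "K ?J \<subseteq> topspace Yt" using K_subset I J by blast+
  have "b \<noteq> b'"
  proof
    assume "b = b'"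
    \<comment> \<open>The colours have to differ: for equal colours both knots would pass through
      this point, which lies over the common midpoint of the two diameters.\<close>
    define x :: "real^4" where "x = axis (if b then 4 else 3) 1"
    have "x \<in> \<psi> ` K ?I \<inter> \<psi> ` K ?J"
      unfolding KI KJ \<open>b = b'\<close> [symmetric] by (cases b) (simp_all add: x_def axis_def norm_axis_1 [unfolded axis_def])
    then have "x \<in> \<psi> ` (K ?I \<inter> K ?J)"
      by (simp only: inj_on_image_Int [OF homeomorphic_imp_injective_map [OF \<psi>] sub])
    then show False by (simp only: K_disjoint [OF I J ne] image_empty empty_iff)
  qed
  then show ?thesis
    by (intro hopf_link_not_split [OF \<psi> sub KI KJ]) auto
qed

lemma split_if_separated:
  assumes cyc: "cyclic_order P C W n" and ord: "i < i'" "i' < j" "j < j'" "j' < i + n"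
    and I: "closed_segment (W i) (W i') \<in> p_edges P - C" and J: "closed_segment (W j) (W j') \<in> p_edges P - C"
  shows "split_link Yt (K (closed_segment (W i) (W i'))) (K (closed_segment (W j) (W j')))"
proof -
  \<comment> \<open>A rational unit vector in the open first quadrant. Both \<open>\<omega>\<close>
    and \<open>\<omega> * \<i>\<close> have positive imaginary part, so the first chord lies above
    the real axis and the opposite chord below.\<close>
  define \<omega> where "\<omega> = Complex (3/5) (4/5)"
  have n: "norm \<omega> = 1" by (simp add: \<omega>_def cmod_def power2_eq_square)
  obtain \<phi> \<psi> where \<psi>: "homeomorphic_map Yt S3 \<psi>"
    and \<phi>: "\<phi> (W i) = \<omega>" "\<phi> (W i') = \<omega> * \<i>" "\<phi> (W j) = - \<omega>" "\<phi> (W j') = - (\<omega> * \<i>)"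
    and im: "\<forall>v w b. closed_segment v w \<in> p_edges P - C \<longrightarrow> closed_segment v w \<subseteq> U b \<longrightarrow>
      \<psi> ` K (closed_segment v w) = {x \<in> sphere 0 1. x $ (if b then 3 else 4) = 0 \<and>
        Complex (x $ 1) (x $ 2) \<in> closed_segment (\<phi> v) (\<phi> w)}"
    using normal_form [OF cyc ord n] by (elim exE conjE)
  obtain b where b: "closed_segment (W i) (W i') \<subseteq> U b" using I by (rule chord_class)
  obtain b' where b': "closed_segment (W j) (W j') \<subseteq> U b'" using J by (rule chord_class)
  have cv: "convex {z. Im z > 0}" "convex {z. Im z < 0}"
    by (simp_all add: convex_halfspace_Im_gt convex_halfspace_Im_lt)
  have "closed_segment \<omega> (\<omega> * \<i>) \<subseteq> {z. Im z > 0}"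
    by (rule closed_segment_subset [OF _ _ cv(1)]) (simp_all add: \<omega>_def)
  then have 1: "\<psi> ` K (closed_segment (W i) (W i')) \<subseteq> {x. x $ 2 > 0}"
    unfolding im [rule_format, OF I b] \<phi> by (auto dest: subsetD)
  have "closed_segment (- \<omega>) (- (\<omega> * \<i>)) \<subseteq> {z. Im z < 0}"
    by (rule closed_segment_subset [OF _ _ cv(2)]) (simp_all add: \<omega>_def)
  then have 2: "\<psi> ` K (closed_segment (W j) (W j')) \<subseteq> {x. x $ 2 < 0}"
    unfolding im [rule_format, OF J b'] \<phi> by (auto dest: subsetD)
  show ?thesis by (rule split_link_separated [OF \<psi> 1 2])
qed

lemma chord_indices:
  assumes w: "inj_on w {..<n :: nat}" "w ` {..<n} = p_vertices P" and I: "I \<in> p_edges P"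
  obtains i i' where "i < i'" "i' < n" "I = closed_segment (w i) (w i')" "I \<inter> p_vertices P = {w i, w i'}"
proof -
  obtain v v' where v: "v \<in> p_vertices P" "v' \<in> p_vertices P" "v \<noteq> v'" "I = closed_segment v v'" "I \<inter> p_vertices P = {v, v'}"
    using I by (rule edge_segment)
  have "v \<in> w ` {..<n}" "v' \<in> w ` {..<n}" unfolding w(2) by (fact v)+
  then obtain a a' where a: "a < n" "v = w a" "a' < n" "v' = w a'" by blast
  have "a \<noteq> a'" using v(3) unfolding a(2,4) by blast
  then consider "a < a'" | "a' < a" by (rule linorder_neqE_nat)
  then show thesis
  proof cases
    case 1
    show thesis
      by (rule that [OF 1 a(3) v(4) [unfolded a(2,4)] v(5) [unfolded a(2,4)]])
  next
    case 2
    have "I = closed_segment (w a') (w a)"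
      unfolding v(4) a(2,4) by (rule closed_segment_commute)
    moreover have "I \<inter> p_vertices P = {w a', w a}"
      unfolding v(5) a(2,4) by (rule insert_commute)
    ultimately show thesis by (rule that [OF 2 a(1)])
  qed
qed

text \<open>The normal form wants four marks while a chord has two ends. The successors of the ends
  fill the gaps; they are different from the ends because a chord is not an edge of
  \<open>C\<close>.\<close>

lemma chords_trivial:
  assumes I: "I \<in> p_edges P - C"
  shows "trivial_knot Yt (K I)"
proof -
  define n where "n = card (p_vertices P)"
  have "\<exists>w. inj_on w {..<n} \<and> w ` {..<n} = p_vertices P \<and> (\<forall>k. Suc k < n \<longrightarrow> w (Suc k) \<in> nbrs (w k))"
    unfolding n_def by (rule spanning_path_exists [OF C_connected], intro exI conjI allI impI) assumption+
  then obtain w where w: "inj_on w {..<n}" "w ` {..<n} = p_vertices P" and nb: "\<forall>k. Suc k < n \<longrightarrow> w (Suc k) \<in> nbrs (w k)"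
    by (elim exE conjE)
  define W where "W = (\<lambda>k. w (k mod n))"
  have cyc: "cyclic_order P C W n" unfolding W_def using w nb [rule_format] by (rule cyclic_order_of_path)
  interpret cy: cyclic_order P C W n by (rule cyc)
  have Ie: "I \<in> p_edges P" using I by blast
  obtain i i' where i: "i < i'" "i' < n" "I = closed_segment (w i) (w i')" by (rule chord_indices [OF w(1,2) Ie])
  have IW: "I = closed_segment (W i) (W i')" using i by (simp add: W_def)
  have "Suc i \<noteq> i'"
  proof
    assume "Suc i = i'"
    then have "I = cy.seg i" using IW by simp
    then show False using cy.seg_C I by blast
  qed
  moreover have "Suc i' \<noteq> i + n"
  proof
    assume "Suc i' = i + n"
    then have "cy.seg i' = closed_segment (W i') (W i)" by simp
    then have "I = cy.seg i'" using IW by (simp add: closed_segment_commute)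
    then show False using cy.seg_C I by blast
  qed
  ultimately have ord: "i < Suc i" "Suc i < i'" "i' < Suc i'" "Suc i' < i + n" using i by linarith+
  obtain \<phi> \<psi> where \<psi>: "homeomorphic_map Yt S3 \<psi>" and \<phi>: "\<phi> (W i) = 1" "\<phi> (W i') = - 1"
    and im: "\<forall>v w b. closed_segment v w \<in> p_edges P - C \<longrightarrow> closed_segment v w \<subseteq> U b \<longrightarrow>
      \<psi> ` K (closed_segment v w) = {x \<in> sphere 0 1. x $ (if b then 3 else 4) = 0 \<and>
        Complex (x $ 1) (x $ 2) \<in> closed_segment (\<phi> v) (\<phi> w)}"
    using normal_form [OF cyc ord norm_one] by (elim exE conjE)
  obtain b where b: "I \<subseteq> U b" using I by (rule chord_class)
  have "\<psi> ` K I = {x \<in> sphere 0 1. x $ (if b then 3 else 4) = 0 \<and> x $ 2 = 0}"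
    using im [rule_format, OF I [unfolded IW] b [unfolded IW]] unfolding IW [symmetric] \<phi>
    by (auto simp: segment_real sphere4_coord_le)
  then show ?thesis by (intro trivial_knot_great_circle [OF \<psi>, of "if b then 3 else 4"]) auto
qed

text \<open>The linear order of four different endpoints is compared with their cyclic order. Only
  the interleaved arrangements are linked, and each arrangement is brought to the order required by
  the geometric lemmas by adding \<open>n\<close> to the endpoints that are passed first.\<close>

lemma chords_linking:
  assumes num: "path_numbering P C num" and I: "I \<in> p_edges P - C" and J: "J \<in> p_edges P - C" and ne: "I \<noteq> J"
  shows "\<not> split_link Yt (K I) (K J) \<longleftrightarrow> chords_intersect P num I J"
proof -
  define n where "n = card (p_vertices P)"
  \<comment> \<open>The numbering starts at 1 and the periodic indexing at 0, hence the shift by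
    \<open>Suc\<close>.\<close>
  define w where "w = (\<lambda>k. inv_into (p_vertices P) num (Suc k))"
  have bij: "bij_betw num (p_vertices P) {1..n}" using num by (simp add: path_numbering_def n_def)
  have bw: "bij_betw w {..<n} (p_vertices P)"
  proof -
    have "bij_betw Suc {..<n} {1..n}" by (intro bij_betw_imageI) (auto simp: image_Suc_lessThan)
    then have "bij_betw (inv_into (p_vertices P) num \<circ> Suc) {..<n} (p_vertices P)"
      using bij_betw_inv_into [OF bij] by (rule bij_betw_trans)
    then show ?thesis by (simp add: w_def comp_def)
  qed
  then have w: "inj_on w {..<n}" "w ` {..<n} = p_vertices P" by (auto simp: bij_betw_def)
  have numw: "num (w k) = Suc k" if "k < n" for k
    unfolding w_def using that bij by (intro bij_betw_inv_into_right [OF bij]) auto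
  have adj: "w (Suc k) \<in> nbrs (w k)" if k: "Suc k < n" for k
  proof -
    have "closed_segment (w k) (w (Suc k)) \<in> C"
      using num [unfolded path_numbering_def, THEN conjunct2, rule_format, of "Suc k"] k by (simp add: w_def n_def)
    moreover have "w (Suc k) \<noteq> w k" using inj_onD [OF w(1), of "Suc k" k] k by auto
    moreover have "w (Suc k) \<in> p_vertices P" using w(2) k by blast
    ultimately show ?thesis by (simp add: nbrs_def)
  qed
  define W where "W = (\<lambda>k. w (k mod n))"
  have cyc: "cyclic_order P C W n" unfolding W_def using w adj by (rule cyclic_order_of_path)
  interpret cy: cyclic_order P C W n by (rule cyc)
  have Ie: "I \<in> p_edges P" "J \<in> p_edges P" using I J by blast+
  obtain i i' where i: "i < i'" "i' < n" "I = closed_segment (w i) (w i')" "I \<inter> p_vertices P = {w i, w i'}"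
    by (rule chord_indices [OF w Ie(1)])
  obtain j j' where j: "j < j'" "j' < n" "J = closed_segment (w j) (w j')" "J \<inter> p_vertices P = {w j, w j'}"
    by (rule chord_indices [OF w Ie(2)])
  have lohi: "chord_lo P num I = Suc i" "chord_hi P num I = Suc i'" "chord_lo P num J = Suc j" "chord_hi P num J = Suc j'"
    unfolding chord_lo_def chord_hi_def i(4) j(4) using i(1,2) j(1,2) by (simp_all add: numw)
  have ci: "chords_intersect P num I J \<longleftrightarrow> i < j \<and> j < i' \<and> i' < j' \<or> j < i \<and> i < j' \<and> j' < i'"
    unfolding chords_intersect_def lohi by simp
  have disj: "{w i, w i'} \<inter> {w j, w j'} = {}"
    unfolding i(4) [symmetric] j(4) [symmetric] using chords_disjoint [OF I J ne] by blast
  then have d: "i \<noteq> j" "i \<noteq> j'" "i' \<noteq> j" "i' \<noteq> j'" by auto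
  have Ws: "W i = w i" "W i' = w i'" "W j = w j" "W j' = w j'" using i(1,2) j(1,2) by (simp_all add: W_def)
  have IW: "I = closed_segment (W i) (W i')" "I = closed_segment (W i') (W i)"
    and JW: "J = closed_segment (W j) (W j')" "J = closed_segment (W j') (W j)"
    unfolding Ws i(3) j(3) by (rule refl closed_segment_commute)+
  have Iw: "closed_segment (W i) (W i') \<in> p_edges P - C" "closed_segment (W i') (W i) \<in> p_edges P - C"
    and Jw: "closed_segment (W j) (W j') \<in> p_edges P - C" "closed_segment (W j') (W j) \<in> p_edges P - C"
    by (simp_all only: IW [symmetric] JW [symmetric] I J)
  have Wn: "W (k + n) = W k" for k by (simp add: W_def)
  have bound: "i' < j + n" "j' < i + n" using i(2) j(2) by simp_all
  \<comment> \<open>The six possible orders: interleaved in two ways, one chord after the other in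
    two ways, nested in two ways. In the cyclic order nested chords are separated just as
    consecutive ones.\<close>
  consider "i < j" "j < i'" "i' < j'" | "j < i" "i < j'" "j' < i'" | "i' < j" | "j' < i"
    | "i < j" "j' < i'" | "j < i" "i' < j'"
    using d by linarith
  then show ?thesis
  proof cases
    case 1
    have "\<not> split_link Yt (K I) (K J)"
      by (rule linked_if_interleaved [OF cyc 1 bound(2), folded IW(1) JW(1), OF I J ne])
    then show ?thesis using ci 1 by simp
  next
    case 2
    have "j + n < i + n" using 2(1) by simp
    from linked_if_interleaved [OF cyc 2(2,3) bound(1) this, unfolded Wn, folded IW(1) JW(2), OF I J ne]
    show ?thesis using ci 2 by simp
  next
    case 3
    have "split_link Yt (K I) (K J)"
      by (rule split_if_separated [OF cyc i(1) 3 j(1) bound(2), folded IW(1) JW(1), OF I J])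
    then show ?thesis using ci 3 i(1) j(1) by auto
  next
    case 4
    have "j + n < j' + n" "j' + n < i + n" using 4 j(1) by simp_all
    from split_if_separated [OF cyc i(1) bound(1) this, unfolded Wn, folded IW(1) JW(1), OF I J]
    show ?thesis using ci 4 i(1) j(1) by auto
  next
    case 5
    \<comment> \<open>Reading the cycle from \<open>i'\<close> on, the ends of the outer chord come
      first and those of the inner chord afterwards, so the nesting disappears.\<close>
    have "i' < i + n" "i + n < j + n" "j + n < j' + n" "j' + n < i' + n" using 5 i(2) j(1) by simp_all
    from split_if_separated [OF cyc this, unfolded Wn, folded IW(2) JW(1), OF I J]
    show ?thesis using ci 5 i(1) j(1) by auto
  next
    case 6
    have "j + n < i + n" using 6 by simp
    from split_if_separated [OF cyc i(1) 6(2) _ this, unfolded Wn, folded IW(1) JW(2), OF _ I J] j(2)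
    show ?thesis using ci 6 i(1) j(1) by auto
  qed
qed

text \<open>Finitely many disjoint nonempty connected compact sets cover the link. Each of them and
  the union of the others are closed, so a component that contains one of them cannot reach any
  other.\<close>

lemma link_components:
  "connected_components_of (subtopology Yt (\<Union>(K ` (p_edges P - C)))) = K ` (p_edges P - C)"
proof -
  let ?D = "p_edges P - C"
  define Z where "Z = subtopology Yt (\<Union>(K ` ?D))"
  have top: "topspace Z = \<Union>(K ` ?D)" unfolding Z_def using K_subset by auto
  have Haus: "Hausdorff_space Yt"
    using sph homeomorphic_Hausdorff_space Hausdorff_space_subtopology Hausdorff_space_euclidean by blast
  have closed: "closedin Yt (K I)" if I: "I \<in> ?D" for I
  proof -
    have "compactin PU (I \<times> UNIV)"
      using edgeD(5,7) [of I] I by (auto simp: compactin_Times compactin_subtopology compactin_discrete_topology)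
    then have "compactin Yt (K I)"
      unfolding K_def using quotient_imp_continuous_map [OF Rquot] by (rule image_compactin)
    then show ?thesis using Haus compactin_imp_closedin by blast
  qed
  have clZ: "closedin Z (\<Union>(K ` D'))" if "D' \<subseteq> ?D" for D'
    unfolding Z_def
  proof (rule closedin_subset_topspace)
    show "closedin Yt (\<Union>(K ` D'))"
      using that closed finite_subset [OF that] finite_edges by (intro closedin_Union) auto
  qed (use that in auto)
  have comp: "K I \<in> connected_components_of Z" if I: "I \<in> ?D" for I
  proof -
    have con: "connectedin Z (K I)"
      unfolding Z_def using K_connected [OF I] I by (auto simp: connectedin_subtopology)
    have "K I \<noteq> {}" using K_nonempty I by blast
    then have "Z \<noteq> trivial_topology" using connectedin_subset_topspace [OF con] by auto
    then obtain A where A: "A \<in> connected_components_of Z" "K I \<subseteq> A"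
      using exists_connected_component_of_superset [OF con] by blast
    have conA: "connectedin Z A" using A(1) by (rule connectedin_connected_components_of)
    have "A \<subseteq> \<Union>(K ` ?D)" using connectedin_subset_topspace [OF conA] top by simp
    have c1: "closedin Z (K I)" using clZ [of "{I}"] I by simp
    have c2: "closedin Z (\<Union>(K ` (?D - {I})))" by (rule clZ) blast
    have dis: "K I \<inter> \<Union>(K ` (?D - {I})) = {}" using K_disjoint [OF I] by blast
    have cover: "A \<subseteq> K I \<union> \<Union>(K ` (?D - {I}))" using \<open>A \<subseteq> \<Union>(K ` ?D)\<close> by blast
    have no: "False" if "closedin Z E1" "closedin Z E2" "A \<subseteq> E1 \<union> E2" "E1 \<inter> E2 \<inter> A = {}" "E1 \<inter> A \<noteq> {}" "E2 \<inter> A \<noteq> {}"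
      for E1 E2
    proof -
      have "\<not> (\<exists>E1 E2. closedin Z E1 \<and> closedin Z E2 \<and> A \<subseteq> E1 \<union> E2 \<and> E1 \<inter> E2 \<inter> A = {} \<and> E1 \<inter> A \<noteq> {} \<and> E2 \<inter> A \<noteq> {})"
        using conA unfolding connectedin_closedin by (rule conjunct2)
      moreover have "\<exists>E1 E2. closedin Z E1 \<and> closedin Z E2 \<and> A \<subseteq> E1 \<union> E2 \<and> E1 \<inter> E2 \<inter> A = {} \<and> E1 \<inter> A \<noteq> {} \<and> E2 \<inter> A \<noteq> {}"
        by (rule exI [of _ E1], rule exI [of _ E2], intro conjI) (fact that)+
      ultimately show False by (rule notE)
    qed
    have "\<Union>(K ` (?D - {I})) \<inter> A = {}"
    proof (rule ccontr)
      assume ne: "\<Union>(K ` (?D - {I})) \<inter> A \<noteq> {}"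
      have "K I \<inter> \<Union>(K ` (?D - {I})) \<inter> A = {}" unfolding dis by simp
      moreover have "K I \<inter> A \<noteq> {}" using A(2) \<open>K I \<noteq> {}\<close> by (simp add: Int_absorb2)
      ultimately show False using no [OF c1 c2 cover _ _ ne] by simp
    qed
    then have "A = K I" using cover A(2) by blast
    then show ?thesis using A(1) by simp
  qed
  have "A \<in> K ` ?D" if A: "A \<in> connected_components_of Z" for A
  proof -
    have "A \<noteq> {}" using nonempty_connected_components_of A by blast
    moreover have "A \<subseteq> \<Union>(K ` ?D)"
      using connectedin_subset_topspace [OF connectedin_connected_components_of [OF A]] top by simp
    ultimately obtain I where I: "I \<in> ?D" "A \<inter> K I \<noteq> {}" by blast
    have "A = K I"
      using connected_components_of_overlap [OF A comp [OF I(1)]] I(2) by (rule iffD1)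
    then show ?thesis using I by blast
  qed
  then have "connected_components_of Z = K ` ?D" using comp by (intro equalityI subsetI) auto
  then show ?thesis unfolding Z_def .
qed

end

theorem theorem4p12:
  fixes P :: "(real^3) set" and lam :: "(real^3) set \<Rightarrow> bit^3"
    and Xt :: "'x topology" and q :: "(real^3) \<times> (bit^3) \<Rightarrow> 'x"
    and Yt :: "'y topology" and r :: "'x \<Rightarrow> 'y" and g :: "bit^3"
  assumes "simple_3polytope P"
    and "char_fun P lam"
    and "hamiltonian_cf P lam"
    and "small_cover_quot P lam Xt q"
    and "orientable3 Xt"
    and "orient_pres P Xt q g" and "g \<noteq> 0"
    and "quotient_map Xt Yt r"
    and "\<forall>x\<in>topspace Xt. \<forall>y\<in>topspace Xt. r x = r y \<longleftrightarrow> (y = x \<or> y = sc_act P q g x)"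
    and "Yt homeomorphic_space S3"
  shows "let C = {I\<in>p_edges P. edge_label P lam I \<noteq> g};
             L = r ` {x\<in>topspace Xt. sc_act P q g x = x};
             K = (\<lambda>I. r ` q ` (I \<times> UNIV))
         in ham_cycle P C \<and>
            connected_components_of (subtopology Yt L) = K ` (p_edges P - C) \<and>
            inj_on K (p_edges P - C) \<and>
            (\<forall>I\<in>p_edges P - C. trivial_knot Yt (K I)) \<and>
            (\<forall>num. path_numbering P C num \<longrightarrow>
               (\<forall>I\<in>p_edges P - C. \<forall>J\<in>p_edges P - C. I \<noteq> J \<longrightarrow>
                  (\<not> split_link Yt (K I) (K J) \<longleftrightarrow> chords_intersect P num I J)))"
proof -
  interpret b: branched P lam Xt q Yt r g
    by unfold_locales (fact assms)+
  have "\<exists>a b c. card {a, b, c} = 3 \<and> z2_indep id {a, b, c} \<and> lam ` p_facets P = {a, b, c, a + b + c}"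
    using assms(3) unfolding hamiltonian_cf_def by (elim exE conjE) (intro exI conjI, assumption+)
  then obtain a b c where abc: "card {a, b, c} = 3" "z2_indep id {a, b, c}" "lam ` p_facets P = {a, b, c, a + b + c}"
    by (elim exE conjE)
  have "g \<notin> {a, b, c, a + b + c}"
    unfolding abc(3) [symmetric] using b.lam_neq_g by (metis imageE)
  then obtain k1 k2 where "splitting k1 k2 {a, b, c, a + b + c} g"
    by (rule splitting_exists [OF abc(1,2) assms(7)])
  then have spl: "splitting k1 k2 (lam ` p_facets P) g"
    by (simp only: abc(3))
  interpret s: branched_split P lam Xt q Yt r g k1 k2
    by unfold_locales (rule spl)
  have K: "(\<lambda>I. r ` q ` (I \<times> UNIV)) = s.K"
    by (simp add: fun_eq_iff s.K_def b.R_def image_comp)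
  have ham: "ham_cycle P s.C"
    by (rule s.hamiltonian [OF s.C_connected])
  have trivial: "\<forall>I\<in>p_edges P - s.C. trivial_knot Yt (s.K I)"
    using s.chords_trivial by (rule ballI)
  have linking: "\<forall>num. path_numbering P s.C num \<longrightarrow>
      (\<forall>I\<in>p_edges P - s.C. \<forall>J\<in>p_edges P - s.C. I \<noteq> J \<longrightarrow>
        (\<not> split_link Yt (s.K I) (s.K J) \<longleftrightarrow> chords_intersect P num I J))"
    by (intro allI impI ballI) (rule s.chords_linking)
  show ?thesis
    unfolding Let_def K s.C_edge_label [symmetric] s.fixed_points
    by (rule conjI [OF ham conjI [OF s.link_components conjI [OF s.K_inj conjI [OF trivial linking]]]])
qed

end
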